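(* Let $K$ be a field, let $H\subseteq K[x_0,\dots,x_{n-1}]$ be a homogeneous ideal and let $\prec$ be a term order on the terms in $x_0,\dots,x_{n-1}$. Let $K[C]$ and the ideal $\mathfrak h_0\subseteq K[C]$ be constructed from $H$ and $\prec$ as described in the context. Then the affine scheme $\operatorname{Spec}(K[C]/\mathfrak h_0)$ represents the functor of liftings $\underline{\mathrm L}_H$ from Noetherian $K$-algebras to sets.
   Context: Notation: $\mathbf x=\{x_0,\dots,x_{n-1}\}$, with variables ordered $x_0>\dots>x_{n-1}>x_n$; rings are commutative with unit $1\ne 0$, and $K$-algebras are Noetherian. For a $K$-algebra $A$, $A[\mathbf x]=A\otimes_K K[\mathbf x]$ and $A[\mathbf x,x_n]=A\otimes_K K[\mathbf x,x_n]$; homogeneity is with respect to the variables $\mathbf x,x_n$. A term is a monic monomial $x^\alpha$, and $|\alpha|$ is its degree. Lifting: for a homogeneous ideal $H\subseteq K[\mathbf x]$ and a Noetherian $K$-algebra $A$, a homogeneous ideal $I\subseteq A[\mathbf x,x_n]$ is an $x_n$-lifting of $H$ if (a) $x_n$ is not a zero-divisor in $A[\mathbf x,x_n]/I$ and (b) $\{g(x_0,\dots,x_{n-1},0): g\in I\}=H A[\mathbf x]$. The functor of liftings $\underline{\mathrm L}_H$ sends a Noetherian $K$-algebra $A$ to the set of $x_n$-liftings of $H$ in $A[\mathbf x,x_n]$, and a $K$-algebra morphism $\phi:A\to B$ to the map $I\mapsto I\otimes_A B:=I\,B[\mathbf x,x_n]$ (the extended ideal). Degreverse order: given a term order $\prec$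 on terms in $\mathbf x$, $\prec_n$ is the graded term order on terms in $\mathbf x,x_n$ such that for terms of the same degree $x^\alpha\prec_n x^\beta$ iff $\alpha_n>\beta_n$, or $\alpha_n=\beta_n$ and $x^\alpha/x_n^{\alpha_n}\prec x^\beta/x_n^{\beta_n}$. Construction of $\mathfrak h_0$: let $\{f_\alpha\}_\alpha$ be the reduced Gröbner basis of $H$ w.r.t. $\prec$, where $f_\alpha$ has head term $x^\alpha$ and $x^\alpha$ runs over the minimal monomial generators of $\mathrm{in}_\prec(H)$. Let $J=\mathrm{in}_\prec(H)K[\mathbf x,x_n]$ and let $\mathcal N(J)_d$ be the set of terms of degree $d$ in $\mathbf x,x_n$ not in $J$. Put $g_\alpha=\sum_{x_nx^\gamma\in\mathcal N(J)_{|\alpha|}}C_{\alpha\gamma}\,x_nx^\gamma$, where the $C_{\alpha\gamma}$ are new variables and $x^\gamma$ is a term in $\mathbf x,x_n$; let $C$ be the set of all $C_{\alpha\gamma}$ and $\mathcal G=\{f_\alpha+g_\alpha\}_\alpha\subset K[C][\mathbf x,x_n]$. Extend $\prec_n$ to an elimination order of $\mathbf x,x_n$ on $K[C][\mathbf x,x_n]$ (terms are compared first by their $\mathbf x,x_n$-part via $\prec_n$, then by a fixed term order on $K[C]$). Then $\mathfrak h_0\subseteq K[C]$ is the ideal generated by the coefficients (in $K[C]$) of the terms in $\mathbf x,x_n$ in a complete reduction by $\mathcal G$ with respect to $\prec_n$ of the $S$-polynomial $S(f_\alpha+g_\alpha,f_{\alpha'}+g_{\alpha'})$, for all pairs $\alpha,\alpha'$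 (this ideal does not depend on the chosen complete reductions). *)

theory Defs
  imports "HOL-Algebra.Ring_Divisibility" "HOL-Algebra.Module" "HOL-Library.Multiset"
begin

section \<open>Polynomial rings over a carrier ring\<close>

text \<open>As in \<open>HOL-Algebra.Indexed_Polynomials\<close>, a term is the multiset of its
  variables and a polynomial is its coefficient function. A polynomial in fewer variables is thus
  literally also a polynomial in more variables. For a term \<open>m\<close>, divisibility is
  \<open>\<subseteq>#\<close>, the least common multiple is \<open>\<union>#\<close>, the degree is \<open>size m\<close>.\<close>

definition terms :: "'v set \<Rightarrow> 'v multiset set" where
  "terms V = {m. set_mset m \<subseteq> V}"

definition supp :: "('a, 'e) ring_scheme \<Rightarrow> ('v multiset \<Rightarrow> 'a) \<Rightarrow> 'v multiset set" where
  "supp R p = {m. p m \<noteq> \<zero>\<^bsub>R\<^esub>}"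

definition monom :: "('a, 'e) ring_scheme \<Rightarrow> 'a \<Rightarrow> 'v multiset \<Rightarrow> 'v multiset \<Rightarrow> 'a" where
  "monom R a m = (\<lambda>t. if t = m then a else \<zero>\<^bsub>R\<^esub>)"

definition mpoly :: "('a, 'e) ring_scheme \<Rightarrow> 'v set \<Rightarrow> ('a, 'v multiset \<Rightarrow> 'a) module" where
  "mpoly R V =
    \<lparr>carrier = {p. (\<forall>m. p m \<in> carrier R) \<and> finite (supp R p) \<and> supp R p \<subseteq> terms V},
     mult = (\<lambda>p q m. \<Oplus>\<^bsub>R\<^esub>t\<in>{t. t \<subseteq># m}. p t \<otimes>\<^bsub>R\<^esub> q (m - t)),
     one = monom R \<one>\<^bsub>R\<^esub> {#},
     zero = (\<lambda>m. \<zero>\<^bsub>R\<^esub>),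
     add = (\<lambda>p q m. p m \<oplus>\<^bsub>R\<^esub> q m),
     smult = (\<lambda>a p m. a \<otimes>\<^bsub>R\<^esub> p m)\<rparr>"

definition hom_component :: "('a, 'e) ring_scheme \<Rightarrow> nat \<Rightarrow> ('v multiset \<Rightarrow> 'a) \<Rightarrow> 'v multiset \<Rightarrow> 'a" where
  "hom_component R d p = (\<lambda>m. if size m = d then p m else \<zero>\<^bsub>R\<^esub>)"

definition homogeneous_ideal :: "('a, 'e) ring_scheme \<Rightarrow> 'v set \<Rightarrow> ('v multiset \<Rightarrow> 'a) set \<Rightarrow> bool" where
  "homogeneous_ideal R V I \<longleftrightarrow> ideal I (mpoly R V) \<and> (\<forall>f\<in>I. \<forall>d. hom_component R d f \<in> I)"


section \<open>Term orders, Groebner bases and reduction\<close>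

text \<open>Orders on terms are strict; only their values on \<open>terms V\<close> matter.\<close>

definition term_order :: "'v set \<Rightarrow> ('v multiset \<Rightarrow> 'v multiset \<Rightarrow> bool) \<Rightarrow> bool" where
  "term_order V prec \<longleftrightarrow>
    (\<forall>s\<in>terms V. \<not> prec s s) \<and>
    (\<forall>s\<in>terms V. \<forall>t\<in>terms V. \<forall>u\<in>terms V. prec s t \<longrightarrow> prec t u \<longrightarrow> prec s u) \<and>
    (\<forall>s\<in>terms V. \<forall>t\<in>terms V. s \<noteq> t \<longrightarrow> prec s t \<or> prec t s) \<and>
    (\<forall>s\<in>terms V. s \<noteq> {#} \<longrightarrow> prec {#} s) \<and>
    (\<forall>s\<in>terms V. \<forall>t\<in>terms V. \<forall>u\<in>terms V. prec s t \<longrightarrow> prec (s + u) (t + u))"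

definition head_term ::
  "('a, 'e) ring_scheme \<Rightarrow> ('v multiset \<Rightarrow> 'v multiset \<Rightarrow> bool) \<Rightarrow> ('v multiset \<Rightarrow> 'a) \<Rightarrow> 'v multiset" where
  "head_term R prec p = (THE m. m \<in> supp R p \<and> (\<forall>t\<in>supp R p. t = m \<or> prec t m))"

definition head_coeff ::
  "('a, 'e) ring_scheme \<Rightarrow> ('v multiset \<Rightarrow> 'v multiset \<Rightarrow> bool) \<Rightarrow> ('v multiset \<Rightarrow> 'a) \<Rightarrow> 'a" where
  "head_coeff R prec p = p (head_term R prec p)"

definition head_terms_ideal ::
  "('a, 'e) ring_scheme \<Rightarrow> 'v set \<Rightarrow> ('v multiset \<Rightarrow> 'v multiset \<Rightarrow> bool)
    \<Rightarrow> ('v multiset \<Rightarrow> 'a) set \<Rightarrow> ('v multiset \<Rightarrow> 'a) set" where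
  "head_terms_ideal R V prec F =
    Idl\<^bsub>mpoly R V\<^esub> {monom R \<one>\<^bsub>R\<^esub> (head_term R prec f) | f. f \<in> F \<and> f \<noteq> \<zero>\<^bsub>mpoly R V\<^esub>}"

definition is_reduced_groebner_basis ::
  "('a, 'e) ring_scheme \<Rightarrow> 'v set \<Rightarrow> ('v multiset \<Rightarrow> 'v multiset \<Rightarrow> bool)
    \<Rightarrow> ('v multiset \<Rightarrow> 'a) set \<Rightarrow> ('v multiset \<Rightarrow> 'a) set \<Rightarrow> bool" where
  "is_reduced_groebner_basis R V prec H G \<longleftrightarrow>
    finite G \<and> G \<subseteq> H \<and> \<zero>\<^bsub>mpoly R V\<^esub> \<notin> G \<and>
    head_terms_ideal R V prec G = head_terms_ideal R V prec H \<and>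
    (\<forall>g\<in>G. head_coeff R prec g = \<one>\<^bsub>R\<^esub>) \<and>
    (\<forall>g\<in>G. \<forall>g'\<in>G - {g}. \<forall>m\<in>supp R g. \<not> head_term R prec g' \<subseteq># m)"

definition spoly ::
  "('a, 'e) ring_scheme \<Rightarrow> 'v set \<Rightarrow> ('v multiset \<Rightarrow> 'v multiset \<Rightarrow> bool)
    \<Rightarrow> ('v multiset \<Rightarrow> 'a) \<Rightarrow> ('v multiset \<Rightarrow> 'a) \<Rightarrow> ('v multiset \<Rightarrow> 'a)" where
  "spoly R V prec p q =
    (let l = head_term R prec p \<union># head_term R prec q in
      (monom R (inv\<^bsub>R\<^esub> head_coeff R prec p) (l - head_term R prec p) \<otimes>\<^bsub>mpoly R V\<^esub> p)
      \<ominus>\<^bsub>mpoly R V\<^esub>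
      (monom R (inv\<^bsub>R\<^esub> head_coeff R prec q) (l - head_term R prec q) \<otimes>\<^bsub>mpoly R V\<^esub> q))"

text \<open>A single reduction step cancels any (not necessarily the leading) term of \<open>h\<close> that
  is divisible by a head term of \<open>G\<close>.\<close>

definition reduction_step ::
  "('a, 'e) ring_scheme \<Rightarrow> 'v set \<Rightarrow> ('v multiset \<Rightarrow> 'v multiset \<Rightarrow> bool)
    \<Rightarrow> ('v multiset \<Rightarrow> 'a) set \<Rightarrow> ('v multiset \<Rightarrow> 'a) \<Rightarrow> ('v multiset \<Rightarrow> 'a) \<Rightarrow> bool" where
  "reduction_step R V prec G h h' \<longleftrightarrow>
    (\<exists>g\<in>G. \<exists>m. g \<noteq> \<zero>\<^bsub>mpoly R V\<^esub> \<and> m + head_term R prec g \<in> supp R h \<and>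
      h' = h \<ominus>\<^bsub>mpoly R V\<^esub>
        (monom R (h (m + head_term R prec g) \<otimes>\<^bsub>R\<^esub> inv\<^bsub>R\<^esub> head_coeff R prec g) m \<otimes>\<^bsub>mpoly R V\<^esub> g))"

definition is_complete_reduction ::
  "('a, 'e) ring_scheme \<Rightarrow> 'v set \<Rightarrow> ('v multiset \<Rightarrow> 'v multiset \<Rightarrow> bool)
    \<Rightarrow> ('v multiset \<Rightarrow> 'a) set \<Rightarrow> ('v multiset \<Rightarrow> 'a) \<Rightarrow> ('v multiset \<Rightarrow> 'a) \<Rightarrow> bool" where
  "is_complete_reduction R V prec G h r \<longleftrightarrow>
    (reduction_step R V prec G)\<^sup>*\<^sup>* h r \<and> (\<nexists>r'. reduction_step R V prec G r r')"

definition degrevorder :: "nat \<Rightarrow> (nat multiset \<Rightarrow> nat multiset \<Rightarrow> bool) \<Rightarrow> nat multiset \<Rightarrow> nat multiset \<Rightarrow> bool" where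
  "degrevorder n prec a b \<longleftrightarrow>
    size a < size b \<or>
    size a = size b \<and>
      (count a n > count b n \<or>
       count a n = count b n \<and>
         prec (a - replicate_mset (count a n) n) (b - replicate_mset (count b n) n))"


section \<open>Noetherian algebras and representability\<close>

definition noetherian_algebra :: "('k, 'e) ring_scheme \<Rightarrow> ('k, 'a) module \<Rightarrow> bool" where
  "noetherian_algebra K A \<longleftrightarrow> algebra K A \<and> noetherian_ring A \<and> \<one>\<^bsub>A\<^esub> \<noteq> \<zero>\<^bsub>A\<^esub>"

text \<open>Morphisms are extensional, so that they are determined by their values on the carrier.\<close>

definition alg_hom :: "('k, 'e) ring_scheme \<Rightarrow> ('k, 'a) module \<Rightarrow> ('k, 'b) module \<Rightarrow> ('a \<Rightarrow> 'b) set" where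
  "alg_hom K A B =
    {h \<in> ring_hom A B \<inter> extensional (carrier A).
      \<forall>k\<in>carrier K. \<forall>x\<in>carrier A. h (k \<odot>\<^bsub>A\<^esub> x) = k \<odot>\<^bsub>B\<^esub> h x}"

definition quot_algebra :: "('k, 'a) module \<Rightarrow> 'a set \<Rightarrow> ('k, 'a set) module" where
  "quot_algebra A I =
    \<lparr>carrier = carrier (A Quot I), mult = mult (A Quot I), one = one (A Quot I),
     zero = zero (A Quot I), add = add (A Quot I),
     smult = (\<lambda>k X. (I +>\<^bsub>A\<^esub> (k \<odot>\<^bsub>A\<^esub> \<one>\<^bsub>A\<^esub>)) \<otimes>\<^bsub>A Quot I\<^esub> X)\<rparr>"

text \<open>\<open>Spec R\<close> represents a set-valued functor \<open>F\<close> (with action \<open>Fmap\<close> on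
  morphisms) on Noetherian \<open>K\<close>-algebras if the functors \<open>Hom\<^sub>K(R, -)\<close>, which is
  \<open>Mor\<^sub>K(Spec -, Spec R)\<close>, and \<open>F\<close> are naturally isomorphic. The test algebras
  range over all those with elements in the type \<open>'u\<close>, which plays the role of a universe and
  is arbitrary. Naturality and surjectivity of \<open>\<eta>\<close> contain the claim that
  \<open>Fmap A B \<psi>\<close> maps \<open>F A\<close> to \<open>F B\<close>.\<close>

definition represents ::
  "('k, 'e) ring_scheme \<Rightarrow> ('k, 'r) module \<Rightarrow> (('k, 'u) module \<Rightarrow> 's set)
    \<Rightarrow> (('k, 'u) module \<Rightarrow> ('k, 'u) module \<Rightarrow> ('u \<Rightarrow> 'u) \<Rightarrow> 's \<Rightarrow> 's) \<Rightarrow> bool" where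
  "represents K R F Fmap \<longleftrightarrow>
    noetherian_algebra K R \<and>
    (\<exists>\<eta> :: ('k, 'u) module \<Rightarrow> ('r \<Rightarrow> 'u) \<Rightarrow> 's.
      (\<forall>A. noetherian_algebra K A \<longrightarrow> bij_betw (\<eta> A) (alg_hom K R A) (F A)) \<and>
      (\<forall>A B. noetherian_algebra K A \<longrightarrow> noetherian_algebra K B \<longrightarrow>
        (\<forall>\<phi>\<in>alg_hom K R A. \<forall>\<psi>\<in>alg_hom K A B.
          \<eta> B (compose (carrier R) \<psi> \<phi>) = Fmap A B \<psi> (\<eta> A \<phi>))))"


section \<open>The functor of liftings\<close>

text \<open>The variables \<open>x\<^sub>0, \<dots>, x\<^sub>n\<close> are indexed by \<open>0, \<dots>, n\<close>: \<open>A[\<bold>x]\<close> is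
  \<open>mpoly A {..<n}\<close> and \<open>A[\<bold>x, x\<^sub>n]\<close> is \<open>mpoly A {..n}\<close>.\<close>

definition extended_ideal_from_field ::
  "('k, 'a) module \<Rightarrow> 'v set \<Rightarrow> ('v multiset \<Rightarrow> 'k) set \<Rightarrow> ('v multiset \<Rightarrow> 'a) set" where
  "extended_ideal_from_field A V H = Idl\<^bsub>mpoly A V\<^esub> ((\<lambda>f m. f m \<odot>\<^bsub>A\<^esub> \<one>\<^bsub>A\<^esub>) ` H)"

text \<open>No properness of \<open>I\<close> is required; for \<open>H = K[\<bold>x]\<close> the unit ideal is the
  (only) lifting, every element being a non-zero-divisor in the zero ring.\<close>

definition liftings ::
  "nat \<Rightarrow> (nat multiset \<Rightarrow> 'k) set \<Rightarrow> ('k, 'a) module \<Rightarrow> (nat multiset \<Rightarrow> 'a) set set" where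
  "liftings n H A =
    {I. homogeneous_ideal A {..n} I \<and>
        (\<forall>y\<in>carrier (mpoly A {..n} Quot I).
          (I +>\<^bsub>mpoly A {..n}\<^esub> monom A \<one>\<^bsub>A\<^esub> {#n#}) \<otimes>\<^bsub>mpoly A {..n} Quot I\<^esub> y = \<zero>\<^bsub>mpoly A {..n} Quot I\<^esub>
          \<longrightarrow> y = \<zero>\<^bsub>mpoly A {..n} Quot I\<^esub>) \<and>
        (\<lambda>g m. if n \<in># m then \<zero>\<^bsub>A\<^esub> else g m) ` I = extended_ideal_from_field A {..<n} H}"

definition liftings_map ::
  "nat \<Rightarrow> ('k, 'a) module \<Rightarrow> ('k, 'b) module \<Rightarrow> ('a \<Rightarrow> 'b)
    \<Rightarrow> (nat multiset \<Rightarrow> 'a) set \<Rightarrow> (nat multiset \<Rightarrow> 'b) set" where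
  "liftings_map n A B \<phi> I = Idl\<^bsub>mpoly B {..n}\<^esub> ((\<lambda>g m. \<phi> (g m)) ` I)"


section \<open>The ideal \<open>\<hh>\<^sub>0\<close>\<close>

definition initial_ideal ::
  "('k, 'e) ring_scheme \<Rightarrow> nat \<Rightarrow> (nat multiset \<Rightarrow> nat multiset \<Rightarrow> bool)
    \<Rightarrow> (nat multiset \<Rightarrow> 'k) set \<Rightarrow> (nat multiset \<Rightarrow> 'k) set" where
  "initial_ideal K n prec H = head_terms_ideal K {..<n} prec H"

definition minimal_generators ::
  "('k, 'e) ring_scheme \<Rightarrow> nat \<Rightarrow> (nat multiset \<Rightarrow> nat multiset \<Rightarrow> bool)
    \<Rightarrow> (nat multiset \<Rightarrow> 'k) set \<Rightarrow> nat multiset set" where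
  "minimal_generators K n prec H =
    {\<alpha> \<in> terms {..<n}. monom K \<one>\<^bsub>K\<^esub> \<alpha> \<in> initial_ideal K n prec H \<and>
      (\<forall>\<beta>. \<beta> \<subset># \<alpha> \<longrightarrow> monom K \<one>\<^bsub>K\<^esub> \<beta> \<notin> initial_ideal K n prec H)}"

definition groebner_element ::
  "('k, 'e) ring_scheme \<Rightarrow> nat \<Rightarrow> (nat multiset \<Rightarrow> nat multiset \<Rightarrow> bool)
    \<Rightarrow> (nat multiset \<Rightarrow> 'k) set \<Rightarrow> nat multiset \<Rightarrow> nat multiset \<Rightarrow> 'k" where
  "groebner_element K n prec H \<alpha> =
    (THE f. f \<in> (THE G. is_reduced_groebner_basis K {..<n} prec H G) \<and> head_term K prec f = \<alpha>)"

definition normal_terms ::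
  "('k, 'e) ring_scheme \<Rightarrow> nat \<Rightarrow> (nat multiset \<Rightarrow> nat multiset \<Rightarrow> bool)
    \<Rightarrow> (nat multiset \<Rightarrow> 'k) set \<Rightarrow> nat \<Rightarrow> nat multiset set" where
  "normal_terms K n prec H d =
    {m \<in> terms {..n}. size m = d \<and>
      monom K \<one>\<^bsub>K\<^esub> m \<notin> Idl\<^bsub>mpoly K {..n}\<^esub> (initial_ideal K n prec H)}"

text \<open>The variable \<open>C\<^sub>\<alpha>\<^sub>\<gamma>\<close> is the pair \<open>(\<alpha>, \<gamma>)\<close>.\<close>

type_synonym cvar = "nat multiset \<times> nat multiset"

definition cvars ::
  "('k, 'e) ring_scheme \<Rightarrow> nat \<Rightarrow> (nat multiset \<Rightarrow> nat multiset \<Rightarrow> bool)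
    \<Rightarrow> (nat multiset \<Rightarrow> 'k) set \<Rightarrow> cvar set" where
  "cvars K n prec H =
    {(\<alpha>, \<gamma>). \<alpha> \<in> minimal_generators K n prec H \<and>
      add_mset n \<gamma> \<in> normal_terms K n prec H (size \<alpha>)}"

text \<open>\<open>K[C][\<bold>x, x\<^sub>n]\<close> is the polynomial ring over \<open>K\<close> in the disjoint union of \<open>C\<close>
  and \<open>{..n}\<close>, whose terms are products of a \<open>C\<close>-part and an \<open>\<bold>x, x\<^sub>n\<close>-part.\<close>

definition cpart :: "('c + nat) multiset \<Rightarrow> 'c multiset" where
  "cpart m = image_mset projl (filter_mset isl m)"

definition xpart :: "('c + nat) multiset \<Rightarrow> nat multiset" where
  "xpart m = image_mset projr (filter_mset (\<lambda>v. \<not> isl v) m)"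

definition elimination_order ::
  "(nat multiset \<Rightarrow> nat multiset \<Rightarrow> bool) \<Rightarrow> ('c multiset \<Rightarrow> 'c multiset \<Rightarrow> bool)
    \<Rightarrow> ('c + nat) multiset \<Rightarrow> ('c + nat) multiset \<Rightarrow> bool" where
  "elimination_order prec precC a b \<longleftrightarrow>
    prec (xpart a) (xpart b) \<or> xpart a = xpart b \<and> precC (cpart a) (cpart b)"

definition coeff_of_xterm :: "(('c + nat) multiset \<Rightarrow> 'k) \<Rightarrow> nat multiset \<Rightarrow> 'c multiset \<Rightarrow> 'k" where
  "coeff_of_xterm p m = (\<lambda>\<delta>. p (image_mset Inl \<delta> + image_mset Inr m))"

definition all_vars ::
  "('k, 'e) ring_scheme \<Rightarrow> nat \<Rightarrow> (nat multiset \<Rightarrow> nat multiset \<Rightarrow> bool)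
    \<Rightarrow> (nat multiset \<Rightarrow> 'k) set \<Rightarrow> (cvar + nat) set" where
  "all_vars K n prec H = cvars K n prec H <+> {..n}"

text \<open>The element \<open>f\<^sub>\<alpha> + g\<^sub>\<alpha>\<close>; the first sum is \<open>f\<^sub>\<alpha>\<close> with each \<open>x\<^sub>i\<close> renamed
  to \<open>Inr i\<close>.\<close>

definition generic_element ::
  "('k, 'e) ring_scheme \<Rightarrow> nat \<Rightarrow> (nat multiset \<Rightarrow> nat multiset \<Rightarrow> bool)
    \<Rightarrow> (nat multiset \<Rightarrow> 'k) set \<Rightarrow> nat multiset \<Rightarrow> (cvar + nat) multiset \<Rightarrow> 'k" where
  "generic_element K n prec H \<alpha> =
    (let P = mpoly K (all_vars K n prec H); f = groebner_element K n prec H \<alpha> in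
      (\<Oplus>\<^bsub>P\<^esub>m\<in>supp K f. monom K (f m) (image_mset Inr m))
      \<oplus>\<^bsub>P\<^esub>
      (\<Oplus>\<^bsub>P\<^esub>\<gamma>\<in>{\<gamma>. add_mset n \<gamma> \<in> normal_terms K n prec H (size \<alpha>)}.
         monom K \<one>\<^bsub>K\<^esub> (add_mset (Inl (\<alpha>, \<gamma>)) (image_mset Inr (add_mset n \<gamma>)))))"

text \<open>A choice \<open>red\<close> of complete reductions of all S-polynomials, and the ideal generated by
  their coefficients in \<open>K[C]\<close>. The ideal does not depend on the choice, but this is not
  built in: \<open>red\<close> is a parameter.\<close>

definition spoly_complete_reductions ::
  "('k, 'e) ring_scheme \<Rightarrow> nat \<Rightarrow> (nat multiset \<Rightarrow> nat multiset \<Rightarrow> bool)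
    \<Rightarrow> (cvar multiset \<Rightarrow> cvar multiset \<Rightarrow> bool) \<Rightarrow> (nat multiset \<Rightarrow> 'k) set
    \<Rightarrow> (nat multiset \<Rightarrow> nat multiset \<Rightarrow> (cvar + nat) multiset \<Rightarrow> 'k) \<Rightarrow> bool" where
  "spoly_complete_reductions K n prec precC H red \<longleftrightarrow>
    (let V = all_vars K n prec H;
         eprec = elimination_order (degrevorder n prec) precC;
         M = minimal_generators K n prec H;
         G = generic_element K n prec H in
      \<forall>\<alpha>\<in>M. \<forall>\<alpha>'\<in>M.
        is_complete_reduction K V eprec (G ` M) (spoly K V eprec (G \<alpha>) (G \<alpha>')) (red \<alpha> \<alpha>'))"

definition h0 ::
  "('k, 'e) ring_scheme \<Rightarrow> nat \<Rightarrow> (nat multiset \<Rightarrow> nat multiset \<Rightarrow> bool)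
    \<Rightarrow> (nat multiset \<Rightarrow> 'k) set
    \<Rightarrow> (nat multiset \<Rightarrow> nat multiset \<Rightarrow> (cvar + nat) multiset \<Rightarrow> 'k) \<Rightarrow> (cvar multiset \<Rightarrow> 'k) set" where
  "h0 K n prec H red =
    Idl\<^bsub>mpoly K (cvars K n prec H)\<^esub>
      {coeff_of_xterm (red \<alpha> \<alpha>') m | \<alpha> \<alpha>' m.
        \<alpha> \<in> minimal_generators K n prec H \<and> \<alpha>' \<in> minimal_generators K n prec H \<and> m \<in> terms {..n}}"

end

theory Submission
  imports Defs
begin

text \<open>
  Write \<open>f\<^sub>\<alpha>\<close> for the reduced Groebner basis of \<open>H\<close>, indexed by its set \<open>M\<close> of head terms, and
  call a term standard if no \<open>\<alpha> \<in> M\<close> divides it. Over a \<open>K\<close>-algebra \<open>A\<close>, a family \<open>c\<close> of elements of \<open>A\<close>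
  indexed by the variables \<open>C\<close> specializes the generic elements \<open>f\<^sub>\<alpha> + g\<^sub>\<alpha>\<close> to polynomials
  \<open>lift c \<alpha>\<close> in \<open>A[\<bold>x, x\<^sub>n]\<close>. They are homogeneous, restrict to \<open>f\<^sub>\<alpha>\<close> at \<open>x\<^sub>n = 0\<close>, and have
  head term \<open>\<alpha>\<close> with coefficient 1 for the degree reverse order. Let \<open>lift_ideal c\<close> be the ideal
  that they generate. A homomorphism from \<open>K[C]/\<hh>\<^sub>0\<close> to \<open>A\<close> is a family \<open>c\<close> at which \<open>\<hh>\<^sub>0\<close> vanishes, and
  the natural bijection sends it to \<open>lift_ideal c\<close>. It rests on three facts.

  Every lifting \<open>I\<close> is \<open>lift_ideal c\<close> for exactly one \<open>c\<close>. Indeed, \<open>A[\<bold>x]\<close> is the direct sum of \<open>H A[\<bold>x]\<close>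
  and the span of the standard terms in \<open>\<bold>x\<close>. Because \<open>x\<^sub>n\<close> is a non-zero-divisor modulo \<open>I\<close> and does not
  divide any \<open>\<alpha>\<close>, an induction on the degree extends this to
  \<open>A[\<bold>x, x\<^sub>n]\<close> and \<open>I\<close> (\<open>standard_in_lifting\<close>, \<open>lifting_normal_form\<close>). The normal form of \<open>f\<^sub>\<alpha>\<close>
  modulo \<open>I\<close> is a multiple of \<open>x\<^sub>n\<close>, and its coefficients determine \<open>c\<close> (\<open>lifting_contains_lift\<close>,
  \<open>lift_unique\<close>); division by the \<open>lift c \<alpha>\<close> shows that they generate \<open>I\<close>
  (\<open>lifting_eq_lift_ideal\<close>).

  Conversely, \<open>lift_ideal c\<close> is a lifting as soon as it contains no nonzero combination of
  standard terms, because then remainders modulo it are unique and multiplication by \<open>x\<^sub>n\<close> preserves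
  standardness (\<open>lift_ideal_lifting\<close>).

  Finally, this last condition says that \<open>\<hh>\<^sub>0\<close> vanishes at \<open>c\<close> (\<open>lifting_iff_eval_h0\<close>). Reductions over
  \<open>K[C]\<close> never divide by a coefficient involving \<open>C\<close>, so they may be evaluated at \<open>c\<close>: the remainder of
  an S-polynomial becomes a combination of standard terms congruent to the S-polynomial of
  \<open>lift c \<alpha>\<close> and \<open>lift c \<alpha>'\<close>. If there are no nonzero standard elements in the ideal, these
  remainders vanish; if the remainders vanish, Buchberger's criterion, which holds over any
  commutative ring for polynomials with head coefficient 1 (\<open>buchberger\<close>), gives the condition.

  That \<open>K[C]/\<hh>\<^sub>0\<close> is Noetherian follows from the existence of Groebner bases
  (\<open>mpoly_noetherian\<close>). It is not the zero ring because \<open>\<hh>\<^sub>0\<close> vanishes at \<open>c = 0\<close>, which corresponds to the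
  lifting \<open>H A[\<bold>x, x\<^sub>n]\<close> (\<open>standard_in_trivial_lift\<close>).
\<close>

section \<open>Polynomial rings\<close>

lemma finite_submultisets [simp]: "finite {t. t \<subseteq># m}"
proof -
  have "{t. t \<subseteq># add_mset x m} \<subseteq> {t. t \<subseteq># m} \<union> add_mset x ` {t. t \<subseteq># m}" for x and m :: "'a multiset"
  proof
    fix t assume "t \<in> {t. t \<subseteq># add_mset x m}"
    then have t: "t \<subseteq># add_mset x m" by simp
    show "t \<in> {t. t \<subseteq># m} \<union> add_mset x ` {t. t \<subseteq># m}"
    proof (cases "x \<in># t")
      case True
      then obtain u where "t = add_mset x u" by (metis insert_DiffM)
      then show ?thesis using t by auto
    next
      case False
      have "t \<subseteq># m"
      proof (rule mset_subset_eqI)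
        fix y show "count t y \<le> count m y"
          using mset_subset_eq_count[OF t, of y] False by (cases "y = x") (simp_all add: not_in_iff)
      qed
      then show ?thesis by simp
    qed
  qed
  then show ?thesis
    by (induction m) (auto intro: finite_subset)
qed

text \<open>Multiplication by a term. Since it does not mention the set of variables, it serves for
  polynomials in \<open>\<bold>x\<close> and in \<open>\<bold>x, x\<^sub>n\<close> alike.\<close>

definition shift :: "('a, 'e) ring_scheme \<Rightarrow> 'v multiset \<Rightarrow> ('v multiset \<Rightarrow> 'a) \<Rightarrow> 'v multiset \<Rightarrow> 'a" where
  "shift R s p = (\<lambda>m. if s \<subseteq># m then p (m - s) else \<zero>\<^bsub>R\<^esub>)"

lemma shift_add_term [simp]: "shift R s p (s + m) = p m" "shift R s p (m + s) = p m"
  by (simp_all add: shift_def)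

lemma terms_add [simp]: "s + t \<in> terms V \<longleftrightarrow> s \<in> terms V \<and> t \<in> terms V"
  by (auto simp: terms_def)

lemma terms_empty [simp]: "{#} \<in> terms V"
  by (auto simp: terms_def)

lemma terms_subset: "s \<subseteq># t \<Longrightarrow> t \<in> terms V \<Longrightarrow> s \<in> terms V"
  by (auto simp: terms_def dest: set_mset_mono)

lemma mpoly_mult:
  "mult (mpoly R V) = (\<lambda>p q m. \<Oplus>\<^bsub>R\<^esub>t\<in>{t. t \<subseteq># m}. p t \<otimes>\<^bsub>R\<^esub> q (m - t))"
  by (simp add: mpoly_def)

lemma mpoly_simps [simp]:
  "one (mpoly R V) = monom R \<one>\<^bsub>R\<^esub> {#}"
  "zero (mpoly R V) = (\<lambda>m. \<zero>\<^bsub>R\<^esub>)"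
  "add (mpoly R V) = (\<lambda>p q m. p m \<oplus>\<^bsub>R\<^esub> q m)"
  "smult (mpoly R V) = (\<lambda>a p m. a \<otimes>\<^bsub>R\<^esub> p m)"
  by (simp_all add: mpoly_def)

lemma mpoly_carrier:
  "p \<in> carrier (mpoly R V) \<longleftrightarrow> (\<forall>m. p m \<in> carrier R) \<and> finite (supp R p) \<and> supp R p \<subseteq> terms V"
  by (simp add: mpoly_def)

lemma mpoly_coeff_closed: "p \<in> carrier (mpoly R V) \<Longrightarrow> p m \<in> carrier R"
  by (simp add: mpoly_carrier)

lemma mpoly_term: "p \<in> carrier (mpoly R V) \<Longrightarrow> p m \<noteq> \<zero>\<^bsub>R\<^esub> \<Longrightarrow> m \<in> terms V"
  by (auto simp: mpoly_carrier supp_def)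

lemma mpoly_carrierI:
  assumes "\<And>m. p m \<in> carrier R" and "finite T" and "\<And>m. p m \<noteq> \<zero>\<^bsub>R\<^esub> \<Longrightarrow> m \<in> T \<and> m \<in> terms V"
  shows "p \<in> carrier (mpoly R V)"
  using assms by (auto simp: mpoly_carrier supp_def intro: finite_subset[of _ T])

lemma (in abelian_monoid) finsum_Sigma:
  assumes "finite A" and "\<And>x. x \<in> A \<Longrightarrow> finite (B x)"
    and "\<And>x y. x \<in> A \<Longrightarrow> y \<in> B x \<Longrightarrow> f x y \<in> carrier G"
  shows "(\<Oplus>x\<in>A. \<Oplus>y\<in>B x. f x y) = (\<Oplus>z\<in>Sigma A B. f (fst z) (snd z))"
  using assms
proof (induction A rule: finite_induct)
  case empty
  then show ?case by simp
next
  case (insert a A)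
  have 1: "(\<Oplus>z\<in>Pair a ` B a. f (fst z) (snd z)) = (\<Oplus>y\<in>B a. f a y)"
    using insert.prems by (subst finsum_reindex) (auto simp: inj_on_def)
  have "Sigma (insert a A) B = Pair a ` B a \<union> Sigma A B" by auto
  then have "(\<Oplus>z\<in>Sigma (insert a A) B. f (fst z) (snd z)) =
      (\<Oplus>z\<in>Pair a ` B a. f (fst z) (snd z)) \<oplus> (\<Oplus>z\<in>Sigma A B. f (fst z) (snd z))"
    using insert by (auto intro!: finsum_Un_disjoint)
  then show ?case
    using insert 1 by (subst finsum_insert) auto
qed

lemma (in abelian_monoid) finsum_single:
  assumes "finite A" and "\<And>x. x \<in> A \<Longrightarrow> x \<noteq> a \<Longrightarrow> f x = \<zero>" and "a \<in> A \<Longrightarrow> f a \<in> carrier G"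
  shows "(\<Oplus>x\<in>A. f x) = (if a \<in> A then f a else \<zero>)"
proof -
  have "(\<Oplus>x\<in>A. f x) = (\<Oplus>x\<in>A. if a = x then f a else \<zero>)"
    using assms by (intro finsum_cong') (auto simp: Pi_def)
  also have "\<dots> = (if a \<in> A then f a else \<zero>)"
    using finsum_singleton[of a A "\<lambda>x. f a"] assms by (auto intro: add.finprod_one_eqI)
  finally show ?thesis .
qed

context cring
begin

lemma monom_closed [simp]: "a \<in> carrier R \<Longrightarrow> s \<in> terms V \<Longrightarrow> monom R a s \<in> carrier (mpoly R V)"
  by (auto simp: monom_def intro!: mpoly_carrierI[of _ _ "{s}"] split: if_splits)

lemma mpoly_add_closed:
  "p \<in> carrier (mpoly R V) \<Longrightarrow> q \<in> carrier (mpoly R V) \<Longrightarrow> (\<lambda>m. p m \<oplus> q m) \<in> carrier (mpoly R V)"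
  by (rule mpoly_carrierI[of _ _ "supp R p \<union> supp R q"])
    (auto simp: mpoly_carrier supp_def subset_iff, metis l_zero zero_closed)

lemma mpoly_smult_closed:
  "a \<in> carrier R \<Longrightarrow> p \<in> carrier (mpoly R V) \<Longrightarrow> (\<lambda>m. a \<otimes> p m) \<in> carrier (mpoly R V)"
  by (rule mpoly_carrierI[of _ _ "supp R p"])
    (auto simp: mpoly_carrier supp_def)

lemma shift_closed:
  "s \<in> terms V \<Longrightarrow> p \<in> carrier (mpoly R V) \<Longrightarrow> shift R s p \<in> carrier (mpoly R V)"
proof (rule mpoly_carrierI[of _ _ "(\<lambda>m. s + m) ` supp R p"])
  assume *: "s \<in> terms V" "p \<in> carrier (mpoly R V)"
  fix m
  show "shift R s p m \<in> carrier R"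
    using * by (simp add: shift_def mpoly_coeff_closed)
  assume "shift R s p m \<noteq> \<zero>"
  then obtain u where "m = s + u" "p u \<noteq> \<zero>"
    by (auto simp: shift_def mset_subset_eq_exists_conv split: if_splits)
  then show "m \<in> (\<lambda>m. s + m) ` supp R p \<and> m \<in> terms V"
    using * mpoly_term[of p R V u] by (auto simp: supp_def)
qed (auto simp: mpoly_carrier)

lemma mpoly_mult_closed:
  assumes p: "p \<in> carrier (mpoly R V)" and q: "q \<in> carrier (mpoly R V)"
  shows "p \<otimes>\<^bsub>mpoly R V\<^esub> q \<in> carrier (mpoly R V)"
proof (rule mpoly_carrierI[of _ _ "(\<lambda>(s, t). s + t) ` (supp R p \<times> supp R q)"])
  fix m
  show "(p \<otimes>\<^bsub>mpoly R V\<^esub> q) m \<in> carrier R"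
    using p q by (auto simp: mpoly_carrier mpoly_mult)
  assume "(p \<otimes>\<^bsub>mpoly R V\<^esub> q) m \<noteq> \<zero>"
  then have "\<exists>t\<in>{t. t \<subseteq># m}. p t \<otimes> q (m - t) \<noteq> \<zero>"
    using add.finprod_one_eqI[of "{t. t \<subseteq># m}" "\<lambda>t. p t \<otimes> q (m - t)"]
    by (auto simp: mpoly_mult)
  then obtain t where t: "t \<subseteq># m" "p t \<otimes> q (m - t) \<noteq> \<zero>"
    by auto
  then have pq: "p t \<noteq> \<zero>" "q (m - t) \<noteq> \<zero>"
    using p q by (auto simp: mpoly_carrier)
  moreover have "m = t + (m - t)" using t by simp
  ultimately show "m \<in> (\<lambda>(s, t). s + t) ` (supp R p \<times> supp R q) \<and> m \<in> terms V"
    using mpoly_term[OF p pq(1)] mpoly_term[OF q pq(2)] 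
    by (metis (mono_tags, lifting) SigmaI case_prod_conv image_eqI mem_Collect_eq supp_def terms_add)
qed (use p q in \<open>auto simp: mpoly_carrier\<close>)

lemma monom_mult:
  assumes "a \<in> carrier R" and "\<And>m. q m \<in> carrier R"
  shows "monom R a s \<otimes>\<^bsub>mpoly R V\<^esub> q = (\<lambda>m. a \<otimes> shift R s q m)"
proof
  fix m
  have "(\<Oplus>t\<in>{t. t \<subseteq># m}. monom R a s t \<otimes> q (m - t)) = (if s \<in> {t. t \<subseteq># m} then monom R a s s \<otimes> q (m - s) else \<zero>)"
    using assms by (intro finsum_single) (auto simp: monom_def)
  then show "(monom R a s \<otimes>\<^bsub>mpoly R V\<^esub> q) m = a \<otimes> shift R s q m"
    using assms by (simp add: shift_def monom_def mpoly_mult)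
qed

lemma mpoly_mult_comm:
  assumes "\<And>m. p m \<in> carrier R" and "\<And>m. q m \<in> carrier R"
  shows "p \<otimes>\<^bsub>mpoly R V\<^esub> q = q \<otimes>\<^bsub>mpoly R V\<^esub> p"
proof
  fix m :: "'c multiset"
  let ?D = "{t. t \<subseteq># m}"
  have *: "m - (m - t) = t" if "t \<subseteq># m" for t
    using that by (auto simp: multiset_eq_iff subseteq_mset_def)
  have "(\<lambda>t. m - t) ` ?D = ?D"
    using * by (auto simp: image_iff) (metis diff_subset_eq_self)
  then have "(\<Oplus>t\<in>?D. p t \<otimes> q (m - t)) = (\<Oplus>t\<in>(\<lambda>t. m - t) ` ?D. p t \<otimes> q (m - t))"
    by simp
  also have "\<dots> = (\<Oplus>t\<in>?D. p (m - t) \<otimes> q (m - (m - t)))"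
    using assms * by (subst finsum_reindex) (auto simp: inj_on_def, metis)
  also have "\<dots> = (\<Oplus>t\<in>?D. q t \<otimes> p (m - t))"
    using assms * by (intro finsum_cong') (auto simp: m_comm)
  finally show "(p \<otimes>\<^bsub>mpoly R V\<^esub> q) m = (q \<otimes>\<^bsub>mpoly R V\<^esub> p) m"
    by (simp add: mpoly_mult)
qed

text \<open>Both sides sum over the factorizations of \<open>m\<close> into three terms: the pairs \<open>s \<subseteq># t \<subseteq># m\<close> on the
  left correspond to the pairs \<open>(s, u)\<close> with \<open>t = s + u\<close> on the right.\<close>

lemma mpoly_mult_assoc:
  assumes [simp]: "\<And>m. p m \<in> carrier R" "\<And>m. q m \<in> carrier R" "\<And>m. r m \<in> carrier R"
  shows "(p \<otimes>\<^bsub>mpoly R V\<^esub> q) \<otimes>\<^bsub>mpoly R V\<^esub> r = p \<otimes>\<^bsub>mpoly R V\<^esub> (q \<otimes>\<^bsub>mpoly R V\<^esub> r)"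
proof
  fix m :: "'c multiset"
  let ?D = "\<lambda>m :: 'c multiset. {t. t \<subseteq># m}"
  let ?L = "Sigma (?D m) ?D" and ?R = "Sigma (?D m) (\<lambda>s. ?D (m - s))"
  let ?h = "\<lambda>(s, u). (s + u, s)"
  have bij: "?h ` ?R = ?L"
  proof
    show "?h ` ?R \<subseteq> ?L"
      by (auto simp: subseteq_mset_def) (metis add.commute le_diff_conv2)
    show "?L \<subseteq> ?h ` ?R"
    proof
      fix z assume "z \<in> ?L"
      then obtain t s where z: "z = (t, s)" "t \<subseteq># m" "s \<subseteq># t" by auto
      then have "(s, t - s) \<in> ?R"
        by (auto simp: subseteq_mset_def diff_le_mono intro: order_trans)
      moreover have "z = ?h (s, t - s)" using z by simp
      ultimately show "z \<in> ?h ` ?R" by blast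
    qed
  qed
  have inj: "inj_on ?h ?R" by (auto simp: inj_on_def)
  have "(\<Oplus>t\<in>?D m. (\<Oplus>s\<in>?D t. p s \<otimes> q (t - s)) \<otimes> r (m - t))
      = (\<Oplus>t\<in>?D m. \<Oplus>s\<in>?D t. p s \<otimes> q (t - s) \<otimes> r (m - t))"
    by (intro finsum_cong') (auto simp: finsum_ldistr)
  also have "\<dots> = (\<Oplus>z\<in>?L. p (snd z) \<otimes> q (fst z - snd z) \<otimes> r (m - fst z))"
    by (subst finsum_Sigma) auto
  also have "\<dots> = (\<Oplus>z\<in>?R. p (snd (?h z)) \<otimes> q (fst (?h z) - snd (?h z)) \<otimes> r (m - fst (?h z)))"
    unfolding bij[symmetric] using inj by (subst finsum_reindex) (auto simp: split_def)
  also have "\<dots> = (\<Oplus>z\<in>?R. p (fst z) \<otimes> (q (snd z) \<otimes> r (m - fst z - snd z)))"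
    by (intro finsum_cong') (auto simp: m_assoc)
  also have "\<dots> = (\<Oplus>s\<in>?D m. \<Oplus>u\<in>?D (m - s). p s \<otimes> (q u \<otimes> r (m - s - u)))"
    by (subst finsum_Sigma) auto
  also have "\<dots> = (\<Oplus>s\<in>?D m. p s \<otimes> (\<Oplus>u\<in>?D (m - s). q u \<otimes> r (m - s - u)))"
    by (intro finsum_cong') (auto simp: finsum_rdistr)
  finally show "((p \<otimes>\<^bsub>mpoly R V\<^esub> q) \<otimes>\<^bsub>mpoly R V\<^esub> r) m = (p \<otimes>\<^bsub>mpoly R V\<^esub> (q \<otimes>\<^bsub>mpoly R V\<^esub> r)) m"
    by (simp add: mpoly_mult)
qed

lemma shift_empty [simp]: "shift R {#} q = q"
  by (auto simp: shift_def)

lemma mpoly_uminus_closed: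
  "p \<in> carrier (mpoly R V) \<Longrightarrow> (\<lambda>m. \<ominus> p m) \<in> carrier (mpoly R V)"
  by (rule mpoly_carrierI[of _ _ "supp R p"]) (auto simp: mpoly_carrier supp_def)

lemma mpoly_zero_closed: "(\<lambda>m. \<zero>) \<in> carrier (mpoly R V)"
  by (rule mpoly_carrierI[of _ _ "{}"]) auto

lemma mpoly_cring: "cring (mpoly R V)"
proof (rule cringI)
  show "abelian_group (mpoly R V)"
  proof (rule abelian_groupI)
    fix x assume x: "x \<in> carrier (mpoly R V)"
    then show "\<exists>y\<in>carrier (mpoly R V). y \<oplus>\<^bsub>mpoly R V\<^esub> x = \<zero>\<^bsub>mpoly R V\<^esub>"
      by (intro bexI[OF _ mpoly_uminus_closed[OF x]]) (auto simp: mpoly_coeff_closed l_neg)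
  qed (auto simp: mpoly_add_closed mpoly_coeff_closed mpoly_zero_closed a_ac)
  show "comm_monoid (mpoly R V)"
  proof (rule comm_monoidI)
    fix x y z
    assume *: "x \<in> carrier (mpoly R V)" "y \<in> carrier (mpoly R V)" "z \<in> carrier (mpoly R V)"
    show "x \<otimes>\<^bsub>mpoly R V\<^esub> y \<otimes>\<^bsub>mpoly R V\<^esub> z = x \<otimes>\<^bsub>mpoly R V\<^esub> (y \<otimes>\<^bsub>mpoly R V\<^esub> z)"
      using * by (intro mpoly_mult_assoc) (auto simp: mpoly_coeff_closed)
  next
    fix x y assume *: "x \<in> carrier (mpoly R V)" "y \<in> carrier (mpoly R V)"
    show "x \<otimes>\<^bsub>mpoly R V\<^esub> y \<in> carrier (mpoly R V)"
      using * by (rule mpoly_mult_closed)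
    show "x \<otimes>\<^bsub>mpoly R V\<^esub> y = y \<otimes>\<^bsub>mpoly R V\<^esub> x"
      using * by (intro mpoly_mult_comm) (auto simp: mpoly_coeff_closed)
  next
    fix x assume "x \<in> carrier (mpoly R V)"
    then show "\<one>\<^bsub>mpoly R V\<^esub> \<otimes>\<^bsub>mpoly R V\<^esub> x = x"
      using monom_mult[of \<one> x V "{#}"] by (simp add: mpoly_coeff_closed)
  qed simp
  fix x y z assume "x \<in> carrier (mpoly R V)" "y \<in> carrier (mpoly R V)" "z \<in> carrier (mpoly R V)"
  then show "(x \<oplus>\<^bsub>mpoly R V\<^esub> y) \<otimes>\<^bsub>mpoly R V\<^esub> z = x \<otimes>\<^bsub>mpoly R V\<^esub> z \<oplus>\<^bsub>mpoly R V\<^esub> y \<otimes>\<^bsub>mpoly R V\<^esub> z"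
    by (simp add: mpoly_mult mpoly_coeff_closed l_distr finsum_addf Pi_def)
qed

lemma mpoly_uminus:
  assumes "p \<in> carrier (mpoly R V)"
  shows "\<ominus>\<^bsub>mpoly R V\<^esub> p = (\<lambda>m. \<ominus> p m)"
proof -
  interpret P: cring "mpoly R V" by (rule mpoly_cring)
  show ?thesis
    using assms by (intro P.minus_equality) (auto simp: mpoly_uminus_closed mpoly_coeff_closed l_neg)
qed

lemma mpoly_minus:
  assumes "p \<in> carrier (mpoly R V)" and "q \<in> carrier (mpoly R V)"
  shows "p \<ominus>\<^bsub>mpoly R V\<^esub> q = (\<lambda>m. p m \<ominus> q m)"
  using assms by (simp add: a_minus_def[of "mpoly R V"] mpoly_uminus minus_eq)

lemma mpoly_finsum:
  assumes "finite A" and "\<And>i. i \<in> A \<Longrightarrow> p i \<in> carrier (mpoly R V)"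
  shows "(\<Oplus>\<^bsub>mpoly R V\<^esub>i\<in>A. p i) m = (\<Oplus>i\<in>A. p i m)"
proof -
  interpret P: cring "mpoly R V" by (rule mpoly_cring)
  show ?thesis
    using assms
    by (induction A rule: finite_induct) (auto simp: Pi_def mpoly_coeff_closed[where V = V])
qed

end

section \<open>Linear spans and ideals\<close>

text \<open>An ideal is used below through the linear span of the term multiples of its generators. Induction
  over the span takes the place of computations with finite sums of products.\<close>

inductive_set lspan :: "('a, 'e) ring_scheme \<Rightarrow> ('m \<Rightarrow> 'a) set \<Rightarrow> ('m \<Rightarrow> 'a) set" for R B where
  zero: "(\<lambda>m. \<zero>\<^bsub>R\<^esub>) \<in> lspan R B"
| step: "p \<in> lspan R B \<Longrightarrow> a \<in> carrier R \<Longrightarrow> b \<in> B \<Longrightarrow> (\<lambda>m. a \<otimes>\<^bsub>R\<^esub> b m \<oplus>\<^bsub>R\<^esub> p m) \<in> lspan R B"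

lemma lspan_mono: "B \<subseteq> C \<Longrightarrow> lspan R B \<subseteq> lspan R C"
proof
  fix p assume BC: "B \<subseteq> C" and "p \<in> lspan R B"
  from this(2) show "p \<in> lspan R C"
    using BC by induction (auto intro: lspan.intros)
qed

abbreviation multiples ::
    "('a, 'e) ring_scheme \<Rightarrow> 'v set \<Rightarrow> ('v multiset \<Rightarrow> 'a) set \<Rightarrow> ('v multiset \<Rightarrow> 'a) set" where
  "multiples R V G \<equiv> {shift R s g | s g. s \<in> terms V \<and> g \<in> G}"

lemma shift_nonzeroE:
  assumes "shift R s p m \<noteq> \<zero>\<^bsub>R\<^esub>"
  obtains u where "m = s + u" "p u \<noteq> \<zero>\<^bsub>R\<^esub>"
proof -
  have "s \<subseteq># m" using assms by (auto simp: shift_def split: if_splits)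
  then obtain u where "m = s + u" by (auto simp: mset_subset_eq_exists_conv)
  then show ?thesis using assms that by auto
qed

context cring
begin

lemma lspan_closed:
  assumes "B \<subseteq> carrier (mpoly R V)" and "p \<in> lspan R B"
  shows "p \<in> carrier (mpoly R V)"
  using assms(2)
proof induction
  case zero
  show ?case by (rule mpoly_zero_closed)
next
  case (step p a b)
  then show ?case
    using assms(1) by (intro mpoly_add_closed mpoly_smult_closed) auto
qed

lemma lspan_coeff_closed:
  assumes "B \<subseteq> carrier (mpoly R V)" and "p \<in> lspan R B"
  shows "p m \<in> carrier R"
  using lspan_closed[OF assms] by (rule mpoly_coeff_closed)

lemma lspan_base:
  assumes "B \<subseteq> carrier (mpoly R V)" and "b \<in> B"
  shows "b \<in> lspan R B"
  using lspan.step[OF lspan.zero _ assms(2), of \<one> R] mpoly_coeff_closed[of b R V] assms by auto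

lemma lspan_add:
  assumes B: "B \<subseteq> carrier (mpoly R V)" and "p \<in> lspan R B" and q: "q \<in> lspan R B"
  shows "(\<lambda>m. p m \<oplus> q m) \<in> lspan R B"
  using assms(2)
proof induction
  case zero
  then show ?case using lspan_coeff_closed[OF B q] q by simp
next
  case (step p a b)
  then have "b m \<in> carrier R" "p m \<in> carrier R" for m
    using B lspan_coeff_closed[OF B] mpoly_coeff_closed[of b R V] by auto
  then show ?case
    using lspan.step[OF step.IH step.hyps(2,3)] step.hyps lspan_coeff_closed[OF B q]
    by (simp add: a_assoc)
qed

lemma lspan_smult:
  assumes B: "B \<subseteq> carrier (mpoly R V)" and a: "a \<in> carrier R" and "p \<in> lspan R B"
  shows "(\<lambda>m. a \<otimes> p m) \<in> lspan R B"
  using assms(3)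
proof induction
  case zero
  then show ?case using a by (simp add: lspan.zero)
next
  case (step p c b)
  then have "b m \<in> carrier R" "p m \<in> carrier R" for m
    using B lspan_coeff_closed[OF B] mpoly_coeff_closed[of b R V] by auto
  then show ?case
    using lspan.step[OF step.IH, of "a \<otimes> c" b] step.hyps a by (simp add: m_assoc r_distr)
qed

lemma mpoly_in_lspan_monoms:
  assumes p: "p \<in> carrier (mpoly R V)"
  shows "p \<in> lspan R (monom R \<one> ` supp R p)"
proof -
  have "p \<in> lspan R (monom R \<one> ` S)" if "finite S" "supp R p \<subseteq> S" "\<And>m. p m \<in> carrier R" for S p
    using that
  proof (induction S arbitrary: p rule: finite_induct)
    case empty
    then have "p = (\<lambda>m. \<zero>)" by (auto simp: supp_def)
    then show ?case by (simp add: lspan.zero)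
  next
    case (insert s S)
    let ?q = "\<lambda>m. if m = s then \<zero> else p m"
    have "?q \<in> lspan R (monom R \<one> ` insert s S)"
      using insert by (intro subsetD[OF lspan_mono insert.IH]) (auto simp: supp_def)
    from lspan.step[OF this, of "p s" "monom R \<one> s"] insert.prems
    have "(\<lambda>m. p s \<otimes> monom R \<one> s m \<oplus> ?q m) \<in> lspan R (monom R \<one> ` insert s S)"
      by auto
    also have "(\<lambda>m. p s \<otimes> monom R \<one> s m \<oplus> ?q m) = p"
      using insert.prems by (auto simp: monom_def)
    finally show ?case .
  qed
  then show ?thesis using p by (auto simp: mpoly_carrier)
qed

text \<open>A property that is preserved by adding multiples of a term holds for all polynomials; this
  reduces linear and bilinear identities to terms.\<close>

lemma mpoly_induct [consumes 1, case_names zero step]: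
  assumes p: "p \<in> carrier (mpoly R V)" and "Q (\<lambda>m. \<zero>)"
    and st: "\<And>q a s. q \<in> carrier (mpoly R V) \<Longrightarrow> Q q \<Longrightarrow> a \<in> carrier R \<Longrightarrow> s \<in> terms V
      \<Longrightarrow> Q (\<lambda>m. a \<otimes> monom R \<one> s m \<oplus> q m)"
  shows "Q p"
proof -
  have "p \<in> lspan R (monom R \<one> ` terms V)"
    using mpoly_in_lspan_monoms[OF p] p lspan_mono[of "monom R \<one> ` supp R p" "monom R \<one> ` terms V"]
    by (auto simp: mpoly_carrier)
  moreover have B: "monom R \<one> ` terms V \<subseteq> carrier (mpoly R V)" by auto
  ultimately have "Q p \<and> p \<in> carrier (mpoly R V)"
  proof induction
    case zero
    then show ?case using assms(2) by (simp add: mpoly_zero_closed)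
  next
    case (step p a b)
    then show ?case
      using st by (auto intro!: mpoly_add_closed mpoly_smult_closed)
  qed
  then show ?thesis by simp
qed

lemma shift_add: "shift R s (shift R t p) = shift R (s + t) p"
proof
  fix m
  show "shift R s (shift R t p) m = shift R (s + t) p m"
  proof (cases "s \<subseteq># m \<and> t \<subseteq># m - s")
    case True
    then have "s + t \<subseteq># m" 
      by (metis mset_subset_eq_mono_add_left_cancel subset_mset.add_diff_inverse)
    then show ?thesis using True by (simp add: shift_def diff_diff_add)
  next
    case False
    have "\<not> s + t \<subseteq># m"
    proof
      assume "s + t \<subseteq># m"
      then obtain c where "m = s + t + c" by (auto simp: mset_subset_eq_exists_conv)
      then show False using False by (simp add: union_assoc)
    qed
    then show ?thesis using False by (auto simp: shift_def)
  qed
qed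

lemma shift_lin:
  "a \<in> carrier R \<Longrightarrow> shift R s (\<lambda>m. a \<otimes> b m \<oplus> p m) = (\<lambda>m. a \<otimes> shift R s b m \<oplus> shift R s p m)"
  by (auto simp: shift_def)

lemma shift_minus: "shift R s (\<lambda>m. p m \<ominus> q m) = (\<lambda>m. shift R s p m \<ominus> shift R s q m)"
  by (auto simp: shift_def minus_eq)

lemma shift_zero [simp]: "shift R s (\<lambda>m. \<zero>) = (\<lambda>m. \<zero>)"
  by (auto simp: shift_def)

lemma shift_eq_zero: "shift R s p = (\<lambda>m. \<zero>) \<Longrightarrow> p = (\<lambda>m. \<zero>)"
  by (metis shift_add_term(1))

lemma shift_monom: "shift R s (monom R a t) = monom R a (s + t)"
  by (auto simp: shift_def monom_def fun_eq_iff mset_subset_eq_exists_conv)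

context
  fixes V :: "'v set" and I :: "('v multiset \<Rightarrow> 'a) set"
  assumes I: "ideal I (mpoly R V)"
begin

lemma ideal_mpoly_closed: "p \<in> I \<Longrightarrow> p \<in> carrier (mpoly R V)"
  using I by (auto dest: ideal.Icarr)

lemma ideal_mpoly_zero: "(\<lambda>m. \<zero>) \<in> I"
  using additive_subgroup.zero_closed[OF ideal.axioms(1)[OF I]] by simp

lemma ideal_mpoly_add: "p \<in> I \<Longrightarrow> q \<in> I \<Longrightarrow> (\<lambda>m. p m \<oplus> q m) \<in> I"
  using additive_subgroup.a_closed[OF ideal.axioms(1)[OF I], of p q] by simp

lemma ideal_mpoly_smult_shift:
  "p \<in> I \<Longrightarrow> a \<in> carrier R \<Longrightarrow> s \<in> terms V \<Longrightarrow> (\<lambda>m. a \<otimes> shift R s p m) \<in> I"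
  using ideal.I_l_closed[OF I, of p "monom R a s"] ideal_mpoly_closed[of p]
  by (simp add: monom_mult mpoly_coeff_closed)

lemma ideal_mpoly_smult: "p \<in> I \<Longrightarrow> a \<in> carrier R \<Longrightarrow> (\<lambda>m. a \<otimes> p m) \<in> I"
  using ideal_mpoly_smult_shift[of p a "{#}"] by simp

lemma ideal_mpoly_shift: "p \<in> I \<Longrightarrow> s \<in> terms V \<Longrightarrow> shift R s p \<in> I"
  using ideal_mpoly_smult_shift[of p \<one> s] shift_closed[of s V p] ideal_mpoly_closed[of p]
  by (simp add: mpoly_coeff_closed)

lemma ideal_mpoly_minus:
  assumes "p \<in> I" and "q \<in> I" shows "(\<lambda>m. p m \<ominus> q m) \<in> I"
proof -
  have "(\<lambda>m. p m \<oplus> (\<ominus> \<one>) \<otimes> q m) \<in> I"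
    using assms ideal_mpoly_add ideal_mpoly_smult by simp
  then show ?thesis
    using assms ideal_mpoly_closed mpoly_coeff_closed[of _ R V] by (simp add: minus_eq l_minus)
qed

text \<open>The form in which remainders of elements of an ideal are seen to lie in it.\<close>

lemma ideal_mpoly_remainder:
  assumes p: "p \<in> I" and r: "r \<in> carrier (mpoly R V)" and d: "(\<lambda>m. p m \<ominus> r m) \<in> I"
  shows "r \<in> I"
proof -
  have "p m \<ominus> (p m \<ominus> r m) = r m" for m
    using mpoly_coeff_closed[OF ideal_mpoly_closed[OF p], of m] mpoly_coeff_closed[OF r, of m] by algebra
  then show ?thesis using ideal_mpoly_minus[OF p d] by simp
qed

lemma lspan_ideal: "lspan R I = I"
proof
  have C: "I \<subseteq> carrier (mpoly R V)" using ideal_mpoly_closed by auto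
  then show "I \<subseteq> lspan R I" by (auto intro: lspan_base)
  show "lspan R I \<subseteq> I"
  proof
    fix p assume "p \<in> lspan R I"
    then show "p \<in> I"
      by induction (auto intro: ideal_mpoly_zero ideal_mpoly_add ideal_mpoly_smult)
  qed
qed

end

lemma ideal_lspan_subset:
  assumes "ideal I (mpoly R V)" and "B \<subseteq> I"
  shows "lspan R B \<subseteq> I"
  using lspan_mono[OF assms(2)] lspan_ideal[OF assms(1)] by blast

lemma multiples_closed: "G \<subseteq> carrier (mpoly R V) \<Longrightarrow> multiples R V G \<subseteq> carrier (mpoly R V)"
  by (auto intro: shift_closed)

lemma lspan_shift:
  assumes s: "s \<in> terms V" and "p \<in> lspan R (multiples R V G)"
  shows "shift R s p \<in> lspan R (multiples R V G)"
  using assms(2)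
proof induction
  case (step p a b)
  then show ?case
    using s by (auto simp: shift_lin shift_add intro!: lspan.step) (metis terms_add)
qed (simp add: lspan.zero)

text \<open>A product with an arbitrary polynomial is a linear combination of products with terms, and
  these permute the multiples.\<close>

lemma lspan_multiples_ideal:
  assumes G: "G \<subseteq> carrier (mpoly R V)"
  shows "ideal (lspan R (multiples R V G)) (mpoly R V)"
proof -
  interpret P: cring "mpoly R V" by (rule mpoly_cring)
  let ?L = "lspan R (multiples R V G)"
  have C: "multiples R V G \<subseteq> carrier (mpoly R V)" by (rule multiples_closed[OF G])
  have mult: "q \<otimes>\<^bsub>mpoly R V\<^esub> p \<in> ?L" if p: "p \<in> ?L" and q: "q \<in> carrier (mpoly R V)" for p q
    using q
  proof (induction rule: mpoly_induct)
    case zero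
    have "(\<lambda>m. \<zero>) \<otimes>\<^bsub>mpoly R V\<^esub> p = (\<lambda>m. \<zero>)"
      using P.l_null[OF lspan_closed[OF C p]] by simp
    then show ?case by (simp add: lspan.zero)
  next
    case (step q a s)
    have pc: "p \<in> carrier (mpoly R V)" by (rule lspan_closed[OF C p])
    have "(\<lambda>m. a \<otimes> monom R \<one> s m) = monom R a s"
      using step by (auto simp: monom_def)
    then have "(\<lambda>m. a \<otimes> monom R \<one> s m \<oplus> q m) = monom R a s \<oplus>\<^bsub>mpoly R V\<^esub> q"
      by (simp add: fun_eq_iff)
    then have "(\<lambda>m. a \<otimes> monom R \<one> s m \<oplus> q m) \<otimes>\<^bsub>mpoly R V\<^esub> p =
        (\<lambda>m. a \<otimes> shift R s p m \<oplus> (q \<otimes>\<^bsub>mpoly R V\<^esub> p) m)"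
      using P.l_distr[of "monom R a s" q p] step pc monom_mult[of a p V s]
      by (simp add: mpoly_coeff_closed)
    moreover have "(\<lambda>m. a \<otimes> shift R s p m) \<in> ?L"
      using lspan_smult[OF C _ lspan_shift] step p by auto
    ultimately show ?case
      using lspan_add[OF C _ step.IH] by simp
  qed
  show ?thesis
  proof (rule idealI)
    show "ring (mpoly R V)" by (rule P.ring_axioms)
    show "subgroup ?L (add_monoid (mpoly R V))"
    proof (rule group.subgroupI)
      show "group (add_monoid (mpoly R V))" by (rule P.add.is_group)
      show "?L \<subseteq> carrier (add_monoid (mpoly R V))" using lspan_closed[OF C] by auto
      show "?L \<noteq> {}" using lspan.zero by auto
    next
      fix p assume p: "p \<in> ?L"
      have "(\<lambda>m. \<ominus> p m) \<in> ?L"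
        using lspan_smult[OF C _ p, of "\<ominus> \<one>"] lspan_coeff_closed[OF C p] by (simp add: l_minus)
      then show "inv\<^bsub>add_monoid (mpoly R V)\<^esub> p \<in> ?L"
        using mpoly_uminus[OF lspan_closed[OF C p]] by (simp add: a_inv_def)
    next
      fix p q assume "p \<in> ?L" "q \<in> ?L"
      then show "p \<otimes>\<^bsub>add_monoid (mpoly R V)\<^esub> q \<in> ?L"
        using lspan_add[OF C] by simp
    qed
  next
    fix a x assume a: "a \<in> ?L" and x: "x \<in> carrier (mpoly R V)"
    show "x \<otimes>\<^bsub>mpoly R V\<^esub> a \<in> ?L" by (rule mult[OF a x])
    then show "a \<otimes>\<^bsub>mpoly R V\<^esub> x \<in> ?L"
      using P.m_comm[OF x lspan_closed[OF C a]] by simp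
  qed
qed

lemma Idl_eq_lspan:
  assumes G: "G \<subseteq> carrier (mpoly R V)"
  shows "Idl\<^bsub>mpoly R V\<^esub> G = lspan R (multiples R V G)"
proof
  interpret P: cring "mpoly R V" by (rule mpoly_cring)
  have C: "multiples R V G \<subseteq> carrier (mpoly R V)" by (rule multiples_closed[OF G])
  have "G \<subseteq> multiples R V G" by (auto intro!: exI[of _ "{#}"])
  then show "Idl\<^bsub>mpoly R V\<^esub> G \<subseteq> lspan R (multiples R V G)"
    using lspan_base[OF C] by (intro P.genideal_minimal lspan_multiples_ideal G) auto
  have I: "ideal (Idl\<^bsub>mpoly R V\<^esub> G) (mpoly R V)" by (rule P.genideal_ideal[OF G])
  show "lspan R (multiples R V G) \<subseteq> Idl\<^bsub>mpoly R V\<^esub> G"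
    using P.genideal_self[OF G] by (intro ideal_lspan_subset[OF I]) (auto intro: ideal_mpoly_shift[OF I])
qed

lemma hom_component_closed:
  "p \<in> carrier (mpoly R V) \<Longrightarrow> hom_component R d p \<in> carrier (mpoly R V)"
  by (rule mpoly_carrierI[of _ _ "supp R p"])
    (auto simp: hom_component_def mpoly_coeff_closed mpoly_carrier supp_def split: if_splits)

lemma hom_component_lin:
  "a \<in> carrier R \<Longrightarrow> hom_component R d (\<lambda>m. a \<otimes> b m \<oplus> p m)
    = (\<lambda>m. a \<otimes> hom_component R d b m \<oplus> hom_component R d p m)"
  by (auto simp: hom_component_def)

lemma hom_component_minus:
  "hom_component R d (\<lambda>m. p m \<ominus> q m) = (\<lambda>m. hom_component R d p m \<ominus> hom_component R d q m)"
  by (auto simp: hom_component_def minus_eq)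

lemma hom_component_self: "supp R p \<subseteq> {m. size m = d} \<Longrightarrow> hom_component R d p = p"
  by (force simp: hom_component_def supp_def fun_eq_iff)

text \<open>A term multiple of a homogeneous generator is homogeneous, so each of its components is itself
  or zero.\<close>

lemma homogeneous_ideal_Idl:
  assumes G: "G \<subseteq> carrier (mpoly R V)" and hom: "\<And>g. g \<in> G \<Longrightarrow> \<exists>d. supp R g \<subseteq> {m. size m = d}"
  shows "homogeneous_ideal R V (Idl\<^bsub>mpoly R V\<^esub> G)"
proof -
  let ?L = "lspan R (multiples R V G)"
  have C: "multiples R V G \<subseteq> carrier (mpoly R V)" by (rule multiples_closed[OF G])
  have "hom_component R d p \<in> ?L" if "p \<in> ?L" for d p
    using that
  proof induction
    case zero
    then show ?case by (simp add: hom_component_def lspan.zero)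
  next
    case (step p a b)
    then obtain s g where b: "b = shift R s g" "s \<in> terms V" "g \<in> G" by auto
    obtain e where e: "supp R g \<subseteq> {m. size m = e}" using hom[OF b(3)] by auto
    have e': "size m = size s + e" if "b m \<noteq> \<zero>" for m
    proof -
      obtain u where "m = s + u" "g u \<noteq> \<zero>"
        using \<open>b m \<noteq> \<zero>\<close> unfolding b(1) by (rule shift_nonzeroE)
      then show ?thesis using e by (auto simp: supp_def)
    qed
    have "hom_component R d b = b \<or> hom_component R d b = (\<lambda>m. \<zero>)"
      unfolding hom_component_def fun_eq_iff using e' by (cases "d = size s + e") metis+
    then have "hom_component R d b \<in> ?L"
      using lspan_base[OF C step.hyps(3)] lspan.zero by auto
    then show ?case
      using step by (simp add: hom_component_lin lspan_add[OF C] lspan_smult[OF C])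
  qed
  then show ?thesis
    using lspan_multiples_ideal[OF G] by (simp add: homogeneous_ideal_def Idl_eq_lspan[OF G])
qed

end

section \<open>Well-foundedness of term orders\<close>

text \<open>A weakly decreasing sequence of natural numbers is constant from the point where it attains its
  minimum.\<close>

lemma nat_seq_mono_subseq:
  fixes g :: "nat \<Rightarrow> nat"
  obtains s :: "nat \<Rightarrow> nat" where "strict_mono s" "\<And>i j. i \<le> j \<Longrightarrow> g (s i) \<le> g (s j)"
proof -
  obtain s where s: "strict_mono s" "monoseq (\<lambda>i. g (s i))"
    using seq_monosub[of g] by blast
  show ?thesis
  proof (cases "\<forall>i j. i \<le> j \<longrightarrow> g (s i) \<le> g (s j)")
    case True
    then show ?thesis by (intro that[of s] s(1)) simp
  next
    case False
    then have "\<forall>i j. i \<le> j \<longrightarrow> g (s j) \<le> g (s i)"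
      using s(2) unfolding monoseq_def by (elim disjE) simp_all
    then have dec: "i \<le> j \<Longrightarrow> g (s j) \<le> g (s i)" for i j by simp
    obtain k where k: "\<And>i. g (s k) \<le> g (s i)"
      using ex_has_least_nat[of "\<lambda>_. True" 0 "\<lambda>i. g (s i)"] by metis
    have const: "g (s (k + i)) = g (s k)" for i
      using dec[of k "k + i"] k[of "k + i"] by auto
    show ?thesis
    proof (rule that)
      show "strict_mono (\<lambda>i. s (k + i))" using s(1) by (simp add: strict_mono_def)
      show "g (s (k + i)) \<le> g (s (k + j))" for i j using const by simp
    qed
  qed
qed

text \<open>Dickson's lemma. One passes to a subsequence on which the exponent of a variable is
  weakly increasing, for each variable in turn.\<close>

lemma dickson:
  assumes V: "finite V" and f: "\<And>i. f i \<in> terms V"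
  obtains i j :: nat where "i < j" "f i \<subseteq># f j"
proof -
  define good where "good r W \<longleftrightarrow> (\<forall>v\<in>W. \<forall>i j. i \<le> j \<longrightarrow> count (f (r i)) v \<le> count (f (r j)) v)"
    for r :: "nat \<Rightarrow> nat" and W
  have "\<exists>r. strict_mono r \<and> good r V"
    using V
  proof (induction V rule: finite_induct)
    case empty
    show ?case by (intro exI[of _ id]) (simp add: strict_mono_def good_def)
  next
    case (insert w W)
    then obtain r where r: "strict_mono r" "good r W" by (elim exE conjE)
    obtain s :: "nat \<Rightarrow> nat" where s: "strict_mono s"
      "\<And>i j. i \<le> j \<Longrightarrow> count (f (r (s i))) w \<le> count (f (r (s j))) w"
      using nat_seq_mono_subseq[of "\<lambda>i. count (f (r i)) w"] by metis
    have "strict_mono (r \<circ> s)" using r(1) s(1) by (rule strict_mono_o)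
    moreover have "good (r \<circ> s) (insert w W)"
      using r(2) s(2) strict_mono_less_eq[OF s(1)] by (simp add: good_def)
    ultimately show ?case by (intro exI[of _ "r \<circ> s"] conjI)
  qed
  then obtain r where r: "strict_mono r" "good r V" by (elim exE conjE)
  have "f (r 0) \<subseteq># f (r 1)"
  proof (rule mset_subset_eqI)
    fix v show "count (f (r 0)) v \<le> count (f (r 1)) v"
    proof (cases "v \<in> V")
      case True
      then show ?thesis using r(2) by (simp add: good_def)
    next
      case False
      then have "v \<notin># f (r 0)" using f[of "r 0"] by (auto simp: terms_def)
      then show ?thesis by (simp add: not_in_iff)
    qed
  qed
  moreover have "r 0 < r 1" using r(1) by (simp add: strict_mono_def)
  ultimately show ?thesis by (rule that[rotated])
qed

context
  fixes V :: "'v set" and ord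
  assumes ord: "term_order V ord"
begin

lemma term_order_irrefl: "s \<in> terms V \<Longrightarrow> \<not> ord s s"
  using ord unfolding term_order_def by blast

lemma term_order_trans:
  "ord s t \<Longrightarrow> ord t u \<Longrightarrow> s \<in> terms V \<Longrightarrow> t \<in> terms V \<Longrightarrow> u \<in> terms V \<Longrightarrow> ord s u"
  using ord unfolding term_order_def by blast

lemma term_order_total: "s \<in> terms V \<Longrightarrow> t \<in> terms V \<Longrightarrow> s = t \<or> ord s t \<or> ord t s"
  using ord unfolding term_order_def by blast

lemma term_order_add: 
  "ord s t \<Longrightarrow> s \<in> terms V \<Longrightarrow> t \<in> terms V \<Longrightarrow> u \<in> terms V \<Longrightarrow> ord (u + s) (u + t)"
  using ord unfolding term_order_def by (metis add.commute)

lemma term_order_divides: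
  assumes "s \<subseteq># t" "s \<noteq> t" "t \<in> terms V" shows "ord s t"
proof -
  obtain u where u: "t = s + u" using assms by (auto simp: mset_subset_eq_exists_conv)
  then have "s \<in> terms V" "u \<in> terms V" "u \<noteq> {#}" using assms by auto
  moreover have "ord {#} u" using ord \<open>u \<in> terms V\<close> \<open>u \<noteq> {#}\<close> unfolding term_order_def by blast
  ultimately show ?thesis
    using u term_order_add[of "{#}" u s] by simp
qed

text \<open>In a descending chain some term would divide a later one, and divisors are never larger.\<close>

lemma term_order_wf:
  assumes V: "finite V"
  shows "wf {(s, t). s \<in> terms V \<and> t \<in> terms V \<and> ord s t}"
  unfolding wf_iff_no_infinite_down_chain
proof
  assume "\<exists>f. \<forall>i. (f (Suc i), f i) \<in> {(s, t). s \<in> terms V \<and> t \<in> terms V \<and> ord s t}"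
  then obtain f where f: "\<And>i. ord (f (Suc i)) (f i)" "\<And>i. f i \<in> terms V" by auto
  have dec: "ord (f (i + Suc k)) (f i)" for i k
    using f by (induction k) (auto intro: term_order_trans)
  obtain i j where ij: "i < j" "f i \<subseteq># f j" by (rule dickson[OF V f(2)])
  then have "ord (f j) (f i)" using dec[of i "j - i - 1"] by auto
  moreover have "f i = f j \<or> ord (f i) (f j)" using term_order_divides[of "f i" "f j"] ij f by auto
  ultimately show False
    using f(2) term_order_irrefl[of "f i"] term_order_trans[of "f i" "f j" "f i"] by metis
qed

end

lemma finite_minimal_terms:
  assumes V: "finite V" and L: "L \<subseteq> terms V"
    and anti: "\<And>s t. s \<in> L \<Longrightarrow> t \<in> L \<Longrightarrow> s \<subseteq># t \<Longrightarrow> s = t"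
  shows "finite L"
proof (rule ccontr)
  assume "infinite L"
  then obtain f :: "nat \<Rightarrow> _" where f: "inj f" "range f \<subseteq> L"
    using infinite_countable_subset by blast
  then have fL: "f i \<in> L" for i by auto
  then have "f i \<in> terms V" for i using L by auto
  then obtain i j where ij: "i < j" "f i \<subseteq># f j" by (rule dickson[OF V])
  then have "f i = f j" using anti fL by simp
  then show False using f(1) ij(1) by (simp add: inj_eq)
qed

section \<open>Division by families of monic polynomials\<close>

text \<open>The terms outside the monomial ideal generated by \<open>M\<close>.\<close>

definition standard :: "'v multiset set \<Rightarrow> 'v multiset \<Rightarrow> bool" where
  "standard M m \<longleftrightarrow> (\<forall>\<alpha>\<in>M. \<not> \<alpha> \<subseteq># m)"

definition standard_poly :: "('a, 'e) ring_scheme \<Rightarrow> 'v multiset set \<Rightarrow> ('v multiset \<Rightarrow> 'a) \<Rightarrow> bool" where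
  "standard_poly R M p \<longleftrightarrow> (\<forall>m. p m \<noteq> \<zero>\<^bsub>R\<^esub> \<longrightarrow> standard M m)"

lemma (in cring) supp_monoms_closed:
  assumes "p \<in> carrier (mpoly R V)"
  shows "monom R \<one> ` supp R p \<subseteq> carrier (mpoly R V)"
proof -
  have "supp R p \<subseteq> terms V" using assms by (simp add: mpoly_carrier)
  then show ?thesis by auto
qed

text \<open>All head coefficients are 1, so division is possible over every commutative ring. This
  is what allows Groebner basis arguments over an arbitrary test algebra.\<close>

locale monic_family = cring R for R :: "('a, 'e) ring_scheme" (structure) +
  fixes V :: "'v set" and ord and M :: "'v multiset set" and F :: "'v multiset \<Rightarrow> 'v multiset \<Rightarrow> 'a"
  assumes ord: "term_order V ord"
    and wf_ord: "wf {(s, t). s \<in> terms V \<and> t \<in> terms V \<and> ord s t}"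
    and heads: "M \<subseteq> terms V"
    and F_closed: "\<alpha> \<in> M \<Longrightarrow> F \<alpha> \<in> carrier (mpoly R V)"
    and F_head: "\<alpha> \<in> M \<Longrightarrow> F \<alpha> \<alpha> = \<one>"
    and F_tail: "\<alpha> \<in> M \<Longrightarrow> F \<alpha> t \<noteq> \<zero> \<Longrightarrow> t \<noteq> \<alpha> \<Longrightarrow> ord t \<alpha>"
begin

text \<open>The predicate restricts the head term of a multiple. For \<open>Q = (\<lambda>t. ord t m)\<close> the span of these
  multiples consists of the polynomials with a representation below \<open>m\<close>, in the sense of
  Buchberger's criterion.\<close>

definition multiples_within :: "('v multiset \<Rightarrow> bool) \<Rightarrow> ('v multiset \<Rightarrow> 'a) set" where
  "multiples_within Q = {shift R s (F \<alpha>) | s \<alpha>. s \<in> terms V \<and> \<alpha> \<in> M \<and> Q (s + \<alpha>)}"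

lemma multiples_within_closed: "multiples_within Q \<subseteq> carrier (mpoly R V)"
  by (auto simp: multiples_within_def intro: shift_closed F_closed)

lemma multiples_within_mono: "(\<And>t. t \<in> terms V \<Longrightarrow> Q t \<Longrightarrow> Q' t) \<Longrightarrow> multiples_within Q \<subseteq> multiples_within Q'"
  using heads by (auto simp: multiples_within_def) (metis subsetD terms_add)

lemma multiples_within_True: "multiples_within (\<lambda>_. True) = multiples R V (F ` M)"
  by (auto simp: multiples_within_def)

lemma Idl_eq_multiples_within: "Idl\<^bsub>mpoly R V\<^esub> (F ` M) = lspan R (multiples_within (\<lambda>_. True))"
  unfolding multiples_within_True by (rule Idl_eq_lspan) (auto intro: F_closed)

lemma shift_F_tail:
  assumes "\<alpha> \<in> M" "s \<in> terms V" "shift R s (F \<alpha>) t \<noteq> \<zero>"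
  shows "t \<in> terms V \<and> (t = s + \<alpha> \<or> ord t (s + \<alpha>))"
proof -
  obtain u where u: "t = s + u" "F \<alpha> u \<noteq> \<zero>" using assms(3) by (rule shift_nonzeroE)
  then have "u \<in> terms V" using mpoly_term[OF F_closed[OF assms(1)]] by auto
  then show ?thesis
    using u F_tail[OF assms(1) u(2)] term_order_add[OF ord, of u \<alpha> s] assms heads by auto
qed

text \<open>Division with remainder, keeping track of the multiples that are subtracted. It suffices to reduce
  single terms, by induction along the order: a term that is divisible by some \<open>\<alpha> \<in> M\<close> is replaced by
  the negated tail of a multiple of \<open>F \<alpha>\<close>, whose terms are smaller.\<close>

lemma division:
  assumes down: "\<And>s t. s \<in> terms V \<Longrightarrow> t \<in> terms V \<Longrightarrow> Q t \<Longrightarrow> ord s t \<Longrightarrow> Q s"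
    and p: "p \<in> carrier (mpoly R V)" and pQ: "\<And>m. p m \<noteq> \<zero> \<Longrightarrow> Q m"
  obtains r where "r \<in> carrier (mpoly R V)" "standard_poly R M r" "\<And>m. r m \<noteq> \<zero> \<Longrightarrow> Q m"
    "(\<lambda>m. p m \<ominus> r m) \<in> lspan R (multiples_within Q)"
proof -
  let ?W = "lspan R (multiples_within Q)"
  note C = multiples_within_closed[of Q]
  define reducible where "reducible p \<longleftrightarrow> (\<exists>r\<in>carrier (mpoly R V). standard_poly R M r \<and>
      (\<forall>m. r m \<noteq> \<zero> \<longrightarrow> Q m) \<and> (\<lambda>m. p m \<ominus> r m) \<in> ?W)" for p
  have lin: "reducible p" if "p \<in> lspan R B" "B \<subseteq> carrier (mpoly R V)"
      and red: "\<And>b. b \<in> B \<Longrightarrow> reducible b" for p B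
    using that(1)
  proof induction
    case zero
    show ?case
      unfolding reducible_def
      by (intro bexI[OF _ mpoly_zero_closed]) (auto simp: standard_poly_def lspan.zero minus_eq)
  next
    case (step p a b)
    obtain rp where rp: "rp \<in> carrier (mpoly R V)" "standard_poly R M rp" "\<And>m. rp m \<noteq> \<zero> \<Longrightarrow> Q m"
      "(\<lambda>m. p m \<ominus> rp m) \<in> ?W"
      using step.IH by (auto simp: reducible_def)
    obtain rb where rb: "rb \<in> carrier (mpoly R V)" "standard_poly R M rb" "\<And>m. rb m \<noteq> \<zero> \<Longrightarrow> Q m"
      "(\<lambda>m. b m \<ominus> rb m) \<in> ?W"
      using red[OF step.hyps(3)] by (auto simp: reducible_def)
    have cl: "p m \<in> carrier R" "b m \<in> carrier R" "rp m \<in> carrier R" "rb m \<in> carrier R" for m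
      using lspan_coeff_closed[OF that(2) step.hyps(1)]
        mpoly_coeff_closed[OF subsetD[OF that(2) step.hyps(3)]]
        mpoly_coeff_closed[OF rp(1)] mpoly_coeff_closed[OF rb(1)] by simp_all
    let ?r = "\<lambda>m. a \<otimes> rb m \<oplus> rp m"
    have "(a \<otimes> b m \<oplus> p m) \<ominus> ?r m = a \<otimes> (b m \<ominus> rb m) \<oplus> (p m \<ominus> rp m)" for m
      using cl step.hyps(2) by algebra
    moreover have "(\<lambda>m. a \<otimes> (b m \<ominus> rb m) \<oplus> (p m \<ominus> rp m)) \<in> ?W"
      using lspan_add[OF C lspan_smult[OF C step.hyps(2) rb(4)] rp(4)] .
    moreover have "?r \<in> carrier (mpoly R V)"
      using rp(1) rb(1) step.hyps(2) by (intro mpoly_add_closed mpoly_smult_closed)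
    moreover have "standard M m \<and> Q m" if "?r m \<noteq> \<zero>" for m
    proof -
      have "rb m \<noteq> \<zero> \<or> rp m \<noteq> \<zero>" using that step.hyps(2) by auto
      then show ?thesis using rp(2,3) rb(2,3) by (auto simp: standard_poly_def)
    qed
    ultimately show ?case
      unfolding reducible_def by (intro bexI[of _ ?r]) (simp_all add: standard_poly_def)
  qed
  \<comment> \<open>Remainders can be combined linearly, so only terms remain to be treated.\<close>
  have mon: "reducible (monom R \<one> t)" if "t \<in> terms V" "Q t" for t
    using wf_ord that
  proof (induction t rule: wf_induct_rule)
    case (less t)
    show ?case
    proof (cases "standard M t")
      case True
      have "(\<lambda>m. monom R \<one> t m \<ominus> monom R \<one> t m) = (\<lambda>m. \<zero>)" by (auto simp: monom_def minus_eq r_neg)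
      moreover have "monom R \<one> t \<in> carrier (mpoly R V)" using less.prems by simp
      ultimately show ?thesis
        unfolding reducible_def using True less.prems lspan.zero
        by (intro bexI[of _ "monom R \<one> t"]) (auto simp: standard_poly_def monom_def split: if_splits)
    next
      case False
      then obtain \<alpha> s where \<alpha>: "\<alpha> \<in> M" "t = s + \<alpha>"
        by (auto simp: standard_def mset_subset_eq_exists_conv add.commute)
      then have s: "s \<in> terms V" using less.prems by simp
      let ?f = "shift R s (F \<alpha>)"
      have f: "?f \<in> carrier (mpoly R V)" using s \<alpha> by (intro shift_closed F_closed)
      then have fm: "?f m \<in> carrier R" for m by (rule mpoly_coeff_closed)
      have tc: "monom R \<one> t \<in> carrier (mpoly R V)" using less.prems by simp
      have f_t: "?f t = \<one>" using \<alpha> F_head by simp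
      let ?u = "\<lambda>m. monom R \<one> t m \<ominus> ?f m"
      have u: "?u \<in> carrier (mpoly R V)"
        using ring.ring_simprules(4)[OF cring.axioms(1)[OF mpoly_cring[of V]] tc f]
        unfolding mpoly_minus[OF tc f] .
      have "ord m t \<and> m \<in> terms V" if "?u m \<noteq> \<zero>" for m
      proof -
        have "m \<noteq> t" using that f_t by (auto simp: monom_def minus_eq r_neg)
        then have "?f m \<noteq> \<zero>" using that by (auto simp: monom_def minus_eq)
        then show ?thesis using shift_F_tail[OF \<alpha>(1) s] \<open>m \<noteq> t\<close> \<alpha>(2) by auto
      qed
      then have "reducible (monom R \<one> m)" if "m \<in> supp R ?u" for m
        using that less down[of m t] by (auto simp: supp_def)
      moreover have "monom R \<one> ` supp R ?u \<subseteq> carrier (mpoly R V)"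
        by (rule supp_monoms_closed[OF u])
      ultimately have "reducible ?u"
        using lin[OF mpoly_in_lspan_monoms[OF u]] by auto
      then obtain r where r: "r \<in> carrier (mpoly R V)" "standard_poly R M r" "\<And>m. r m \<noteq> \<zero> \<Longrightarrow> Q m"
        "(\<lambda>m. ?u m \<ominus> r m) \<in> ?W" by (auto simp: reducible_def)
      have "?f \<in> ?W"
        using \<alpha> s less.prems by (intro lspan_base[OF C]) (auto simp: multiples_within_def)
      from lspan_add[OF C this r(4)] have "(\<lambda>m. ?f m \<oplus> (?u m \<ominus> r m)) \<in> ?W" .
      moreover have "?f m \<oplus> (?u m \<ominus> r m) = monom R \<one> t m \<ominus> r m" for m
        using fm[of m] mpoly_coeff_closed[OF r(1), of m] mpoly_coeff_closed[OF tc, of m] by algebra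
      ultimately show ?thesis using r unfolding reducible_def by auto
    qed
  qed
  have "monom R \<one> ` supp R p \<subseteq> carrier (mpoly R V)"
    by (rule supp_monoms_closed[OF p])
  moreover have "reducible b" if b: "b \<in> monom R \<one> ` supp R p" for b
    using b mon pQ mpoly_term[OF p] by (auto simp: supp_def)
  ultimately have "reducible p"
    by (rule lin[OF mpoly_in_lspan_monoms[OF p]])
  then show ?thesis using that by (auto simp: reducible_def)
qed

lemma division_ideal:
  assumes p: "p \<in> carrier (mpoly R V)"
  obtains r where "r \<in> carrier (mpoly R V)" "standard_poly R M r"
    "(\<lambda>m. p m \<ominus> r m) \<in> Idl\<^bsub>mpoly R V\<^esub> (F ` M)"
  using division[of "\<lambda>_. True" p] p unfolding Idl_eq_multiples_within by blast

text \<open>The remainder of an element of \<open>I\<close> is a standard element of \<open>I\<close>, hence zero.\<close>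

lemma ideal_eqI:
  assumes I: "ideal I (mpoly R V)" and F: "F ` M \<subseteq> I"
    and std: "\<And>p. p \<in> I \<Longrightarrow> standard_poly R M p \<Longrightarrow> p = (\<lambda>m. \<zero>)"
  shows "I = Idl\<^bsub>mpoly R V\<^esub> (F ` M)"
proof
  interpret P: cring "mpoly R V" by (rule mpoly_cring)
  show sub: "Idl\<^bsub>mpoly R V\<^esub> (F ` M) \<subseteq> I"
    using I F by (rule P.genideal_minimal)
  show "I \<subseteq> Idl\<^bsub>mpoly R V\<^esub> (F ` M)"
  proof
    fix p assume p: "p \<in> I"
    then have pc: "p \<in> carrier (mpoly R V)" by (rule ideal_mpoly_closed[OF I])
    obtain r where r: "r \<in> carrier (mpoly R V)" "standard_poly R M r"
      "(\<lambda>m. p m \<ominus> r m) \<in> Idl\<^bsub>mpoly R V\<^esub> (F ` M)"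
      using division_ideal[OF pc] .
    have "r \<in> I" by (rule ideal_mpoly_remainder[OF I p r(1) subsetD[OF sub r(3)]])
    then have "r = (\<lambda>m. \<zero>)" using std r(2) by simp
    then show "p \<in> Idl\<^bsub>mpoly R V\<^esub> (F ` M)"
      using r(3) mpoly_coeff_closed[OF pc] by (simp add: minus_eq)
  qed
qed

text \<open>Buchberger's criterion. Among the representations of \<open>p\<close> take one whose largest head term \<open>m\<close> is
  minimal. By \<open>S\<close>, all multiples with head term \<open>m\<close> can be replaced by scalar multiples of a
  single one of them; its coefficient is \<open>p m\<close>, which vanishes because \<open>m\<close> is not standard. Thus the
  representation can be lowered, a contradiction unless \<open>p\<close> is zero.\<close>

lemma buchberger:
  assumes S: "\<And>s \<alpha> s' \<alpha>'. \<alpha> \<in> M \<Longrightarrow> \<alpha>' \<in> M \<Longrightarrow> s \<in> terms V \<Longrightarrow> s' \<in> terms V \<Longrightarrow> s + \<alpha> = s' + \<alpha>' \<Longrightarrow>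
      (\<lambda>m. shift R s (F \<alpha>) m \<ominus> shift R s' (F \<alpha>') m) \<in> lspan R (multiples_within (\<lambda>t. ord t (s + \<alpha>)))"
    and p: "p \<in> Idl\<^bsub>mpoly R V\<^esub> (F ` M)" and std: "standard_poly R M p"
  shows "p = (\<lambda>m. \<zero>)"
proof -
  let ?le = "\<lambda>m. lspan R (multiples_within (\<lambda>t. t = m \<or> ord t m))"
  let ?less = "\<lambda>m. lspan R (multiples_within (\<lambda>t. ord t m))"
  note C = multiples_within_closed
  \<comment> \<open>A representation is empty or has a largest head term.\<close>
  have bound: "p = (\<lambda>m. \<zero>) \<or> (\<exists>m\<in>terms V. Q m \<and> p \<in> ?le m)" if "p \<in> lspan R (multiples_within Q)" for Q p
    using that
  proof induction
    case (step p a b)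
    then obtain s \<alpha> where b: "b = shift R s (F \<alpha>)" "s \<in> terms V" "\<alpha> \<in> M" "Q (s + \<alpha>)"
      by (auto simp: multiples_within_def)
    let ?t = "s + \<alpha>"
    have t: "?t \<in> terms V" using b heads by auto
    have b_in: "b \<in> multiples_within (\<lambda>u. u = ?t \<or> ord u ?t)"
      using b by (auto simp: multiples_within_def)
    show ?case
      using step.IH
    proof
      assume "p = (\<lambda>m. \<zero>)"
      then have "p \<in> ?le ?t" by (simp add: lspan.zero)
      then show ?thesis
        using lspan.step[OF _ step.hyps(2) b_in] t b(4) by blast
    next
      assume "\<exists>m\<in>terms V. Q m \<and> p \<in> ?le m"
      then obtain m where m: "m \<in> terms V" "Q m" "p \<in> ?le m" by blast
      show ?thesis
      proof (cases "m = ?t \<or> ord m ?t")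
        case True
        then have "multiples_within (\<lambda>u. u = m \<or> ord u m) \<subseteq> multiples_within (\<lambda>u. u = ?t \<or> ord u ?t)"
          using m t by (intro multiples_within_mono) (auto intro: term_order_trans[OF ord])
        then have "p \<in> ?le ?t" using lspan_mono m(3) by blast
        then show ?thesis
          using lspan.step[OF _ step.hyps(2) b_in] t b(4) by blast
      next
        case False
        then have "ord ?t m" using term_order_total[OF ord m(1) t] by auto
        then have "b \<in> multiples_within (\<lambda>u. u = m \<or> ord u m)"
          using b by (auto simp: multiples_within_def)
        then show ?thesis
          using lspan.step[OF m(3) step.hyps(2)] m by blast
      qed
    qed
  qed auto
  have tail: "m \<in> terms V \<Longrightarrow> q m = \<zero>" if "q \<in> ?less m" for q m
    using that
  proof induction
    case (step p a b)
    then obtain s \<alpha> where b: "b = shift R s (F \<alpha>)" "s \<in> terms V" "\<alpha> \<in> M" "ord (s + \<alpha>) m"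
      by (auto simp: multiples_within_def)
    then have "s + \<alpha> \<in> terms V" using heads by auto
    then have "b m = \<zero>"
      using b step.prems shift_F_tail[of \<alpha> s m] term_order_irrefl[OF ord step.prems]
        term_order_trans[OF ord, of m "s + \<alpha>" m] by auto
    then show ?case using step by simp
  qed auto
  \<comment> \<open>The largest head term of a representation of a standard polynomial can be lowered.\<close>
  have descend: "q \<in> ?less m" if "m \<in> terms V" "q \<in> ?le m" "standard_poly R M q" for m q
  proof (cases "\<exists>s\<in>terms V. \<exists>\<alpha>\<in>M. s + \<alpha> = m")
    case False
    then have "multiples_within (\<lambda>t. t = m \<or> ord t m) = multiples_within (\<lambda>t. ord t m)"
      unfolding multiples_within_def by blast
    then show ?thesis using that(2) by simp
  next
    case True
    then obtain s0 \<alpha>0 where s0: "s0 \<in> terms V" "\<alpha>0 \<in> M" "s0 + \<alpha>0 = m" by blast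
    let ?f = "shift R s0 (F \<alpha>0)"
    have f: "?f \<in> carrier (mpoly R V)" using s0 by (intro shift_closed F_closed)
    \<comment> \<open>All multiples with head term \<open>m\<close> are collected in the one that was chosen.\<close>
    have "\<exists>a\<in>carrier R. (\<lambda>t. q t \<ominus> a \<otimes> ?f t) \<in> ?less m"
      using that(2)
    proof induction
      case zero
      have "(\<lambda>t. \<zero> \<ominus> \<zero> \<otimes> ?f t) = (\<lambda>t. \<zero>)"
        using mpoly_coeff_closed[OF f] by (simp add: minus_eq)
      then show ?case using lspan.zero by (intro bexI[of _ \<zero>]) auto
    next
      case (step p a b)
      obtain a' where a': "a' \<in> carrier R" "(\<lambda>t. p t \<ominus> a' \<otimes> ?f t) \<in> ?less m"
        using step.IH by blast
      obtain s \<alpha> where b: "b = shift R s (F \<alpha>)" "s \<in> terms V" "\<alpha> \<in> M" "s + \<alpha> = m \<or> ord (s + \<alpha>) m"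
        using step.hyps(3) by (auto simp: multiples_within_def)
      have cl: "p t \<in> carrier R" "b t \<in> carrier R" "?f t \<in> carrier R" for t
        using lspan_coeff_closed[OF C step.hyps(1)] mpoly_coeff_closed[OF subsetD[OF C step.hyps(3)]]
          mpoly_coeff_closed[OF f] by simp_all
      show ?case
      proof (cases "s + \<alpha> = m")
        case True
        have "(\<lambda>t. b t \<ominus> ?f t) \<in> ?less m"
          using S[of \<alpha> \<alpha>0 s s0] b s0 True by simp
        from lspan_add[OF C lspan_smult[OF C step.hyps(2) this] a'(2)]
        have "(\<lambda>t. a \<otimes> (b t \<ominus> ?f t) \<oplus> (p t \<ominus> a' \<otimes> ?f t)) \<in> ?less m" .
        moreover have "a \<otimes> (b t \<ominus> ?f t) \<oplus> (p t \<ominus> a' \<otimes> ?f t) = (a \<otimes> b t \<oplus> p t) \<ominus> (a \<oplus> a') \<otimes> ?f t" for t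
          using cl[of t] a'(1) step.hyps(2) by algebra
        ultimately show ?thesis using a'(1) step.hyps(2) by (intro bexI[of _ "a \<oplus> a'"]) auto
      next
        case False
        then have "b \<in> multiples_within (\<lambda>t. ord t m)" using b by (auto simp: multiples_within_def)
        from lspan.step[OF a'(2) step.hyps(2) this]
        have "(\<lambda>t. a \<otimes> b t \<oplus> (p t \<ominus> a' \<otimes> ?f t)) \<in> ?less m" .
        moreover have "a \<otimes> b t \<oplus> (p t \<ominus> a' \<otimes> ?f t) = (a \<otimes> b t \<oplus> p t) \<ominus> a' \<otimes> ?f t" for t
          using cl[of t] a'(1) step.hyps(2) by algebra
        ultimately show ?thesis using a'(1) by (intro bexI[of _ a']) auto
      qed
    qed
    then obtain a where a: "a \<in> carrier R" "(\<lambda>t. q t \<ominus> a \<otimes> ?f t) \<in> ?less m" by blast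
    have qc: "q t \<in> carrier R" for t using lspan_coeff_closed[OF C that(2)] .
    have "\<not> standard M m" using s0 mset_subset_eq_add_right[of \<alpha>0 s0] by (auto simp: standard_def)
    then have "q m = \<zero>" using that(3) by (auto simp: standard_poly_def)
    moreover have "?f m = \<one>" using s0 F_head by auto
    moreover have "q m \<ominus> a \<otimes> ?f m = \<zero>" using tail[OF a(2) that(1)] .
    ultimately have "a = \<zero>" using a(1) by (simp add: minus_eq)
    then show ?thesis using a(2) qc mpoly_coeff_closed[OF f] by (simp add: minus_eq)
  qed
  have "p = (\<lambda>m. \<zero>)" if "m \<in> terms V" "p \<in> ?le m" for m
    using wf_ord that
  proof (induction m rule: wf_induct_rule)
    case (less m)
    have "p \<in> ?less m" using less.prems std by (intro descend)
    from bound[OF this] show ?case using less by auto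
  qed
  then show ?thesis using bound[OF p[unfolded Idl_eq_multiples_within]] by blast
qed

end

section \<open>Reduced Groebner bases over a field\<close>

lemma head_term_eqI:
  assumes ord: "term_order V ord" and "supp R p \<subseteq> terms V"
    and m: "m \<in> supp R p" and max: "\<And>t. t \<in> supp R p \<Longrightarrow> t \<noteq> m \<Longrightarrow> ord t m"
  shows "head_term R ord p = m"
  unfolding head_term_def
proof (rule the_equality)
  show "m \<in> supp R p \<and> (\<forall>t\<in>supp R p. t = m \<or> ord t m)" using m max by blast
  fix m' assume m': "m' \<in> supp R p \<and> (\<forall>t\<in>supp R p. t = m' \<or> ord t m')"
  have T: "m \<in> terms V" "m' \<in> terms V" using m m' assms(2) by auto
  show "m' = m"
  proof (rule ccontr)
    assume ne: "m' \<noteq> m"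
    have "ord m' m" using max m' ne by blast
    moreover have "ord m m'" using m' m ne by auto
    ultimately have "ord m m" using term_order_trans[OF ord, of m m' m] T by blast
    then show False using term_order_irrefl[OF ord T(1)] by blast
  qed
qed

lemma term_order_finite_max:
  assumes ord: "term_order V ord" and "finite S" "S \<noteq> {}" "S \<subseteq> terms V"
  shows "\<exists>m\<in>S. \<forall>t\<in>S. t \<noteq> m \<longrightarrow> ord t m"
  using assms(2-)
proof (induction S rule: finite_ne_induct)
  case (insert x S)
  then obtain m where m: "m \<in> S" "\<forall>t\<in>S. t \<noteq> m \<longrightarrow> ord t m" by auto
  have T: "x \<in> terms V" "m \<in> terms V" "S \<subseteq> terms V" using insert.prems m(1) by auto
  consider "x = m" | "ord x m" | "ord m x" using term_order_total[OF ord T(1,2)] by auto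
  then show ?case
  proof cases
    case 3
    have "ord t x" if "t \<in> S" for t
    proof (cases "t = m")
      case False
      then have "ord t m" using m(2) that by simp
      then show ?thesis using 3 T that by (intro term_order_trans[OF ord, of t m x]) auto
    qed (use 3 in simp)
    then show ?thesis by auto
  qed (use m in auto)
qed auto

context
  fixes R :: "('a, 'e) ring_scheme" and V :: "'v set" and ord
  assumes ord: "term_order V ord"
begin

lemma head_term_max:
  assumes p: "p \<in> carrier (mpoly R V)" and "p \<noteq> (\<lambda>m. \<zero>\<^bsub>R\<^esub>)"
  shows head_term_nonzero: "p (head_term R ord p) \<noteq> \<zero>\<^bsub>R\<^esub>"
    and head_term_greater: "\<And>t. p t \<noteq> \<zero>\<^bsub>R\<^esub> \<Longrightarrow> t \<noteq> head_term R ord p \<Longrightarrow> ord t (head_term R ord p)"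
    and head_term_in_terms: "head_term R ord p \<in> terms V"
proof -
  have S: "finite (supp R p)" "supp R p \<subseteq> terms V" using p by (auto simp: mpoly_carrier)
  have "supp R p \<noteq> {}" using assms(2) by (auto simp: supp_def)
  then obtain m where m: "m \<in> supp R p" "\<And>t. t \<in> supp R p \<Longrightarrow> t \<noteq> m \<Longrightarrow> ord t m"
    using term_order_finite_max[OF ord S(1) _ S(2)] by blast
  have h: "head_term R ord p = m" using head_term_eqI[OF ord S(2) m] .
  show "p (head_term R ord p) \<noteq> \<zero>\<^bsub>R\<^esub>" "head_term R ord p \<in> terms V"
    using m(1) S(2) h by (auto simp: supp_def)
  show "ord t (head_term R ord p)" if "p t \<noteq> \<zero>\<^bsub>R\<^esub>" "t \<noteq> head_term R ord p" for t
    using m(2)[of t] that h by (simp add: supp_def)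
qed

end

lemma (in cring) monomial_ideal_support:
  assumes L: "L \<subseteq> terms V" and p: "p \<in> Idl\<^bsub>mpoly R V\<^esub> (monom R \<one> ` L)" and m: "p m \<noteq> \<zero>"
  shows "\<exists>l\<in>L. l \<subseteq># m"
proof -
  have "p \<in> lspan R (multiples R V (monom R \<one> ` L))"
    using p L by (subst (asm) Idl_eq_lspan) auto
  then show ?thesis using m
  proof induction
    case (step p a b)
    then obtain s l where b: "b = monom R \<one> (s + l)" "s \<in> terms V" "l \<in> L"
      by (auto simp: shift_monom)
    show ?case
    proof (cases "p m = \<zero>")
      case True
      then have "b m \<noteq> \<zero>" using step.prems step.hyps(2) by auto
      then show ?thesis using b by (auto simp: monom_def split: if_splits intro!: bexI[of _ l])
    qed (use step.IH in auto)
  qed auto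
qed

text \<open>A combination of multiples of the generators only involves terms divisible by a
  generator.\<close>

lemma (in cring) monomial_ideal_mem:
  assumes L: "L \<subseteq> terms V" and one: "\<one> \<noteq> \<zero>"
  shows "monom R \<one> m \<in> Idl\<^bsub>mpoly R V\<^esub> (monom R \<one> ` L) \<longleftrightarrow> m \<in> terms V \<and> (\<exists>l\<in>L. l \<subseteq># m)"
proof
  interpret P: cring "mpoly R V" by (rule mpoly_cring)
  have C: "monom R \<one> ` L \<subseteq> carrier (mpoly R V)" using L by auto
  note I = P.genideal_ideal[OF C]
  {
    assume m: "monom R \<one> m \<in> Idl\<^bsub>mpoly R V\<^esub> (monom R \<one> ` L)"
    then have "m \<in> terms V"
      using mpoly_term[OF ideal_mpoly_closed[OF I m], of m] one by (simp add: monom_def)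
    then show "m \<in> terms V \<and> (\<exists>l\<in>L. l \<subseteq># m)"
      using monomial_ideal_support[OF L m, of m] one by (simp add: monom_def)
  }
  assume "m \<in> terms V \<and> (\<exists>l\<in>L. l \<subseteq># m)"
  then obtain l s where l: "l \<in> L" "m = s + l" "s \<in> terms V"
    by (auto simp: mset_subset_eq_exists_conv add.commute)
  have "monom R \<one> l \<in> Idl\<^bsub>mpoly R V\<^esub> (monom R \<one> ` L)"
    using P.genideal_self[OF C] l(1) by auto
  from ideal_mpoly_shift[OF I this l(3)]
  show "monom R \<one> m \<in> Idl\<^bsub>mpoly R V\<^esub> (monom R \<one> ` L)" using l(2) by (simp add: shift_monom)
qed

text \<open>The reduced Groebner basis of \<open>I\<close> is constructed from normal forms: its element with head
  term \<open>\<alpha>\<close> is the difference of \<open>x\<^sup>\<alpha>\<close> and the normal form of \<open>x\<^sup>\<alpha>\<close> modulo \<open>I\<close>.\<close>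

locale polynomial_ideal = field R for R :: "('a, 'e) ring_scheme" (structure) +
  fixes V :: "'v set" and ord and I :: "('v multiset \<Rightarrow> 'a) set"
  assumes finite_vars: "finite V" and ord: "term_order V ord" and ideal: "ideal I (mpoly R V)"
begin

definition heads :: "'v multiset set" where
  "heads = head_term R ord ` (I - {\<lambda>m. \<zero>})"

definition minimal_heads :: "'v multiset set" where
  "minimal_heads = {\<alpha> \<in> heads. \<forall>\<beta>\<in>heads. \<beta> \<subseteq># \<alpha> \<longrightarrow> \<beta> = \<alpha>}"

lemma heads_terms: "heads \<subseteq> terms V"
  using head_term_in_terms[OF ord] ideal_mpoly_closed[OF ideal] by (auto simp: heads_def)

lemma minimal_heads_terms: "minimal_heads \<subseteq> terms V"
  using heads_terms by (auto simp: minimal_heads_def)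

lemma minimal_heads_antichain: "s \<in> minimal_heads \<Longrightarrow> t \<in> minimal_heads \<Longrightarrow> s \<subseteq># t \<Longrightarrow> s = t"
  by (auto simp: minimal_heads_def)

lemma finite_minimal_heads: "finite minimal_heads"
  by (rule finite_minimal_terms[OF finite_vars minimal_heads_terms minimal_heads_antichain])

lemma minimal_head_below: "m \<in> heads \<Longrightarrow> \<exists>\<alpha>\<in>minimal_heads. \<alpha> \<subseteq># m"
proof (induction "size m" arbitrary: m rule: less_induct)
  case less
  show ?case
  proof (cases "m \<in> minimal_heads")
    case False
    then obtain \<beta> where \<beta>: "\<beta> \<in> heads" "\<beta> \<subset># m"
      using less.prems by (auto simp: minimal_heads_def)
    then obtain \<alpha> where "\<alpha> \<in> minimal_heads" "\<alpha> \<subseteq># \<beta>"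
      using less.hyps[OF mset_subset_size[OF \<beta>(2)] \<beta>(1)] by auto
    then show ?thesis using \<beta>(2) by (meson subset_mset.less_imp_le subset_mset.order_trans)
  qed auto
qed

text \<open>The head term of a nonzero element of \<open>I\<close> is divisible by a minimal one.\<close>

lemma standard_in_ideal:
  assumes p: "p \<in> I" and std: "standard_poly R minimal_heads p"
  shows "p = (\<lambda>m. \<zero>)"
proof (rule ccontr)
  assume ne: "p \<noteq> (\<lambda>m. \<zero>)"
  then have "head_term R ord p \<in> heads" using p by (auto simp: heads_def)
  then have "\<not> standard minimal_heads (head_term R ord p)"
    using minimal_head_below by (auto simp: standard_def)
  then show False
    using std head_term_nonzero[OF ord ideal_mpoly_closed[OF ideal p] ne] by (auto simp: standard_poly_def)
qed

lemma wf_ord: "wf {(s, t). s \<in> terms V \<and> t \<in> terms V \<and> ord s t}"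
  by (rule term_order_wf[OF ord finite_vars])

lemma monic_with_head:
  assumes "\<alpha> \<in> heads"
  obtains f where "f \<in> I" "f \<alpha> = \<one>" "\<And>t. f t \<noteq> \<zero> \<Longrightarrow> t \<noteq> \<alpha> \<Longrightarrow> ord t \<alpha>"
proof -
  obtain f where f: "f \<in> I" "f \<noteq> (\<lambda>m. \<zero>)" "\<alpha> = head_term R ord f"
    using assms by (auto simp: heads_def)
  note fc = ideal_mpoly_closed[OF ideal f(1)]
  have u: "f \<alpha> \<in> Units R"
    using head_term_nonzero[OF ord fc f(2)] mpoly_coeff_closed[OF fc] f(3) field_Units by auto
  show ?thesis
  proof (rule that)
    show "(\<lambda>m. inv (f \<alpha>) \<otimes> f m) \<in> I"
      using ideal_mpoly_smult[OF ideal f(1)] u by simp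
    show "inv (f \<alpha>) \<otimes> f \<alpha> = \<one>" using u by simp
    show "ord t \<alpha>" if "inv (f \<alpha>) \<otimes> f t \<noteq> \<zero>" "t \<noteq> \<alpha>" for t
    proof -
      have "f t \<noteq> \<zero>" using that(1) u by auto
      then show ?thesis using head_term_greater[OF ord fc f(2), of t] that(2) f(3) by simp
    qed
  qed
qed

definition is_basis_element :: "'v multiset \<Rightarrow> ('v multiset \<Rightarrow> 'a) \<Rightarrow> bool" where
  "is_basis_element \<alpha> f \<longleftrightarrow> f \<in> I \<and> f \<alpha> = \<one> \<and>
     (\<forall>t. f t \<noteq> \<zero> \<longrightarrow> t \<noteq> \<alpha> \<longrightarrow> ord t \<alpha> \<and> standard minimal_heads t)"

text \<open>In the difference of two candidates the head terms cancel, so it is a standard element of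
  \<open>I\<close>.\<close>

lemma basis_element_unique:
  assumes "is_basis_element \<alpha> f" and "is_basis_element \<alpha> g"
  shows "f = g"
proof -
  have I: "f \<in> I" "g \<in> I" using assms by (auto simp: is_basis_element_def)
  have cl: "f m \<in> carrier R" "g m \<in> carrier R" for m
    using mpoly_coeff_closed[OF ideal_mpoly_closed[OF ideal I(1)]]
      mpoly_coeff_closed[OF ideal_mpoly_closed[OF ideal I(2)]] by auto
  have "standard minimal_heads m" if "f m \<ominus> g m \<noteq> \<zero>" for m
  proof -
    have "m \<noteq> \<alpha>" using that assms by (auto simp: is_basis_element_def minus_eq r_neg)
    moreover have "f m \<noteq> \<zero> \<or> g m \<noteq> \<zero>" using that by (auto simp: minus_eq)
    ultimately show ?thesis using assms by (auto simp: is_basis_element_def)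
  qed
  then have "(\<lambda>m. f m \<ominus> g m) = (\<lambda>m. \<zero>)"
    using ideal_mpoly_minus[OF ideal I] by (intro standard_in_ideal) (auto simp: standard_poly_def)
  then have "f m \<ominus> g m = \<zero>" for m by (rule fun_cong)
  then show ?thesis using cl r_right_minus_eq by (auto simp: fun_eq_iff)
qed

text \<open>Start from any monic elements of \<open>I\<close> with the minimal head terms and replace the tail
  of the one with head term \<open>\<alpha>\<close> by its remainder under division by all of them.\<close>

lemma basis_element_exists:
  assumes \<alpha>: "\<alpha> \<in> minimal_heads"
  shows "\<exists>f. is_basis_element \<alpha> f"
proof -
  have hd: "\<forall>\<alpha>\<in>minimal_heads. \<exists>f. f \<in> I \<and> f \<alpha> = \<one> \<and> (\<forall>t. f t \<noteq> \<zero> \<longrightarrow> t \<noteq> \<alpha> \<longrightarrow> ord t \<alpha>)"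
  proof
    fix \<alpha> assume "\<alpha> \<in> minimal_heads"
    then have "\<alpha> \<in> heads" by (simp add: minimal_heads_def)
    then show "\<exists>f. f \<in> I \<and> f \<alpha> = \<one> \<and> (\<forall>t. f t \<noteq> \<zero> \<longrightarrow> t \<noteq> \<alpha> \<longrightarrow> ord t \<alpha>)"
      by (rule monic_with_head) blast
  qed
  obtain F where F: "\<And>\<alpha>. \<alpha> \<in> minimal_heads \<Longrightarrow> F \<alpha> \<in> I \<and> F \<alpha> \<alpha> = \<one> \<and> (\<forall>t. F \<alpha> t \<noteq> \<zero> \<longrightarrow> t \<noteq> \<alpha> \<longrightarrow> ord t \<alpha>)"
    using bchoice[OF hd] by blast
  interpret F: monic_family R V ord minimal_heads F
    using ord wf_ord minimal_heads_terms F ideal_mpoly_closed[OF ideal] by unfold_locales auto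
  have T: "\<alpha> \<in> terms V" using \<alpha> minimal_heads_terms by auto
  let ?p = "\<lambda>m. F \<alpha> m \<ominus> monom R \<one> \<alpha> m"
  note Fc = F.F_closed[OF \<alpha>]
  have mc: "monom R \<one> \<alpha> \<in> carrier (mpoly R V)" using T by simp
  have pc: "?p \<in> carrier (mpoly R V)"
    using ring.ring_simprules(4)[OF cring.axioms(1)[OF mpoly_cring[of V]] Fc mc]
    unfolding mpoly_minus[OF Fc mc] .
  have "ord m \<alpha>" if "?p m \<noteq> \<zero>" for m
  proof -
    have "m \<noteq> \<alpha>" using that F.F_head[OF \<alpha>] by (auto simp: monom_def minus_eq r_neg)
    moreover have "F \<alpha> m \<noteq> \<zero>" using that \<open>m \<noteq> \<alpha>\<close> by (auto simp: monom_def minus_eq)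
    ultimately show ?thesis using F.F_tail[OF \<alpha>] by simp
  qed
  then obtain r where r: "r \<in> carrier (mpoly R V)" "standard_poly R minimal_heads r"
    "\<And>m. r m \<noteq> \<zero> \<Longrightarrow> ord m \<alpha>" "(\<lambda>m. ?p m \<ominus> r m) \<in> lspan R (F.multiples_within (\<lambda>t. ord t \<alpha>))"
    using T by (elim F.division[of "\<lambda>t. ord t \<alpha>", OF _ pc, rotated -1]) (auto intro: term_order_trans[OF ord])
  have "F.multiples_within (\<lambda>t. ord t \<alpha>) \<subseteq> I"
    using F ideal_mpoly_shift[OF ideal] by (auto simp: F.multiples_within_def)
  then have "(\<lambda>m. ?p m \<ominus> r m) \<in> I" using r(4) ideal_lspan_subset[OF ideal] by blast
  from ideal_mpoly_minus[OF ideal _ this, of "F \<alpha>"]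
  have "(\<lambda>m. F \<alpha> m \<ominus> (?p m \<ominus> r m)) \<in> I" using F \<alpha> by blast
  moreover have "F \<alpha> m \<ominus> (?p m \<ominus> r m) = monom R \<one> \<alpha> m \<oplus> r m" for m
    using mpoly_coeff_closed[OF Fc, of m] mpoly_coeff_closed[OF mc, of m] mpoly_coeff_closed[OF r(1), of m]
    by algebra
  ultimately have I: "(\<lambda>m. monom R \<one> \<alpha> m \<oplus> r m) \<in> I" by simp
  have "r \<alpha> = \<zero>" using r(3) term_order_irrefl[OF ord T] by blast
  then have "is_basis_element \<alpha> (\<lambda>m. monom R \<one> \<alpha> m \<oplus> r m)"
    using I r mpoly_coeff_closed[OF r(1)] by (auto simp: is_basis_element_def monom_def standard_poly_def)
  then show ?thesis by blast
qed

definition basis :: "'v multiset \<Rightarrow> 'v multiset \<Rightarrow> 'a" where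
  "basis \<alpha> = (SOME f. is_basis_element \<alpha> f)"

lemma basis_element: "\<alpha> \<in> minimal_heads \<Longrightarrow> is_basis_element \<alpha> (basis \<alpha>)"
  unfolding basis_def using basis_element_exists by (rule someI_ex)

lemma basis_in_ideal: "\<alpha> \<in> minimal_heads \<Longrightarrow> basis \<alpha> \<in> I"
  using basis_element by (auto simp: is_basis_element_def)

lemma basis_tail_standard:
  "\<alpha> \<in> minimal_heads \<Longrightarrow> basis \<alpha> t \<noteq> \<zero> \<Longrightarrow> t \<noteq> \<alpha> \<Longrightarrow> standard minimal_heads t"
  using basis_element by (auto simp: is_basis_element_def)

lemma basis_family: "monic_family R V ord minimal_heads basis"
  using ord wf_ord minimal_heads_terms basis_element ideal_mpoly_closed[OF ideal basis_in_ideal]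
  by unfold_locales (auto simp: is_basis_element_def)

sublocale basis: monic_family R V ord minimal_heads basis
  by (rule basis_family)

lemma ideal_eq_Idl_basis: "I = Idl\<^bsub>mpoly R V\<^esub> (basis ` minimal_heads)"
  by (rule basis.ideal_eqI[OF ideal]) (auto intro: basis_in_ideal standard_in_ideal)

lemma basis_supp_terms: "\<alpha> \<in> minimal_heads \<Longrightarrow> supp R (basis \<alpha>) \<subseteq> terms V"
  using basis.F_closed by (auto simp: mpoly_carrier)

lemma head_term_basis: "\<alpha> \<in> minimal_heads \<Longrightarrow> head_term R ord (basis \<alpha>) = \<alpha>"
  using basis.F_head basis.F_tail basis_supp_terms one_not_zero
  by (intro head_term_eqI[OF ord]) (auto simp: supp_def)

lemma zero_not_basis: "(\<lambda>m. \<zero>) \<notin> basis ` minimal_heads"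
proof
  assume "(\<lambda>m. \<zero>) \<in> basis ` minimal_heads"
  then obtain \<alpha> where "(\<lambda>m. \<zero>) = basis \<alpha>" "\<alpha> \<in> minimal_heads" by (rule imageE)
  then show False using basis.F_head[of \<alpha>] one_not_zero by metis
qed

lemma head_terms_ideal_eq:
  "head_terms_ideal R V ord G = Idl\<^bsub>mpoly R V\<^esub> (monom R \<one> ` head_term R ord ` (G - {\<lambda>m. \<zero>}))"
  unfolding head_terms_ideal_def by (rule arg_cong[of _ _ "genideal (mpoly R V)"]) auto

lemma monom_in_initial_ideal:
  "monom R \<one> m \<in> head_terms_ideal R V ord I \<longleftrightarrow> m \<in> terms V \<and> \<not> standard minimal_heads m"
proof -
  have "(\<exists>l\<in>heads. l \<subseteq># m) \<longleftrightarrow> \<not> standard minimal_heads m"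
    using minimal_head_below unfolding standard_def minimal_heads_def
    by (metis (no_types, lifting) mem_Collect_eq subset_mset.order_trans)
  then show ?thesis
    unfolding head_terms_ideal_eq using monomial_ideal_mem[OF heads_terms one_not_zero]
    by (simp add: heads_def)
qed

lemma head_terms_basis: "head_term R ord ` (basis ` minimal_heads - {\<lambda>m. \<zero>}) = minimal_heads"
proof -
  have "basis ` minimal_heads - {\<lambda>m. \<zero>} = basis ` minimal_heads"
    using zero_not_basis by simp
  then show ?thesis using head_term_basis by (simp add: image_image cong: image_cong)
qed

lemma reduced_groebner_basis:
  "is_reduced_groebner_basis R V ord I (basis ` minimal_heads)"
proof -
  interpret P: cring "mpoly R V" by (rule mpoly_cring)
  have "head_terms_ideal R V ord (basis ` minimal_heads) = head_terms_ideal R V ord I"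
  proof
    have C: "monom R \<one> ` heads \<subseteq> carrier (mpoly R V)" "monom R \<one> ` minimal_heads \<subseteq> carrier (mpoly R V)"
      using heads_terms minimal_heads_terms by auto
    show "head_terms_ideal R V ord (basis ` minimal_heads) \<subseteq> head_terms_ideal R V ord I"
      unfolding head_terms_ideal_eq head_terms_basis
      using P.genideal_self[OF C(1)]
      by (intro P.genideal_minimal P.genideal_ideal)
        (auto simp: minimal_heads_def heads_def[symmetric] intro: subsetD[OF C(1)])
    show "head_terms_ideal R V ord I \<subseteq> head_terms_ideal R V ord (basis ` minimal_heads)"
      unfolding head_terms_ideal_eq head_terms_basis heads_def[symmetric]
    proof (intro P.genideal_minimal P.genideal_ideal C)
      show "monom R \<one> ` heads \<subseteq> Idl\<^bsub>mpoly R V\<^esub> (monom R \<one> ` minimal_heads)"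
        using monomial_ideal_mem[OF minimal_heads_terms one_not_zero] heads_terms minimal_head_below
        by auto
    qed
  qed
  moreover have "\<not> head_term R ord g' \<subseteq># m"
    if g: "g \<in> basis ` minimal_heads" "g' \<in> basis ` minimal_heads - {g}" "m \<in> supp R g" for g g' m
  proof -
    obtain \<alpha> \<beta> where *: "g = basis \<alpha>" "g' = basis \<beta>" "\<alpha> \<in> minimal_heads" "\<beta> \<in> minimal_heads" "\<alpha> \<noteq> \<beta>"
      using g by auto
    then have "\<not> \<beta> \<subseteq># m"
      using g(3) basis_tail_standard[of \<alpha> m] minimal_heads_antichain[of \<beta> \<alpha>]
      by (cases "m = \<alpha>") (auto simp: supp_def standard_def)
    then show ?thesis using * head_term_basis by simp
  qed
  moreover note zero_not_basis
  ultimately show ?thesis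
    unfolding is_reduced_groebner_basis_def
    using finite_minimal_heads basis_in_ideal head_term_basis basis.F_head
    by (auto simp: head_coeff_def)
qed

text \<open>Each minimal head term is the head term of an element of \<open>G\<close>. Since \<open>G\<close> is reduced, it has no other
  head terms and its tails are standard, so \<open>basis_element_unique\<close> applies.\<close>

lemma reduced_groebner_basis_unique:
  assumes G: "is_reduced_groebner_basis R V ord I G"
  shows "G = basis ` minimal_heads"
proof -
  have GI: "G \<subseteq> I" and G0: "(\<lambda>m. \<zero>) \<notin> G"
    and Gh: "head_terms_ideal R V ord G = head_terms_ideal R V ord I"
    and G1: "\<And>g. g \<in> G \<Longrightarrow> g (head_term R ord g) = \<one>"
    and Gr: "\<And>g g' m. g \<in> G \<Longrightarrow> g' \<in> G \<Longrightarrow> g' \<noteq> g \<Longrightarrow> g m \<noteq> \<zero> \<Longrightarrow> \<not> head_term R ord g' \<subseteq># m"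
    using G unfolding is_reduced_groebner_basis_def head_coeff_def supp_def mpoly_simps by blast+
  have hd: "head_term R ord g \<in> heads" if "g \<in> G" for g
    using that GI G0 by (auto simp: heads_def)
  have ex: "\<exists>g\<in>G. head_term R ord g = \<alpha>" if \<alpha>: "\<alpha> \<in> minimal_heads" for \<alpha>
  proof -
    have "monom R \<one> \<alpha> \<in> Idl\<^bsub>mpoly R V\<^esub> (monom R \<one> ` head_term R ord ` (G - {\<lambda>m. \<zero>}))"
      using monom_in_initial_ideal[of \<alpha>] minimal_heads_terms \<alpha> Gh
      unfolding head_terms_ideal_eq by (auto simp: standard_def)
    moreover have "head_term R ord ` (G - {\<lambda>m. \<zero>}) \<subseteq> terms V"
      using hd heads_terms by auto
    ultimately obtain g where "g \<in> G" "head_term R ord g \<subseteq># \<alpha>"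
      using monomial_ideal_mem[OF _ one_not_zero, of "head_term R ord ` (G - {\<lambda>m. \<zero>})"] by blast
    then show ?thesis using \<alpha> hd by (auto simp: minimal_heads_def)
  qed
  have each: "\<exists>\<alpha>\<in>minimal_heads. g = basis \<alpha> \<and> head_term R ord g = \<alpha>" if g: "g \<in> G" for g
  proof -
    let ?h = "head_term R ord g"
    have gI: "g \<in> I" and g0: "g \<noteq> (\<lambda>m. \<zero>)" using g GI G0 by auto
    note gc = ideal_mpoly_closed[OF ideal gI]
    obtain \<alpha> where \<alpha>: "\<alpha> \<in> minimal_heads" "\<alpha> \<subseteq># ?h" using minimal_head_below hd g by blast
    obtain g' where g': "g' \<in> G" "head_term R ord g' = \<alpha>" using ex \<alpha>(1) by blast
    have "g' = g"
    proof (rule ccontr)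
      assume "g' \<noteq> g"
      from Gr[OF g g'(1) this, of ?h] show False
        using g'(2) \<alpha>(2) G1[OF g] one_not_zero by simp
    qed
    then have h: "?h = \<alpha>" using g'(2) by simp
    have "ord t \<alpha> \<and> standard minimal_heads t" if t: "g t \<noteq> \<zero>" "t \<noteq> \<alpha>" for t
    proof
      show o: "ord t \<alpha>" using head_term_greater[OF ord gc g0 t(1)] t(2) h by simp
      have T: "t \<in> terms V" "\<alpha> \<in> terms V" using mpoly_term[OF gc t(1)] \<alpha>(1) minimal_heads_terms by auto
      show "standard minimal_heads t"
        unfolding standard_def
      proof (intro ballI notI)
        fix \<beta> assume \<beta>: "\<beta> \<in> minimal_heads" "\<beta> \<subseteq># t"
        obtain g'' where g'': "g'' \<in> G" "head_term R ord g'' = \<beta>" using ex \<beta>(1) by blast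
        have "g'' = g"
        proof (rule ccontr)
          assume "g'' \<noteq> g"
          from Gr[OF g g''(1) this t(1)] show False using g''(2) \<beta>(2) by simp
        qed
        then have "\<alpha> \<subseteq># t" using g''(2) h \<beta>(2) by simp
        then have "ord \<alpha> t" using term_order_divides[OF ord, of \<alpha> t] t(2) T by auto
        then have "ord t t" using o T term_order_trans[OF ord, of t \<alpha> t] by blast
        then show False using term_order_irrefl[OF ord T(1)] by blast
      qed
    qed
    then have "is_basis_element \<alpha> g"
      using gI G1[OF g] h by (simp add: is_basis_element_def)
    then have "g = basis \<alpha>" using basis_element[OF \<alpha>(1)] by (rule basis_element_unique)
    then show ?thesis using \<alpha>(1) h by (intro bexI[of _ \<alpha>] conjI)
  qed
  show ?thesis
  proof
    show "G \<subseteq> basis ` minimal_heads"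
    proof
      fix g assume "g \<in> G"
      then obtain \<alpha> where "\<alpha> \<in> minimal_heads" "g = basis \<alpha>" using each by auto
      then show "g \<in> basis ` minimal_heads" by (intro image_eqI)
    qed
    show "basis ` minimal_heads \<subseteq> G"
    proof
      fix f assume "f \<in> basis ` minimal_heads"
      then obtain \<alpha> where \<alpha>: "\<alpha> \<in> minimal_heads" "f = basis \<alpha>" by blast
      obtain g where "g \<in> G" "head_term R ord g = \<alpha>" using ex \<alpha>(1) by blast
      then show "f \<in> G" using each[of g] \<alpha>(2) by simp
    qed
  qed
qed

lemma the_reduced_groebner_basis:
  "(THE G. is_reduced_groebner_basis R V ord I G) = basis ` minimal_heads"
  using reduced_groebner_basis reduced_groebner_basis_unique by (rule the_equality)

lemma the_basis_element:
  assumes "\<alpha> \<in> minimal_heads"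
  shows "(THE f. f \<in> basis ` minimal_heads \<and> head_term R ord f = \<alpha>) = basis \<alpha>"
  using assms head_term_basis by (intro the_equality) auto

text \<open>The component of degree \<open>size \<alpha>\<close> contains the head term, so the other components add up
  to a standard element of \<open>I\<close>.\<close>

lemma basis_homogeneous:
  assumes hom: "homogeneous_ideal R V I" and \<alpha>: "\<alpha> \<in> minimal_heads" and t: "basis \<alpha> t \<noteq> \<zero>"
  shows "size t = size \<alpha>"
proof (rule ccontr)
  assume ne: "size t \<noteq> size \<alpha>"
  let ?f = "basis \<alpha>"
  have cl: "?f m \<in> carrier R" for m
    using mpoly_coeff_closed[OF basis.F_closed[OF \<alpha>]] .
  have "hom_component R (size \<alpha>) ?f \<in> I"
    using hom basis_in_ideal[OF \<alpha>] by (simp add: homogeneous_ideal_def)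
  from ideal_mpoly_minus[OF ideal basis_in_ideal[OF \<alpha>] this]
  have "(\<lambda>m. ?f m \<ominus> hom_component R (size \<alpha>) ?f m) \<in> I" .
  moreover have "standard minimal_heads m" if "?f m \<ominus> hom_component R (size \<alpha>) ?f m \<noteq> \<zero>" for m
  proof -
    have "size m \<noteq> size \<alpha>" using that cl by (auto simp: hom_component_def minus_eq r_neg)
    then have "m \<noteq> \<alpha>" "?f m \<noteq> \<zero>" using that by (auto simp: hom_component_def minus_eq)
    then show ?thesis using basis_tail_standard[OF \<alpha>] by simp
  qed
  ultimately have "(\<lambda>m. ?f m \<ominus> hom_component R (size \<alpha>) ?f m) = (\<lambda>m. \<zero>)"
    by (intro standard_in_ideal) (auto simp: standard_poly_def)
  from fun_cong[OF this, of t] show False using ne t cl by (simp add: hom_component_def minus_eq)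
qed

end

text \<open>Hilbert's basis theorem over a field; the generators are a reduced Groebner basis.\<close>

lemma (in field) mpoly_noetherian:
  assumes "finite V" and "term_order V ord"
  shows "noetherian_ring (mpoly R V)"
proof -
  interpret P: cring "mpoly R V" by (rule mpoly_cring)
  show ?thesis
  proof (rule P.noetherian_ringI)
    fix I assume I: "ideal I (mpoly R V)"
    interpret polynomial_ideal R V ord I
      by (intro polynomial_ideal.intro polynomial_ideal_axioms.intro field_axioms assms I)
    show "\<exists>A\<subseteq>carrier (mpoly R V). finite A \<and> I = Idl\<^bsub>mpoly R V\<^esub> A"
      using ideal_eq_Idl_basis finite_minimal_heads basis.F_closed
      by (intro exI[of _ "basis ` minimal_heads"]) auto
  qed
qed

section \<open>The degree reverse order\<close>

lemma diff_replicate_count: "a - replicate_mset (count a n) n = filter_mset (\<lambda>i. i \<noteq> n) a"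
  by (rule multiset_eqI) simp

lemma degrevorder_iff:
  "degrevorder n prec a b \<longleftrightarrow> size a < size b \<or> size a = size b \<and>
    (count a n > count b n \<or> count a n = count b n \<and>
      prec (filter_mset (\<lambda>i. i \<noteq> n) a) (filter_mset (\<lambda>i. i \<noteq> n) b))"
  by (simp add: degrevorder_def diff_replicate_count)

lemma filter_terms_below: "a \<in> terms {..n} \<Longrightarrow> filter_mset (\<lambda>i. i \<noteq> n) a \<in> terms {..<n}" for n :: nat
  by (auto simp: terms_def)

lemma multiset_eq_filter_count:
  assumes "filter_mset (\<lambda>i. i \<noteq> n) a = filter_mset (\<lambda>i. i \<noteq> n) b" and "count a n = count b n"
  shows "a = b"
proof (rule multiset_eqI)
  fix i show "count a i = count b i"
    using arg_cong[OF assms(1), of "\<lambda>m. count m i"] assms(2) by (cases "i = n") auto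
qed

lemma term_order_degrevorder:
  assumes prec: "term_order {..<n} prec"
  shows "term_order {..n} (degrevorder n prec)"
  unfolding term_order_def
proof (intro conjI ballI impI)
  let ?f = "filter_mset (\<lambda>i. i \<noteq> n)"
  fix s t u assume s: "s \<in> terms {..n}"
  then have fs: "?f s \<in> terms {..<n}" by (rule filter_terms_below)
  show "\<not> degrevorder n prec s s"
    using term_order_irrefl[OF prec fs] by (simp add: degrevorder_iff)
  have empty_least: "prec {#} (?f s)" if "?f s \<noteq> {#}"
    using term_order_divides[OF prec _ _ fs, of "{#}"] that by auto
  show "degrevorder n prec {#} s" if "s \<noteq> {#}"
    using that by (simp add: degrevorder_iff nonempty_has_size)
  assume t: "t \<in> terms {..n}"
  then have ft: "?f t \<in> terms {..<n}" by (rule filter_terms_below)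
  show "degrevorder n prec s t \<or> degrevorder n prec t s" if "s \<noteq> t"
    using term_order_total[OF prec fs ft] multiset_eq_filter_count[of n s t] that
    by (auto simp: degrevorder_iff)
  assume u: "u \<in> terms {..n}"
  then have fu: "?f u \<in> terms {..<n}" by (rule filter_terms_below)
  show "degrevorder n prec s u" if "degrevorder n prec s t" "degrevorder n prec t u"
    using that term_order_trans[OF prec _ _ fs ft fu] by (auto simp: degrevorder_iff)
  show "degrevorder n prec (s + u) (t + u)" if "degrevorder n prec s t"
    using that term_order_add[OF prec _ fs ft fu] by (auto simp: degrevorder_iff add.commute)
qed

section \<open>Change of coefficients\<close>

text \<open>Representations over \<open>K\<close> are transported to \<open>A\<close>, and representations over \<open>A\<close> to \<open>B\<close>, by this lemma.\<close>

lemma ring_hom_lspan: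
  assumes R: "cring R" and S: "cring S" and h: "h \<in> ring_hom R S"
    and B: "B \<subseteq> carrier (mpoly R V)" and "p \<in> lspan R B"
  shows "(\<lambda>m. h (p m)) \<in> lspan S ((\<lambda>b m. h (b m)) ` B)"
proof -
  interpret ring_hom_cring R S h by (intro ring_hom_cring.intro ring_hom_cring_axioms.intro R S h)
  show ?thesis
    using assms(5)
  proof induction
    case (step p a b)
    have "b m \<in> carrier R" "p m \<in> carrier R" for m
      using mpoly_coeff_closed[OF subsetD[OF B step.hyps(3)]] R.lspan_coeff_closed[OF B step.hyps(1)] by auto
    then show ?case
      using lspan.step[OF step.IH, of "h a" "\<lambda>m. h (b m)"] step.hyps by simp
  qed (simp add: lspan.zero)
qed

lemma ring_hom_mpoly_closed:
  assumes R: "cring R" and S: "cring S" and h: "h \<in> ring_hom R S" and p: "p \<in> carrier (mpoly R V)"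
  shows "(\<lambda>m. h (p m)) \<in> carrier (mpoly S V)"
proof -
  interpret ring_hom_cring R S h by (intro ring_hom_cring.intro ring_hom_cring_axioms.intro R S h)
  show ?thesis
  proof (rule mpoly_carrierI[of _ _ "supp R p"])
    fix m
    show "h (p m) \<in> carrier S" using mpoly_coeff_closed[OF p] by simp
    assume "h (p m) \<noteq> \<zero>\<^bsub>S\<^esub>"
    then have "p m \<noteq> \<zero>\<^bsub>R\<^esub>" by auto
    then show "m \<in> supp R p \<and> m \<in> terms V" using mpoly_term[OF p] by (auto simp: supp_def)
  qed (use p in \<open>simp add: mpoly_carrier\<close>)
qed

lemma ring_hom_shift:
  assumes R: "cring R" and S: "cring S" and h: "h \<in> ring_hom R S"
  shows "(\<lambda>m. h (shift R s p m)) = shift S s (\<lambda>m. h (p m))"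
proof -
  interpret ring_hom_cring R S h by (intro ring_hom_cring.intro ring_hom_cring_axioms.intro R S h)
  show ?thesis by (auto simp: shift_def)
qed

lemma algebra_scalar_hom:
  assumes "algebra K A"
  shows "(\<lambda>k. k \<odot>\<^bsub>A\<^esub> \<one>\<^bsub>A\<^esub>) \<in> ring_hom K A"
proof -
  interpret algebra K A by fact
  show ?thesis
    by (rule ring_hom_memI)
      (simp_all add: smult_l_distr smult_assoc1 smult_assoc2)
qed

section \<open>Syzygies of the reduced Groebner basis\<close>

lemma (in cring) mpoly_minus_closed:
  assumes "p \<in> carrier (mpoly R V)" and "q \<in> carrier (mpoly R V)"
  shows "(\<lambda>m. p m \<ominus> q m) \<in> carrier (mpoly R V)"
  using ring.ring_simprules(4)[OF cring.axioms(1)[OF mpoly_cring[of V]] assms]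
  unfolding mpoly_minus[OF assms] .

context monic_family
begin

lemma shift_F_head:
  assumes "\<alpha> \<in> M" shows "shift R s (F \<alpha>) (s + \<alpha>) = \<one>"
  using F_head[OF assms] by simp

lemma syzygy_tail:
  assumes "\<alpha> \<in> M" "\<alpha>' \<in> M" "s \<in> terms V" "s' \<in> terms V" "s + \<alpha> = s' + \<alpha>'"
    and "shift R s (F \<alpha>) m \<ominus> shift R s' (F \<alpha>') m \<noteq> \<zero>"
  shows "ord m (s + \<alpha>)"
proof -
  have ne: "m \<noteq> s + \<alpha>"
    using assms shift_F_head[of \<alpha> s] shift_F_head[of \<alpha>' s'] by (auto simp: minus_eq r_neg)
  have "shift R s (F \<alpha>) m \<noteq> \<zero> \<or> shift R s' (F \<alpha>') m \<noteq> \<zero>"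
    using assms(6) by (auto simp: minus_eq)
  then show ?thesis
    using shift_F_tail[of \<alpha> s m] shift_F_tail[of \<alpha>' s' m] assms ne by auto
qed

end

text \<open>The difference lies in \<open>I\<close> and all its terms are smaller than \<open>s + \<alpha>\<close>. Dividing it by the
  basis gives a representation below \<open>s + \<alpha>\<close>, because the remainder is a standard
  element of \<open>I\<close>. So the reduced basis satisfies the hypothesis of Buchberger's criterion.\<close>

lemma (in polynomial_ideal) basis_syzygy:
  assumes M: "\<alpha> \<in> minimal_heads" "\<alpha>' \<in> minimal_heads"
    and T: "s \<in> terms V" "s' \<in> terms V" and eq: "s + \<alpha> = s' + \<alpha>'"
  shows "(\<lambda>m. shift R s (basis \<alpha>) m \<ominus> shift R s' (basis \<alpha>') m)
    \<in> lspan R (basis.multiples_within (\<lambda>t. ord t (s + \<alpha>)))"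
proof -
  let ?d = "\<lambda>m. shift R s (basis \<alpha>) m \<ominus> shift R s' (basis \<alpha>') m"
  have sI: "shift R s (basis \<alpha>) \<in> I" "shift R s' (basis \<alpha>') \<in> I"
    using M T basis_in_ideal ideal_mpoly_shift[OF ideal] by auto
  have dI: "?d \<in> I" using ideal_mpoly_minus[OF ideal sI] .
  have u: "s + \<alpha> \<in> terms V" using M T minimal_heads_terms by auto
  have sub: "lspan R (basis.multiples_within (\<lambda>t. ord t (s + \<alpha>))) \<subseteq> I"
    using basis_in_ideal ideal_mpoly_shift[OF ideal]
    by (intro ideal_lspan_subset[OF ideal]) (auto simp: basis.multiples_within_def)
  obtain r where r: "r \<in> carrier (mpoly R V)" "standard_poly R minimal_heads r"
    "(\<lambda>m. ?d m \<ominus> r m) \<in> lspan R (basis.multiples_within (\<lambda>t. ord t (s + \<alpha>)))"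
  proof (rule basis.division[of "\<lambda>t. ord t (s + \<alpha>)", OF _ ideal_mpoly_closed[OF ideal dI]])
    show "ord s' (s + \<alpha>)" if "s' \<in> terms V" "t \<in> terms V" "ord t (s + \<alpha>)" "ord s' t" for s' t
      using term_order_trans[OF ord, of s' t "s + \<alpha>"] that u by blast
    show "ord m (s + \<alpha>)" if "?d m \<noteq> \<zero>" for m
      using basis.syzygy_tail[OF M T eq that] .
  qed
  have "r \<in> I" by (rule ideal_mpoly_remainder[OF ideal dI r(1) subsetD[OF sub r(3)]])
  then have "r = (\<lambda>m. \<zero>)" using standard_in_ideal r(2) by simp
  moreover have "?d m \<ominus> \<zero> = ?d m" for m
    using mpoly_coeff_closed[OF ideal_mpoly_closed[OF ideal dI], of m] by algebra
  ultimately show ?thesis using r(3) by simp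
qed

section \<open>Zero divisors modulo an ideal\<close>

lemma quotient_nonzerodivisor_iff:
  assumes "cring P" and "ideal I P" and x: "x \<in> carrier P"
  shows "(\<forall>y\<in>carrier (P Quot I). (I +>\<^bsub>P\<^esub> x) \<otimes>\<^bsub>P Quot I\<^esub> y = \<zero>\<^bsub>P Quot I\<^esub> \<longrightarrow> y = \<zero>\<^bsub>P Quot I\<^esub>)
    \<longleftrightarrow> (\<forall>p\<in>carrier P. x \<otimes>\<^bsub>P\<^esub> p \<in> I \<longrightarrow> p \<in> I)"
proof -
  interpret P: cring P by fact
  interpret I: ideal I P by fact
  have "carrier (P Quot I) = (\<lambda>p. I +>\<^bsub>P\<^esub> p) ` carrier P"
    by (auto simp: FactRing_simps)
  moreover have "I +>\<^bsub>P\<^esub> p = \<zero>\<^bsub>P Quot I\<^esub> \<longleftrightarrow> p \<in> I" if "p \<in> carrier P" for p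
    using I.a_rcos_self[OF that] I.a_rcos_const by (auto simp: FactRing_def)
  moreover have "(I +>\<^bsub>P\<^esub> x) \<otimes>\<^bsub>P Quot I\<^esub> (I +>\<^bsub>P\<^esub> p) = I +>\<^bsub>P\<^esub> (x \<otimes>\<^bsub>P\<^esub> p)" if "p \<in> carrier P" for p
    using I.rcoset_mult_add[OF x that] by (simp add: FactRing_def)
  ultimately show ?thesis using x by auto
qed

section \<open>Normal forms of liftings\<close>

lemma terms_atMost: "m \<in> terms {..<n} \<Longrightarrow> m \<in> terms {..n}" for n :: nat
  by (force simp: terms_def)

text \<open>The substitution \<open>x\<^sub>n = 0\<close>.\<close>

definition restrict_last :: "('a, 'e) ring_scheme \<Rightarrow> nat \<Rightarrow> (nat multiset \<Rightarrow> 'a) \<Rightarrow> nat multiset \<Rightarrow> 'a" where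
  "restrict_last R n g = (\<lambda>m. if n \<in># m then \<zero>\<^bsub>R\<^esub> else g m)"

context cring
begin

lemma restrict_last_closed:
  "p \<in> carrier (mpoly R {..n}) \<Longrightarrow> restrict_last R n p \<in> carrier (mpoly R {..<n})"
  by (rule mpoly_carrierI[of _ _ "supp R p"])
    (auto simp: restrict_last_def mpoly_coeff_closed mpoly_carrier supp_def terms_def less_le
      subset_iff split: if_splits)

lemma restrict_last_id:
  assumes "p \<in> carrier (mpoly R {..<n})" shows "restrict_last R n p = p"
proof
  fix m show "restrict_last R n p m = p m"
    using mpoly_term[OF assms, of m] by (cases "p m = \<zero>") (auto simp: restrict_last_def terms_def)
qed

lemma restrict_last_minus:
  "restrict_last R n (\<lambda>m. p m \<ominus> q m) = (\<lambda>m. restrict_last R n p m \<ominus> restrict_last R n q m)"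
  by (auto simp: restrict_last_def minus_eq)

lemma restrict_last_lin:
  "a \<in> carrier R \<Longrightarrow> restrict_last R n (\<lambda>m. a \<otimes> b m \<oplus> p m)
    = (\<lambda>m. a \<otimes> restrict_last R n b m \<oplus> restrict_last R n p m)"
  by (auto simp: restrict_last_def)

lemma restrict_last_hom_component:
  "restrict_last R n (hom_component R d p) = hom_component R d (restrict_last R n p)"
  by (auto simp: restrict_last_def hom_component_def)

lemma restrict_last_zero [simp]: "restrict_last R n (\<lambda>m. \<zero>) = (\<lambda>m. \<zero>)"
  by (auto simp: restrict_last_def)

lemma restrict_last_shift:
  "restrict_last R n (shift R s p) = (if n \<in># s then (\<lambda>m. \<zero>) else shift R s (restrict_last R n p))"
proof (cases "n \<in># s")
  case True
  then have "\<not> s \<subseteq># m" if "n \<notin># m" for m using that by (auto dest: mset_subset_eqD)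
  then show ?thesis using True by (auto simp: restrict_last_def shift_def)
next
  case False
  then have "n \<in># m - s \<longleftrightarrow> n \<in># m" if "s \<subseteq># m" for m
    using that by (auto simp: in_diff_count not_in_iff) 
  then show ?thesis using False by (auto simp: restrict_last_def shift_def)
qed

lemma divide_last:
  assumes p: "p \<in> carrier (mpoly R V)" and r: "restrict_last R n p = (\<lambda>m. \<zero>)"
  obtains p1 where "p1 \<in> carrier (mpoly R V)" "p = shift R {#n#} p1" "\<And>m. p1 m = p (add_mset n m)"
proof (rule that[of "\<lambda>m. p (add_mset n m)"])
  show "(\<lambda>m. p (add_mset n m)) \<in> carrier (mpoly R V)"
  proof (rule mpoly_carrierI[of _ _ "(\<lambda>m. m - {#n#}) ` supp R p"])
    fix m
    show "p (add_mset n m) \<in> carrier R" using mpoly_coeff_closed[OF p] .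
    assume *: "p (add_mset n m) \<noteq> \<zero>"
    have "m = add_mset n m - {#n#}" by simp
    then show "m \<in> (\<lambda>m. m - {#n#}) ` supp R p \<and> m \<in> terms V"
      using * mpoly_term[OF p *] by (auto simp: supp_def terms_def intro!: image_eqI[of _ _ "add_mset n m"])
  qed (use p in \<open>simp add: mpoly_carrier\<close>)
  show "p = shift R {#n#} (\<lambda>m. p (add_mset n m))"
  proof
    fix m show "p m = shift R {#n#} (\<lambda>m. p (add_mset n m)) m"
      using fun_cong[OF r, of m] by (auto simp: shift_def restrict_last_def single_subset_iff)
  qed
qed simp

end

locale lifting_problem =
  fixes K :: "'k ring" and n :: nat and H :: "(nat multiset \<Rightarrow> 'k) set"
    and prec :: "nat multiset \<Rightarrow> nat multiset \<Rightarrow> bool"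
  assumes field: "field K" and hom: "homogeneous_ideal K {..<n} H" and prec: "term_order {..<n} prec"
begin

sublocale H: polynomial_ideal K "{..<n}" prec H
  using field hom prec
  by (intro polynomial_ideal.intro polynomial_ideal_axioms.intro) (auto simp: homogeneous_ideal_def)

abbreviation "M \<equiv> H.minimal_heads"

lemma head_no_last: "\<alpha> \<in> M \<Longrightarrow> n \<notin># \<alpha>"
  using H.minimal_heads_terms by (auto simp: terms_def)

lemma heads_terms': "M \<subseteq> terms {..n}"
  using H.minimal_heads_terms by (auto intro: terms_atMost)

lemma standard_add_last [simp]: "standard M (add_mset n m) \<longleftrightarrow> standard M m"
proof -
  have "\<alpha> \<subseteq># m" if "\<alpha> \<in> M" "\<alpha> \<subseteq># add_mset n m" for \<alpha>
    using that head_no_last[OF that(1)]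
    by (metis count_add_mset count_eq_zero_iff mset_subset_eqI subseteq_mset_def zero_le)
  then show ?thesis unfolding standard_def
    by (metis (no_types, lifting) add_mset_add_single mset_subset_eq_add_left subset_mset.order_trans)
qed

lemma minimal_generators_eq: "minimal_generators K n prec H = M"
proof -
  have *: "monom K \<one>\<^bsub>K\<^esub> m \<in> initial_ideal K n prec H \<longleftrightarrow> m \<in> terms {..<n} \<and> \<not> standard M m" for m
    unfolding initial_ideal_def by (rule H.monom_in_initial_ideal)
  show ?thesis
  proof (intro equalityI subsetI)
    fix \<alpha> assume "\<alpha> \<in> minimal_generators K n prec H"
    then have \<alpha>: "\<alpha> \<in> terms {..<n}" "\<not> standard M \<alpha>" "\<And>\<beta>. \<beta> \<subset># \<alpha> \<Longrightarrow> \<beta> \<in> terms {..<n} \<Longrightarrow> standard M \<beta>"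
      using * by (auto simp: minimal_generators_def)
    then obtain \<beta> where \<beta>: "\<beta> \<in> M" "\<beta> \<subseteq># \<alpha>" by (auto simp: standard_def)
    then have "\<not> standard M \<beta>" by (auto simp: standard_def)
    then have "\<beta> = \<alpha>" using \<alpha>(3)[of \<beta>] \<beta> H.minimal_heads_terms by (auto simp: subset_mset.le_less)
    then show "\<alpha> \<in> M" using \<beta>(1) by simp
  next
    fix \<alpha> assume \<alpha>: "\<alpha> \<in> M"
    have "standard M \<beta>" if "\<beta> \<subset># \<alpha>" for \<beta>
      using H.minimal_heads_antichain[OF _ \<alpha>] that unfolding standard_def
      by (metis subset_mset.le_less_trans subset_mset.less_imp_le subset_mset.less_irrefl)
    then show "\<alpha> \<in> minimal_generators K n prec H"
      using * \<alpha> H.minimal_heads_terms by (auto simp: minimal_generators_def standard_def)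
  qed
qed

lemma groebner_element_eq: "\<alpha> \<in> M \<Longrightarrow> groebner_element K n prec H \<alpha> = H.basis \<alpha>"
  unfolding groebner_element_def H.the_reduced_groebner_basis by (rule H.the_basis_element)

text \<open>The initial ideal and its extension to \<open>K[\<bold>x, x\<^sub>n]\<close> have the same monomial generators.\<close>

lemma normal_terms_eq:
  "normal_terms K n prec H d = {m \<in> terms {..n}. size m = d \<and> standard M m}"
proof -
  interpret P: cring "mpoly K {..n}" by (rule H.mpoly_cring)
  interpret P': cring "mpoly K {..<n}" by (rule H.mpoly_cring)
  have C: "monom K \<one>\<^bsub>K\<^esub> ` H.heads \<subseteq> carrier (mpoly K {..<n})" "monom K \<one>\<^bsub>K\<^esub> ` H.heads \<subseteq> carrier (mpoly K {..n})"
    "H.heads \<subseteq> terms {..n}"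
    using H.heads_terms by (auto intro!: H.monom_closed terms_atMost)
  have init: "initial_ideal K n prec H = Idl\<^bsub>mpoly K {..<n}\<^esub> (monom K \<one>\<^bsub>K\<^esub> ` H.heads)"
    unfolding initial_ideal_def H.head_terms_ideal_eq H.heads_def ..
  have sub: "initial_ideal K n prec H \<subseteq> Idl\<^bsub>mpoly K {..n}\<^esub> (monom K \<one>\<^bsub>K\<^esub> ` H.heads)"
    unfolding init H.Idl_eq_lspan[OF C(1)] H.Idl_eq_lspan[OF C(2)]
    by (intro lspan_mono) (blast intro: terms_atMost)
  have "Idl\<^bsub>mpoly K {..n}\<^esub> (initial_ideal K n prec H) = Idl\<^bsub>mpoly K {..n}\<^esub> (monom K \<one>\<^bsub>K\<^esub> ` H.heads)"
  proof
    have I: "ideal (Idl\<^bsub>mpoly K {..n}\<^esub> (monom K \<one>\<^bsub>K\<^esub> ` H.heads)) (mpoly K {..n})"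
      by (rule P.genideal_ideal[OF C(2)])
    then show "Idl\<^bsub>mpoly K {..n}\<^esub> (initial_ideal K n prec H) \<subseteq> Idl\<^bsub>mpoly K {..n}\<^esub> (monom K \<one>\<^bsub>K\<^esub> ` H.heads)"
      using sub by (rule P.genideal_minimal)
    have "initial_ideal K n prec H \<subseteq> carrier (mpoly K {..n})"
      using sub H.ideal_mpoly_closed[OF I] by auto
    then show "Idl\<^bsub>mpoly K {..n}\<^esub> (monom K \<one>\<^bsub>K\<^esub> ` H.heads) \<subseteq> Idl\<^bsub>mpoly K {..n}\<^esub> (initial_ideal K n prec H)"
      using P.genideal_self[of "initial_ideal K n prec H"] P'.genideal_self[OF C(1)]
      by (intro P.genideal_minimal P.genideal_ideal) (auto simp: init)
  qed
  moreover have "(\<exists>l\<in>H.heads. l \<subseteq># m) \<longleftrightarrow> \<not> standard M m" for m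
    using H.minimal_head_below unfolding standard_def H.minimal_heads_def
    by (metis (no_types, lifting) mem_Collect_eq subset_mset.order_trans)
  ultimately show ?thesis
    using H.monomial_ideal_mem[OF C(3) H.one_not_zero] by (auto simp: normal_terms_def)
qed

lemma cvars_iff:
  "(\<alpha>, \<gamma>) \<in> cvars K n prec H \<longleftrightarrow>
    \<alpha> \<in> M \<and> \<gamma> \<in> terms {..n} \<and> Suc (size \<gamma>) = size \<alpha> \<and> standard M \<gamma>"
  by (auto simp: cvars_def minimal_generators_eq normal_terms_eq terms_def)

text \<open>Distinct terms of the same degree do not divide each other, so Dickson's lemma applies.\<close>

lemma finite_normal_terms: "finite (normal_terms K n prec H d)"
proof (rule finite_minimal_terms[of "{..n}"])
  show "s = t" if "s \<in> normal_terms K n prec H d" "t \<in> normal_terms K n prec H d" "s \<subseteq># t" for s t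
    using that mset_subset_size[of s t] by (auto simp: normal_terms_def subset_mset.le_less)
qed (auto simp: normal_terms_def)

lemma finite_cvars: "finite (cvars K n prec H)"
proof (rule finite_subset)
  show "cvars K n prec H \<subseteq> (SIGMA \<alpha>:M. (\<lambda>m. m - {#n#}) ` normal_terms K n prec H (size \<alpha>))"
  proof
    fix z assume z: "z \<in> cvars K n prec H"
    then obtain \<alpha> \<gamma> where "z = (\<alpha>, \<gamma>)" "\<alpha> \<in> M" "add_mset n \<gamma> \<in> normal_terms K n prec H (size \<alpha>)"
      by (auto simp: cvars_def minimal_generators_eq)
    then show "z \<in> (SIGMA \<alpha>:M. (\<lambda>m. m - {#n#}) ` normal_terms K n prec H (size \<alpha>))"
      by (auto intro!: image_eqI[of _ _ "add_mset n \<gamma>"])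
  qed
  show "finite (SIGMA \<alpha>:M. (\<lambda>m. m - {#n#}) ` normal_terms K n prec H (size \<alpha>))"
    using H.finite_minimal_heads finite_normal_terms by auto
qed

text \<open>The basis elements are homogeneous and do not involve \<open>x\<^sub>n\<close>, so the degree reverse order compares
  their terms by \<open>prec\<close>.\<close>

lemma basis_tail_degrev:
  assumes \<alpha>: "\<alpha> \<in> M" and t: "H.basis \<alpha> t \<noteq> \<zero>\<^bsub>K\<^esub>" "t \<noteq> \<alpha>"
  shows "degrevorder n prec t \<alpha>"
proof -
  have low: "filter_mset (\<lambda>i. i \<noteq> n) m = m" if "m \<in> terms {..<n}" for m
    using that by (auto simp: terms_def filter_mset_eq_conv)
  have T: "t \<in> terms {..<n}" "\<alpha> \<in> terms {..<n}"
    using mpoly_term[OF H.basis.F_closed[OF \<alpha>] t(1)] H.minimal_heads_terms \<alpha> by auto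
  then have "n \<notin># t" "n \<notin># \<alpha>" by (auto simp: terms_def)
  then show ?thesis
    using H.basis_homogeneous[OF hom \<alpha> t(1)] H.basis.F_tail[OF \<alpha> t] low T
    by (simp add: degrevorder_iff not_in_iff)
qed

text \<open>Both terms have the same degree, and \<open>x\<^sub>n\<close> divides only the first.\<close>

lemma cvars_degrev: "(\<alpha>, \<gamma>) \<in> cvars K n prec H \<Longrightarrow> degrevorder n prec (add_mset n \<gamma>) \<alpha>"
  using head_no_last[of \<alpha>] by (simp add: degrevorder_iff cvars_iff not_in_iff)

end

locale lifting_algebra = lifting_problem K n H prec for K :: "'k ring" and n H prec +
  fixes A :: "('k, 'a) module" (structure)
  assumes algebra: "algebra K A"
begin

sublocale A: cring A
  using algebra by (rule algebra.axioms(2))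

definition scalar :: "'k \<Rightarrow> 'a" where "scalar k = k \<odot>\<^bsub>A\<^esub> \<one>"

lemma scalar_hom: "scalar \<in> ring_hom K A"
  using algebra_scalar_hom[OF algebra] by (simp add: scalar_def[abs_def])

sublocale scalar: ring_hom_cring K A scalar
  by (intro ring_hom_cring.intro ring_hom_cring_axioms.intro H.is_cring A.is_cring scalar_hom)

lemma H_cring: "cring K" by (rule H.is_cring)

definition f :: "nat multiset \<Rightarrow> nat multiset \<Rightarrow> 'a" where
  "f \<alpha> = (\<lambda>m. scalar (H.basis \<alpha> m))"

lemma f_closed: "\<alpha> \<in> M \<Longrightarrow> f \<alpha> \<in> carrier (mpoly A {..<n})"
  unfolding f_def by (rule ring_hom_mpoly_closed[OF H_cring A.is_cring scalar_hom H.basis.F_closed])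

lemma f_head: "\<alpha> \<in> M \<Longrightarrow> f \<alpha> \<alpha> = \<one>"
  by (simp add: f_def H.basis.F_head)

lemma f_nonzero: "f \<alpha> t \<noteq> \<zero> \<Longrightarrow> H.basis \<alpha> t \<noteq> \<zero>\<^bsub>K\<^esub>"
  by (auto simp: f_def)

lemma f_size: "\<alpha> \<in> M \<Longrightarrow> f \<alpha> t \<noteq> \<zero> \<Longrightarrow> size t = size \<alpha>"
  using f_nonzero H.basis_homogeneous[OF hom] by blast

sublocale f: monic_family A "{..<n}" prec M f
  using f_closed f_head f_nonzero H.basis.F_tail H.minimal_heads_terms prec H.wf_ord
  by unfold_locales auto

abbreviation HA :: "(nat multiset \<Rightarrow> 'a) set" where
  "HA \<equiv> extended_ideal_from_field A {..<n} H"

text \<open>Over \<open>K\<close> every element of \<open>H\<close> is a combination of term multiples of the basis, and combinations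
  are preserved by the map to \<open>A\<close>.\<close>

lemma HA_eq: "HA = Idl\<^bsub>mpoly A {..<n}\<^esub> (f ` M)"
proof -
  interpret P: cring "mpoly A {..<n}" by (rule A.mpoly_cring)
  let ?emb = "\<lambda>g m. scalar (g m)"
  have HA: "HA = Idl\<^bsub>mpoly A {..<n}\<^esub> (?emb ` H)"
    by (simp add: extended_ideal_from_field_def scalar_def)
  have C: "?emb ` H \<subseteq> carrier (mpoly A {..<n})"
    using ring_hom_mpoly_closed[OF H_cring A.is_cring scalar_hom] H.ideal_mpoly_closed[OF H.ideal] by auto
  have fC: "f ` M \<subseteq> carrier (mpoly A {..<n})" using f_closed by auto
  have Hc: "H.basis ` M \<subseteq> carrier (mpoly K {..<n})" using H.basis.F_closed by auto
  have B: "?emb ` multiples K {..<n} (H.basis ` M) = multiples A {..<n} (f ` M)" (is "?L = ?R")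
  proof
    show "?L \<subseteq> ?R"
    proof
      fix p assume "p \<in> ?L"
      then obtain s \<alpha> where *: "p = (\<lambda>m. scalar (shift K s (H.basis \<alpha>) m))" "s \<in> terms {..<n}" "\<alpha> \<in> M" by auto
      then have "p = shift A s (f \<alpha>)"
        unfolding f_def using ring_hom_shift[OF H_cring A.is_cring scalar_hom] by simp
      then show "p \<in> ?R" using * by blast
    qed
    show "?R \<subseteq> ?L"
    proof
      fix p assume "p \<in> ?R"
      then obtain s \<alpha> where *: "p = shift A s (f \<alpha>)" "s \<in> terms {..<n}" "\<alpha> \<in> M" by auto
      have "?emb (shift K s (H.basis \<alpha>)) = p"
        unfolding *(1) f_def by (rule ring_hom_shift[OF H_cring A.is_cring scalar_hom])
      moreover have "shift K s (H.basis \<alpha>) \<in> multiples K {..<n} (H.basis ` M)" using * by blast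
      ultimately show "p \<in> ?L" by (rule image_eqI[OF sym])
    qed
  qed
  show ?thesis
  proof
    have "?emb ` H \<subseteq> lspan A (multiples A {..<n} (f ` M))"
    proof
      fix p assume "p \<in> ?emb ` H"
      then obtain h where h: "h \<in> H" "p = ?emb h" by blast
      have "h \<in> lspan K (multiples K {..<n} (H.basis ` M))"
        using h(1) H.ideal_eq_Idl_basis H.Idl_eq_lspan[OF Hc] by simp
      from ring_hom_lspan[OF H_cring A.is_cring scalar_hom H.multiples_closed[OF Hc] this]
      show "p \<in> lspan A (multiples A {..<n} (f ` M))"
        unfolding B h(2) .
    qed
    then show "HA \<subseteq> Idl\<^bsub>mpoly A {..<n}\<^esub> (f ` M)"
      unfolding HA A.Idl_eq_lspan[OF fC] by (intro P.genideal_minimal A.lspan_multiples_ideal fC)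
    have "f ` M \<subseteq> ?emb ` H" using H.basis_in_ideal by (auto simp: f_def)
    then show "Idl\<^bsub>mpoly A {..<n}\<^esub> (f ` M) \<subseteq> HA"
      unfolding HA using P.genideal_self[OF C] by (intro P.genideal_minimal P.genideal_ideal C) auto
  qed
qed

lemma HA_ideal: "ideal HA (mpoly A {..<n})"
  unfolding HA_eq using f_closed by (intro ring.genideal_ideal cring.axioms(1) A.mpoly_cring) auto

lemma f_in_HA: "\<alpha> \<in> M \<Longrightarrow> f \<alpha> \<in> HA"
  unfolding HA_eq using f_closed ring.genideal_self[OF cring.axioms(1)[OF A.mpoly_cring], of "f ` M"] by auto

text \<open>Buchberger's criterion over \<open>A\<close>, with the representations of the syzygies obtained over \<open>K\<close>.
  Together with division by the \<open>f \<alpha>\<close> this decomposes \<open>A[\<bold>x]\<close> into \<open>H A[\<bold>x]\<close> and the span of the standard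
  terms.\<close>

lemma standard_in_HA:
  assumes "p \<in> HA" and "standard_poly A M p"
  shows "p = (\<lambda>m. \<zero>)"
proof (rule f.buchberger[OF _ assms(1)[unfolded HA_eq] assms(2)])
  fix s \<alpha> s' \<alpha>'
  assume *: "\<alpha> \<in> M" "\<alpha>' \<in> M" "s \<in> terms {..<n}" "s' \<in> terms {..<n}" "s + \<alpha> = s' + \<alpha>'"
  have "(\<lambda>m. scalar (shift K s (H.basis \<alpha>) m \<ominus>\<^bsub>K\<^esub> shift K s' (H.basis \<alpha>') m))
    \<in> lspan A ((\<lambda>b m. scalar (b m)) ` H.basis.multiples_within (\<lambda>t. prec t (s + \<alpha>)))"
    by (rule ring_hom_lspan[OF H_cring A.is_cring scalar_hom H.basis.multiples_within_closed H.basis_syzygy[OF *]])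
  moreover have sub: "(\<lambda>b m. scalar (b m)) ` H.basis.multiples_within Q \<subseteq> f.multiples_within Q" for Q
    using ring_hom_shift[OF H_cring A.is_cring scalar_hom]
    by (auto simp: H.basis.multiples_within_def f.multiples_within_def f_def)
  moreover have "scalar (shift K s (H.basis \<alpha>) m \<ominus>\<^bsub>K\<^esub> shift K s' (H.basis \<alpha>') m) =
     shift A s (f \<alpha>) m \<ominus> shift A s' (f \<alpha>') m" for m
    using mpoly_coeff_closed[OF H.shift_closed[OF *(3) H.basis.F_closed[OF *(1)]], of m]
      mpoly_coeff_closed[OF H.shift_closed[OF *(4) H.basis.F_closed[OF *(2)]], of m]
      fun_cong[OF ring_hom_shift[OF H_cring A.is_cring scalar_hom, of s "H.basis \<alpha>"], of m]
      fun_cong[OF ring_hom_shift[OF H_cring A.is_cring scalar_hom, of s' "H.basis \<alpha>'"], of m]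
    by (simp add: f_def a_minus_def)
  ultimately show "(\<lambda>m. shift A s (f \<alpha>) m \<ominus> shift A s' (f \<alpha>') m)
       \<in> lspan A (f.multiples_within (\<lambda>t. prec t (s + \<alpha>)))"
    using subsetD[OF lspan_mono[OF sub]] by simp
qed

lemma lifting_iff:
  "I \<in> liftings n H A \<longleftrightarrow> homogeneous_ideal A {..n} I \<and>
    (\<forall>p\<in>carrier (mpoly A {..n}). shift A {#n#} p \<in> I \<longrightarrow> p \<in> I) \<and> restrict_last A n ` I = HA"
proof -
  have "(\<forall>y\<in>carrier (mpoly A {..n} Quot I).
          (I +>\<^bsub>mpoly A {..n}\<^esub> monom A \<one> {#n#}) \<otimes>\<^bsub>mpoly A {..n} Quot I\<^esub> y = \<zero>\<^bsub>mpoly A {..n} Quot I\<^esub>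
          \<longrightarrow> y = \<zero>\<^bsub>mpoly A {..n} Quot I\<^esub>) \<longleftrightarrow>
      (\<forall>p\<in>carrier (mpoly A {..n}). shift A {#n#} p \<in> I \<longrightarrow> p \<in> I)" if I: "ideal I (mpoly A {..n})"
  proof -
    have x: "monom A \<one> {#n#} \<in> carrier (mpoly A {..n})" by (simp add: terms_def)
    have "monom A \<one> {#n#} \<otimes>\<^bsub>mpoly A {..n}\<^esub> p = shift A {#n#} p" if p: "p \<in> carrier (mpoly A {..n})" for p
      using A.monom_mult[of "\<one>" p] mpoly_coeff_closed[OF p]
        mpoly_coeff_closed[OF A.shift_closed[OF _ p, of "{#n#}"]] by (simp add: terms_def)
    then show ?thesis
      unfolding quotient_nonzerodivisor_iff[OF A.mpoly_cring I x] by auto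
  qed
  then show ?thesis
    unfolding liftings_def restrict_last_def[abs_def] homogeneous_ideal_def by auto
qed

text \<open>The generic element \<open>f\<^sub>\<alpha> + g\<^sub>\<alpha>\<close> specialized at \<open>C = c\<close>: the coefficient of \<open>x\<^sub>n x\<^sup>\<gamma>\<close> is \<open>c (\<alpha>, \<gamma>)\<close>,
  and the terms without \<open>x\<^sub>n\<close> are those of \<open>f\<^sub>\<alpha>\<close>.\<close>

definition lift :: "(cvar \<Rightarrow> 'a) \<Rightarrow> nat multiset \<Rightarrow> nat multiset \<Rightarrow> 'a" where
  "lift c \<alpha> = (\<lambda>m. if n \<in># m
     then if (\<alpha>, m - {#n#}) \<in> cvars K n prec H then c (\<alpha>, m - {#n#}) else \<zero>
     else f \<alpha> m)"

lemma f_last: "\<alpha> \<in> M \<Longrightarrow> n \<in># m \<Longrightarrow> f \<alpha> m = \<zero>"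
  using mpoly_term[OF f_closed, of \<alpha> m] by (cases "f \<alpha> m = \<zero>") (auto simp: terms_def)

lemma restrict_lift: "\<alpha> \<in> M \<Longrightarrow> restrict_last A n (lift c \<alpha>) = f \<alpha>"
  using f_last by (auto simp: restrict_last_def lift_def)

lemma mpoly_mono: "p \<in> carrier (mpoly A {..<n}) \<Longrightarrow> p \<in> carrier (mpoly A {..n})"
  by (force simp: mpoly_carrier terms_def)

lemma lift_cases:
  assumes "lift c \<alpha> m \<noteq> \<zero>"
  obtains "n \<notin># m" "f \<alpha> m \<noteq> \<zero>" "lift c \<alpha> m = f \<alpha> m"
  | \<gamma> where "m = add_mset n \<gamma>" "(\<alpha>, \<gamma>) \<in> cvars K n prec H" "lift c \<alpha> m = c (\<alpha>, \<gamma>)"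
proof (cases "n \<in># m")
  case True
  then show ?thesis
    using assms by (intro that(2)[of "m - {#n#}"]) (auto simp: lift_def split: if_splits)
next
  case False
  then show ?thesis using assms by (intro that(1)) (auto simp: lift_def)
qed

lemma lift_size: "\<alpha> \<in> M \<Longrightarrow> lift c \<alpha> m \<noteq> \<zero> \<Longrightarrow> size m = size \<alpha>"
  by (erule lift_cases) (auto simp: f_size cvars_iff)

lemma lift_closed:
  assumes c: "\<And>v. v \<in> cvars K n prec H \<Longrightarrow> c v \<in> carrier A" and \<alpha>: "\<alpha> \<in> M"
  shows "lift c \<alpha> \<in> carrier (mpoly A {..n})"
proof (rule mpoly_carrierI[of _ _ "supp A (f \<alpha>) \<union> normal_terms K n prec H (size \<alpha>)"])
  show "lift c \<alpha> m \<in> carrier A" for m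
    using c mpoly_coeff_closed[OF f_closed[OF \<alpha>]] by (auto simp: lift_def)
  show "m \<in> supp A (f \<alpha>) \<union> normal_terms K n prec H (size \<alpha>) \<and> m \<in> terms {..n}"
    if "lift c \<alpha> m \<noteq> \<zero>" for m
    using that
  proof (cases rule: lift_cases)
    case 1
    then show ?thesis using mpoly_term[OF mpoly_mono[OF f_closed[OF \<alpha>]]] by (auto simp: supp_def)
  next
    case (2 \<gamma>)
    then show ?thesis by (auto simp: cvars_iff normal_terms_eq terms_def)
  qed
  show "finite (supp A (f \<alpha>) \<union> normal_terms K n prec H (size \<alpha>))"
    using f_closed[OF \<alpha>] finite_normal_terms by (simp add: mpoly_carrier)
qed

lemma degrev_order: "term_order {..n} (degrevorder n prec)"
  by (rule term_order_degrevorder[OF prec])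

lemma lift_family:
  assumes c: "\<And>v. v \<in> cvars K n prec H \<Longrightarrow> c v \<in> carrier A"
  shows "monic_family A {..n} (degrevorder n prec) M (lift c)"
proof (intro monic_family.intro monic_family_axioms.intro A.is_cring degrev_order heads_terms' lift_closed c)
  show "wf {(s, t). s \<in> terms {..n} \<and> t \<in> terms {..n} \<and> degrevorder n prec s t}"
    by (rule term_order_wf[OF degrev_order]) simp
  fix \<alpha> assume \<alpha>: "\<alpha> \<in> M"
  show "lift c \<alpha> \<alpha> = \<one>" using head_no_last[OF \<alpha>] f_head[OF \<alpha>] by (simp add: lift_def)
  fix t assume t: "lift c \<alpha> t \<noteq> \<zero>" "t \<noteq> \<alpha>"
  show "degrevorder n prec t \<alpha>"
    using t(1)
  proof (cases rule: lift_cases)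
    case 1
    then show ?thesis using basis_tail_degrev[OF \<alpha> f_nonzero t(2)] by simp
  next
    case (2 \<gamma>)
    then show ?thesis using cvars_degrev by simp
  qed
qed

end

section \<open>Parametrizing the liftings\<close>

context lifting_algebra
begin

abbreviation "coefficient_family c \<equiv> (\<forall>v\<in>cvars K n prec H. c v \<in> carrier A)"

abbreviation lift_ideal :: "(cvar \<Rightarrow> 'a) \<Rightarrow> (nat multiset \<Rightarrow> 'a) set" where
  "lift_ideal c \<equiv> Idl\<^bsub>mpoly A {..n}\<^esub> (lift c ` M)"

lemma standard_poly_last:
  "standard_poly A M p \<Longrightarrow> standard_poly A M (shift A {#n#} p)"
  unfolding standard_poly_def by (metis shift_nonzeroE add_mset_add_single add.commute standard_add_last)

lemma standard_poly_restrict: "standard_poly A M p \<Longrightarrow> standard_poly A M (restrict_last A n p)"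
  by (auto simp: standard_poly_def restrict_last_def)

lemma last_term: "{#n#} \<in> terms {..n}"
  by (simp add: terms_def)

context
  fixes I assumes I: "I \<in> liftings n H A"
begin

lemma lifting_ideal: "ideal I (mpoly A {..n})"
  using I by (simp add: lifting_iff homogeneous_ideal_def)

lemma lifting_hom: "p \<in> I \<Longrightarrow> hom_component A d p \<in> I"
  using I by (simp add: lifting_iff homogeneous_ideal_def)

lemma lifting_cancel: "p \<in> carrier (mpoly A {..n}) \<Longrightarrow> shift A {#n#} p \<in> I \<Longrightarrow> p \<in> I"
  using I by (simp add: lifting_iff)

lemma lifting_restrict: "restrict_last A n ` I = HA"
  using I by (simp add: lifting_iff)

text \<open>At \<open>x\<^sub>n = 0\<close> such a \<open>p\<close> becomes a standard element of \<open>H A[\<bold>x]\<close>, hence zero. So \<open>x\<^sub>n\<close> divides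
  \<open>p\<close>, and the quotient is again a standard element of \<open>I\<close>, of smaller degree.\<close>

lemma standard_in_lifting:
  assumes "p \<in> I" and "standard_poly A M p"
  shows "p = (\<lambda>m. \<zero>)"
proof -
  have *: "p = (\<lambda>m. \<zero>)" if "p \<in> I" "standard_poly A M p" "\<And>t. p t \<noteq> \<zero> \<Longrightarrow> size t < d" for d p
    using that
  proof (induction d arbitrary: p)
    case 0
    then show ?case by blast
  next
    case (Suc d)
    note pc = A.ideal_mpoly_closed[OF lifting_ideal Suc.prems(1)]
    have "restrict_last A n p \<in> HA" using Suc.prems(1) lifting_restrict by auto
    then have "restrict_last A n p = (\<lambda>m. \<zero>)"
      using standard_poly_restrict[OF Suc.prems(2)] by (rule standard_in_HA)
    then obtain q where q: "q \<in> carrier (mpoly A {..n})" "p = shift A {#n#} q" "\<And>m. q m = p (add_mset n m)"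
      using A.divide_last[OF pc] by blast
    have "q \<in> I" using lifting_cancel[OF q(1)] q(2) Suc.prems(1) by simp
    moreover have "standard_poly A M q"
      using Suc.prems(2) q(3) unfolding standard_poly_def by (metis standard_add_last)
    moreover have "size t < d" if "q t \<noteq> \<zero>" for t
      using Suc.prems(3)[of "add_mset n t"] that q(3) by simp
    ultimately have "q = (\<lambda>m. \<zero>)" by (rule Suc.IH)
    then show ?case using q(2) by simp
  qed
  have "finite (size ` supp A p)"
    using A.ideal_mpoly_closed[OF lifting_ideal assms(1)] by (simp add: mpoly_carrier)
  then obtain d where "\<And>k. k \<in> size ` supp A p \<Longrightarrow> k < d"
    unfolding finite_nat_set_iff_bounded by blast
  then have "size t < d" if "p t \<noteq> \<zero>" for t
    using that by (auto simp: supp_def)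
  with assms show ?thesis by (rule *)
qed

text \<open>The restriction of \<open>p\<close> to \<open>x\<^sub>n = 0\<close> is congruent modulo \<open>H A[\<bold>x]\<close> to a standard polynomial, and
  the difference is the restriction of an element of \<open>I\<close>. Subtracting both from \<open>p\<close> leaves a multiple of
  \<open>x\<^sub>n\<close>, whose cofactor has smaller degree. Passing to homogeneous components is essential: \<open>prec\<close>
  need not be graded, so division in \<open>A[\<bold>x]\<close> does not bound degrees by itself.\<close>

lemma lifting_normal_form:
  assumes "p \<in> carrier (mpoly A {..n})" and "\<And>m. p m \<noteq> \<zero> \<Longrightarrow> size m = d"
  shows "\<exists>r\<in>carrier (mpoly A {..n}). standard_poly A M r \<and> (\<forall>m. r m \<noteq> \<zero> \<longrightarrow> size m = d) \<and>
    (\<lambda>m. p m \<ominus> r m) \<in> I"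
  using assms
proof (induction d arbitrary: p rule: less_induct)
  case (less d p)
  note p = less.prems(1)
  let ?p0 = "restrict_last A n p"
  have p0: "?p0 \<in> carrier (mpoly A {..<n})" by (rule A.restrict_last_closed[OF p])
  have p0_hom: "hom_component A d ?p0 = ?p0"
    using less.prems(2) by (intro A.hom_component_self) (auto simp: supp_def restrict_last_def)
  obtain r' where r': "r' \<in> carrier (mpoly A {..<n})" "standard_poly A M r'"
    "(\<lambda>m. ?p0 m \<ominus> r' m) \<in> HA"
    unfolding HA_eq using f.division_ideal[OF p0] .
  then have "(\<lambda>m. ?p0 m \<ominus> r' m) \<in> restrict_last A n ` I" using lifting_restrict by simp
  then obtain g' where "(\<lambda>m. ?p0 m \<ominus> r' m) = restrict_last A n g'" and gI': "g' \<in> I" by (rule imageE)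
  then have g': "g' \<in> I" "restrict_last A n g' = (\<lambda>m. ?p0 m \<ominus> r' m)" by simp_all
  \<comment> \<open>Taking components preserves the congruences, as \<open>p\<close> is homogeneous of degree \<open>d\<close>.\<close>
  define r0 where "r0 = hom_component A d r'"
  define g where "g = hom_component A d g'"
  have r0: "r0 \<in> carrier (mpoly A {..<n})" "standard_poly A M r0" "\<And>m. r0 m \<noteq> \<zero> \<Longrightarrow> size m = d"
    using A.hom_component_closed[OF r'(1)] r'(2)
    by (auto simp: r0_def hom_component_def standard_poly_def split: if_splits)
  have r0n: "r0 \<in> carrier (mpoly A {..n})" using r0(1) by (rule mpoly_mono)
  have gI: "g \<in> I" unfolding g_def by (rule lifting_hom[OF g'(1)])
  note gc = A.ideal_mpoly_closed[OF lifting_ideal gI]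
  have g_hom: "\<And>m. g m \<noteq> \<zero> \<Longrightarrow> size m = d" by (auto simp: g_def hom_component_def split: if_splits)
  have g_restr: "restrict_last A n g = (\<lambda>m. ?p0 m \<ominus> r0 m)"
    unfolding g_def r0_def A.restrict_last_hom_component g'(2) A.hom_component_minus p0_hom ..
  have cl: "p m \<in> carrier A" "r0 m \<in> carrier A" "g m \<in> carrier A" "?p0 m \<in> carrier A" for m
    using mpoly_coeff_closed[OF p] mpoly_coeff_closed[OF r0(1)] mpoly_coeff_closed[OF gc]
      mpoly_coeff_closed[OF p0] by simp_all
  let ?q = "\<lambda>m. (p m \<ominus> r0 m) \<ominus> g m"
  have q: "?q \<in> carrier (mpoly A {..n})"
    by (intro A.mpoly_minus_closed p r0n gc)
  have q_restr: "restrict_last A n ?q = (\<lambda>m. \<zero>)"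
    unfolding A.restrict_last_minus A.restrict_last_id[OF r0(1)] g_restr using cl by (simp add: A.minus_eq A.r_neg)
  obtain q1 where q1: "q1 \<in> carrier (mpoly A {..n})" "?q = shift A {#n#} q1" "\<And>m. q1 m = ?q (add_mset n m)"
    using A.divide_last[OF q q_restr] by blast
  have q1_hom: "Suc (size m) = d" if "q1 m \<noteq> \<zero>" for m
  proof -
    have "p (add_mset n m) \<noteq> \<zero> \<or> r0 (add_mset n m) \<noteq> \<zero> \<or> g (add_mset n m) \<noteq> \<zero>"
      using that q1(3)[of m] by (auto simp: A.minus_eq)
    then have "size (add_mset n m) = d"
      using less.prems(2)[of "add_mset n m"] r0(3)[of "add_mset n m"] g_hom[of "add_mset n m"] by argo
    then show ?thesis by simp
  qed
  have "\<exists>r1\<in>carrier (mpoly A {..n}). standard_poly A M r1 \<and> (\<forall>m. r1 m \<noteq> \<zero> \<longrightarrow> Suc (size m) = d) \<and>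
    (\<lambda>m. q1 m \<ominus> r1 m) \<in> I"
  proof (cases d)
    case 0
    then have "q1 = (\<lambda>m. \<zero>)" using q1_hom by auto
    then show ?thesis
      using A.ideal_mpoly_zero[OF lifting_ideal]
      by (intro bexI[OF _ A.mpoly_zero_closed]) (auto simp: standard_poly_def A.minus_eq)
  next
    case (Suc e)
    then have "\<exists>r1\<in>carrier (mpoly A {..n}). standard_poly A M r1 \<and> (\<forall>m. r1 m \<noteq> \<zero> \<longrightarrow> size m = e) \<and>
      (\<lambda>m. q1 m \<ominus> r1 m) \<in> I"
      using q1_hom by (intro less.IH q1(1)) auto
    then show ?thesis using Suc by simp
  qed
  then obtain r1 where r1: "r1 \<in> carrier (mpoly A {..n})" "standard_poly A M r1"
      "\<And>m. r1 m \<noteq> \<zero> \<Longrightarrow> Suc (size m) = d" "(\<lambda>m. q1 m \<ominus> r1 m) \<in> I" by auto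
  let ?s = "shift A {#n#} r1"
  let ?r = "\<lambda>m. r0 m \<oplus> ?s m"
  have s: "?s \<in> carrier (mpoly A {..n})" "standard_poly A M ?s"
    using A.shift_closed[OF last_term r1(1)] standard_poly_last[OF r1(2)] by auto
  have s_hom: "size m = d" if "?s m \<noteq> \<zero>" for m
    using that r1(3) by (elim shift_nonzeroE) auto
  have "(\<lambda>m. g m \<oplus> shift A {#n#} (\<lambda>m. q1 m \<ominus> r1 m) m) \<in> I"
    using A.ideal_mpoly_add[OF lifting_ideal gI A.ideal_mpoly_shift[OF lifting_ideal r1(4) last_term]] .
  moreover have "g m \<oplus> shift A {#n#} (\<lambda>m. q1 m \<ominus> r1 m) m = p m \<ominus> ?r m" for m
    unfolding A.shift_minus q1(2)[symmetric]
    using cl(1,2,3)[of m] mpoly_coeff_closed[OF s(1), of m] by algebra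
  ultimately have "(\<lambda>m. p m \<ominus> ?r m) \<in> I" by simp
  moreover have "?r \<in> carrier (mpoly A {..n})" by (rule A.mpoly_add_closed[OF r0n s(1)])
  moreover have "standard M m \<and> size m = d" if "?r m \<noteq> \<zero>" for m
  proof -
    have "r0 m \<noteq> \<zero> \<or> ?s m \<noteq> \<zero>" using that by auto
    then show ?thesis using r0(2,3) s(2) s_hom by (auto simp: standard_poly_def)
  qed
  ultimately show ?case by (intro bexI[of _ ?r]) (simp_all add: standard_poly_def)
qed

text \<open>Let \<open>r\<close> be the normal form of \<open>f \<alpha>\<close> modulo \<open>I\<close>. Restricted to \<open>x\<^sub>n = 0\<close> it is a standard
  element of \<open>H A[\<bold>x]\<close>, hence zero. So \<open>f \<alpha> - r\<close> has the shape \<open>lift c \<alpha>\<close>.\<close>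

lemma lifting_contains_lift:
  "\<exists>c. coefficient_family c \<and> (\<forall>\<alpha>\<in>M. lift c \<alpha> \<in> I)"
proof -
  have "\<forall>\<alpha>\<in>M. \<exists>r. r \<in> carrier (mpoly A {..n}) \<and> standard_poly A M r \<and>
    (\<forall>m. r m \<noteq> \<zero> \<longrightarrow> size m = size \<alpha>) \<and> (\<lambda>m. f \<alpha> m \<ominus> r m) \<in> I"
    using lifting_normal_form[OF mpoly_mono[OF f_closed] f_size] by blast
  from bchoice[OF this] obtain r where r: "\<forall>\<alpha>\<in>M. r \<alpha> \<in> carrier (mpoly A {..n}) \<and> standard_poly A M (r \<alpha>) \<and>
    (\<forall>m. r \<alpha> m \<noteq> \<zero> \<longrightarrow> size m = size \<alpha>) \<and> (\<lambda>m. f \<alpha> m \<ominus> r \<alpha> m) \<in> I" by blast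
  \<comment> \<open>The coefficients of \<open>f \<alpha> - r \<alpha>\<close> at the multiples of \<open>x\<^sub>n\<close>; those of \<open>f \<alpha>\<close> vanish.\<close>
  define c where "c = (\<lambda>(\<alpha>, \<gamma>). \<ominus> r \<alpha> (add_mset n \<gamma>))"
  have rc: "r \<alpha> m \<in> carrier A" if "\<alpha> \<in> M" for \<alpha> m
    using r that mpoly_coeff_closed by blast
  have "coefficient_family c"
    using rc by (auto simp: c_def cvars_iff)
  moreover have "lift c \<alpha> \<in> I" if \<alpha>: "\<alpha> \<in> M" for \<alpha>
  proof -
    have r\<alpha>: "r \<alpha> \<in> carrier (mpoly A {..n})" "standard_poly A M (r \<alpha>)"
      "\<And>m. r \<alpha> m \<noteq> \<zero> \<Longrightarrow> size m = size \<alpha>" "(\<lambda>m. f \<alpha> m \<ominus> r \<alpha> m) \<in> I"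
      using r \<alpha> by auto
    note fc = f_closed[OF \<alpha>]
    note HAi = HA_ideal and fHA = f_in_HA[OF \<alpha>]
    have "restrict_last A n (\<lambda>m. f \<alpha> m \<ominus> r \<alpha> m) \<in> HA"
      using lifting_restrict r\<alpha>(4) by auto
    then have "(\<lambda>m. f \<alpha> m \<ominus> restrict_last A n (r \<alpha>) m) \<in> HA"
      unfolding A.restrict_last_minus A.restrict_last_id[OF fc] .
    then have "restrict_last A n (r \<alpha>) \<in> HA"
      by (rule A.ideal_mpoly_remainder[OF HAi fHA A.restrict_last_closed[OF r\<alpha>(1)]])
    then have "restrict_last A n (r \<alpha>) = (\<lambda>m. \<zero>)"
      using standard_poly_restrict[OF r\<alpha>(2)] by (rule standard_in_HA)
    then have r_last: "r \<alpha> m = \<zero>" if "n \<notin># m" for m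
      using that by (metis restrict_last_def)
    have "lift c \<alpha> m = f \<alpha> m \<ominus> r \<alpha> m" for m
    proof (cases "n \<in># m")
      case False
      then show ?thesis
        using r_last mpoly_coeff_closed[OF fc] by (simp add: lift_def A.minus_eq)
    next
      case True
      then obtain \<gamma> where m: "m = add_mset n \<gamma>" by (metis insert_DiffM)
      have z: "(\<alpha>, \<gamma>) \<in> cvars K n prec H" if "r \<alpha> m \<noteq> \<zero>"
        using that r\<alpha>(2) r\<alpha>(3)[OF that] mpoly_term[OF r\<alpha>(1) that] \<alpha> m
        by (auto simp: cvars_iff standard_poly_def terms_def)
      show ?thesis
      proof (cases "(\<alpha>, \<gamma>) \<in> cvars K n prec H")
        case False
        then have "r \<alpha> m = \<zero>" using z by blast
        then show ?thesis using False m f_last[OF \<alpha> True] by (simp add: lift_def A.minus_eq)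
      qed (use m f_last[OF \<alpha> True] rc[OF \<alpha>] in \<open>simp add: lift_def c_def A.minus_eq\<close>)
    qed
    then have "lift c \<alpha> = (\<lambda>m. f \<alpha> m \<ominus> r \<alpha> m)" by (rule ext)
    then show ?thesis using r\<alpha>(4) by simp
  qed
  ultimately show ?thesis by blast
qed

lemma lifting_eq_lift_ideal:
  assumes c: "coefficient_family c" and "\<forall>\<alpha>\<in>M. lift c \<alpha> \<in> I"
  shows "I = lift_ideal c"
proof -
  interpret monic_family A "{..n}" "degrevorder n prec" M "lift c"
    using c by (intro lift_family) auto
  show ?thesis
    using assms(2) standard_in_lifting by (intro ideal_eqI lifting_ideal) auto
qed

end

text \<open>The terms without \<open>x\<^sub>n\<close> cancel in \<open>lift c \<alpha> - lift d \<alpha>\<close>, so this is a standard element of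
  \<open>I\<close>.\<close>

lemma lift_unique:
  assumes I: "ideal I (mpoly A {..n})"
    and std: "\<And>p. p \<in> I \<Longrightarrow> standard_poly A M p \<Longrightarrow> p = (\<lambda>m. \<zero>)"
    and c: "coefficient_family c" "\<forall>\<alpha>\<in>M. lift c \<alpha> \<in> I"
    and d: "coefficient_family d" "\<forall>\<alpha>\<in>M. lift d \<alpha> \<in> I"
    and v: "v \<in> cvars K n prec H"
  shows "c v = d v"
proof -
  obtain \<alpha> \<gamma> where v': "v = (\<alpha>, \<gamma>)" by (cases v)
  have \<alpha>: "\<alpha> \<in> M" using v v' by (simp add: cvars_iff)
  have cl: "lift c \<alpha> m \<in> carrier A" "lift d \<alpha> m \<in> carrier A" for m
    using mpoly_coeff_closed[OF lift_closed[OF _ \<alpha>]] c d by auto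
  have "standard M m" if "lift c \<alpha> m \<ominus> lift d \<alpha> m \<noteq> \<zero>" for m
  proof (cases "n \<in># m")
    case False
    then show ?thesis
      using that mpoly_coeff_closed[OF f_closed[OF \<alpha>], of m] by (simp add: lift_def A.minus_eq A.r_neg)
  next
    case True
    then obtain \<delta> where m: "m = add_mset n \<delta>" by (metis insert_DiffM)
    have "(\<alpha>, \<delta>) \<in> cvars K n prec H"
      using that m by (auto simp: lift_def A.minus_eq split: if_splits)
    then show ?thesis using m by (simp add: cvars_iff)
  qed
  then have "(\<lambda>m. lift c \<alpha> m \<ominus> lift d \<alpha> m) = (\<lambda>m. \<zero>)"
    using A.ideal_mpoly_minus[OF I] c(2) d(2) \<alpha> by (intro std) (auto simp: standard_poly_def)
  from fun_cong[OF this, of "add_mset n \<gamma>"]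
  show ?thesis using v v' c(1) d(1) by (simp add: lift_def A.r_right_minus_eq)
qed

text \<open>If \<open>x\<^sub>n p\<close> is in the ideal and \<open>r\<close> is the remainder of \<open>p\<close>, then \<open>x\<^sub>n r\<close> is a standard element
  of the ideal, hence \<open>r = 0\<close>. The condition at \<open>x\<^sub>n = 0\<close> holds for every \<open>c\<close>, since
  \<open>lift c \<alpha>\<close> restricts to \<open>f \<alpha>\<close>.\<close>

lemma lift_ideal_lifting:
  assumes c: "coefficient_family c"
    and std: "\<And>p. p \<in> lift_ideal c \<Longrightarrow> standard_poly A M p \<Longrightarrow> p = (\<lambda>m. \<zero>)"
  shows "lift_ideal c \<in> liftings n H A"
proof -
  interpret monic_family A "{..n}" "degrevorder n prec" M "lift c"
    using c by (intro lift_family) auto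
  have C: "lift c ` M \<subseteq> carrier (mpoly A {..n})" using F_closed by auto
  have C0: "f ` M \<subseteq> carrier (mpoly A {..<n})" using f_closed by auto
  have I: "ideal (lift_ideal c) (mpoly A {..n})"
    by (rule ring.genideal_ideal[OF cring.axioms(1)[OF A.mpoly_cring] C])
  have homog: "homogeneous_ideal A {..n} (lift_ideal c)"
  proof (rule A.homogeneous_ideal_Idl[OF C])
    fix g assume "g \<in> lift c ` M"
    then obtain \<alpha> where \<alpha>: "g = lift c \<alpha>" "\<alpha> \<in> M" by (rule imageE)
    then show "\<exists>d. supp A g \<subseteq> {m. size m = d}"
      by (intro exI[of _ "size \<alpha>"]) (simp add: supp_def subset_iff lift_size)
  qed
  have cancel: "p \<in> lift_ideal c" if p: "p \<in> carrier (mpoly A {..n})" "shift A {#n#} p \<in> lift_ideal c" for p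
  proof -
    obtain r where r: "r \<in> carrier (mpoly A {..n})" "standard_poly A M r"
      "(\<lambda>m. p m \<ominus> r m) \<in> lift_ideal c"
      using division_ideal[OF p(1)] .
    have "shift A {#n#} r \<in> lift_ideal c"
      using A.ideal_mpoly_shift[OF I r(3) last_term] unfolding A.shift_minus
      by (rule A.ideal_mpoly_remainder[OF I p(2) A.shift_closed[OF last_term r(1)]])
    then have "shift A {#n#} r = (\<lambda>m. \<zero>)"
      using standard_poly_last[OF r(2)] by (rule std)
    then have "r = (\<lambda>m. \<zero>)" by (rule A.shift_eq_zero)
    then show ?thesis using r(3) mpoly_coeff_closed[OF p(1)] by (simp add: A.minus_eq)
  qed
  have "restrict_last A n ` lift_ideal c = HA"
  proof (intro equalityI subsetI)
    fix g assume "g \<in> restrict_last A n ` lift_ideal c"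
    then obtain p where p: "p \<in> lift_ideal c" "g = restrict_last A n p" by blast
    have "p \<in> lspan A (multiples A {..n} (lift c ` M))" using p(1) unfolding A.Idl_eq_lspan[OF C] .
    then have "restrict_last A n p \<in> lspan A (multiples A {..<n} (f ` M))"
    proof induction
      case zero
      then show ?case by (simp add: lspan.zero)
    next
      case (step p a b)
      then obtain s \<alpha> where b: "b = shift A s (lift c \<alpha>)" "s \<in> terms {..n}" "\<alpha> \<in> M" by auto
      show ?case
      proof (cases "n \<in># s")
        case True
        then have "restrict_last A n b m = \<zero>" for m by (simp add: b A.restrict_last_shift)
        then show ?thesis
          unfolding A.restrict_last_lin[OF step.hyps(2)]
          using step.IH step.hyps(2) A.lspan_coeff_closed[OF A.multiples_closed[OF C0] step.IH] by simp
      next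
        case False
        have "s \<in> terms {..<n}" using b(2) False by (auto simp: terms_def less_le)
        moreover have "restrict_last A n b = shift A s (f \<alpha>)"
          using False b restrict_lift by (simp add: A.restrict_last_shift)
        ultimately have "restrict_last A n b \<in> multiples A {..<n} (f ` M)" using b(3) by blast
        then show ?thesis
          unfolding A.restrict_last_lin[OF step.hyps(2)] by (intro lspan.step step)
      qed
    qed
    then show "g \<in> HA" unfolding p(2) HA_eq A.Idl_eq_lspan[OF C0] .
  next
    fix g assume "g \<in> HA"
    then have "g \<in> lspan A (multiples A {..<n} (f ` M))" unfolding HA_eq A.Idl_eq_lspan[OF C0] .
    then have "\<exists>p\<in>lift_ideal c. restrict_last A n p = g"
    proof induction
      case zero
      show ?case using A.ideal_mpoly_zero[OF I] by (intro bexI[of _ "\<lambda>m. \<zero>"]) simp_all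
    next
      case (step p a b)
      then obtain q where q: "q \<in> lift_ideal c" "restrict_last A n q = p" by blast
      obtain s \<alpha> where b: "b = shift A s (f \<alpha>)" "s \<in> terms {..<n}" "\<alpha> \<in> M" using step.hyps(3) by auto
      have ns: "n \<notin># s" using b(2) by (auto simp: terms_def)
      have "lift c \<alpha> \<in> lift_ideal c"
        using ring.genideal_self[OF cring.axioms(1)[OF A.mpoly_cring] C] b(3) by auto
      then have l: "shift A s (lift c \<alpha>) \<in> lift_ideal c"
        using b(2) by (intro A.ideal_mpoly_shift[OF I] terms_atMost)
      have "restrict_last A n (shift A s (lift c \<alpha>)) = b"
        using ns b restrict_lift by (simp add: A.restrict_last_shift)
      moreover have "(\<lambda>m. a \<otimes> shift A s (lift c \<alpha>) m \<oplus> q m) \<in> lift_ideal c"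
        using A.ideal_mpoly_add[OF I A.ideal_mpoly_smult[OF I l step.hyps(2)] q(1)] .
      ultimately show ?case
        using q(2) by (intro bexI[of _ "\<lambda>m. a \<otimes> shift A s (lift c \<alpha>) m \<oplus> q m"])
          (simp_all add: A.restrict_last_lin[OF step.hyps(2)])
    qed
    then show "g \<in> restrict_last A n ` lift_ideal c" by blast
  qed
  then show ?thesis using homog cancel by (simp add: lifting_iff)
qed

end

section \<open>Evaluation homomorphisms\<close>

lemma mpoly_algebra:
  assumes "cring K" shows "algebra K (mpoly K V)"
proof -
  interpret cring K by fact
  interpret P: cring "mpoly K V" by (rule mpoly_cring)
  show ?thesis
  proof (rule algebraI)
    fix a x y assume a: "a \<in> carrier K" and x: "x \<in> carrier (mpoly K V)" and y: "y \<in> carrier (mpoly K V)"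
    have *: "a \<odot>\<^bsub>mpoly K V\<^esub> z = monom K a {#} \<otimes>\<^bsub>mpoly K V\<^esub> z" if "z \<in> carrier (mpoly K V)" for z
      using monom_mult[OF a mpoly_coeff_closed[OF that], of V "{#}"] by simp
    show "a \<odot>\<^bsub>mpoly K V\<^esub> x \<otimes>\<^bsub>mpoly K V\<^esub> y = a \<odot>\<^bsub>mpoly K V\<^esub> (x \<otimes>\<^bsub>mpoly K V\<^esub> y)"
      unfolding *[OF x] *[OF P.m_closed[OF x y]] using a x y by (intro P.m_assoc) simp_all
  qed (simp_all add: is_cring P.is_cring mpoly_smult_closed mpoly_coeff_closed l_distr r_distr m_assoc)
qed

locale evaluation = cring A for A :: "('k, 'a) module" (structure) +
  fixes K :: "'k ring" and C :: "'c set" and c :: "'c \<Rightarrow> 'a"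
  assumes algebra: "algebra K A" and finite_vars: "finite C" and c_closed: "v \<in> C \<Longrightarrow> c v \<in> carrier A"
begin

sublocale K: cring K
  using algebra by (rule algebra.axioms(1)[THEN module.axioms(1)])

definition sc :: "'k \<Rightarrow> 'a" where "sc k = k \<odot> \<one>"

sublocale sc: ring_hom_cring K A sc
  using algebra_scalar_hom[OF algebra]
  by (intro ring_hom_cring.intro ring_hom_cring_axioms.intro K.is_cring is_cring) (simp add: sc_def[abs_def])

lemma sc_mult: "k \<in> carrier K \<Longrightarrow> x \<in> carrier A \<Longrightarrow> sc k \<otimes> x = k \<odot> x"
proof -
  interpret algebra K A by (rule algebra)
  show "k \<in> carrier K \<Longrightarrow> x \<in> carrier A \<Longrightarrow> sc k \<otimes> x = k \<odot> x"
    by (simp add: sc_def smult_assoc2)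
qed

definition eval_term :: "'c multiset \<Rightarrow> 'a" where
  "eval_term m = (\<Otimes>v\<in>C. c v [^] count m v)"

definition eval_poly :: "('c multiset \<Rightarrow> 'k) \<Rightarrow> 'a" where
  "eval_poly p = (\<Oplus>m\<in>supp K p. sc (p m) \<otimes> eval_term m)"

abbreviation "PC \<equiv> mpoly K C"

lemma eval_term_closed [simp]: "eval_term m \<in> carrier A"
  by (simp add: eval_term_def Pi_def c_closed)

lemma eval_term_add: "eval_term (s + t) = eval_term s \<otimes> eval_term t"
proof -
  have "eval_term (s + t) = (\<Otimes>v\<in>C. c v [^] count s v \<otimes> c v [^] count t v)"
    unfolding eval_term_def by (intro finprod_cong') (auto simp: nat_pow_mult c_closed)
  then show ?thesis by (simp add: eval_term_def finprod_multf Pi_def c_closed)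
qed

lemma eval_term_empty: "eval_term {#} = \<one>"
  by (simp add: eval_term_def)

lemma eval_term_single: "v \<in> C \<Longrightarrow> eval_term {#v#} = c v"
proof -
  assume v: "v \<in> C"
  have "eval_term {#v#} = (\<Otimes>w\<in>C. if v = w then c w else \<one>)"
    unfolding eval_term_def using c_closed by (intro finprod_cong') auto
  then show ?thesis using finprod_singleton[OF v finite_vars, of c] c_closed by (simp add: Pi_def)
qed

lemma eval_poly_superset:
  assumes p: "p \<in> carrier PC" and S: "finite S" "supp K p \<subseteq> S"
  shows "eval_poly p = (\<Oplus>m\<in>S. sc (p m) \<otimes> eval_term m)"
  unfolding eval_poly_def
proof (rule add.finprod_mono_neutral_cong_left[OF S])
  show "sc (p m) \<otimes> eval_term m = \<zero>" if "m \<in> S - supp K p" for m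
    using that by (simp add: supp_def)
qed (use mpoly_coeff_closed[OF p] in auto)

lemma eval_poly_closed [simp]: "p \<in> carrier PC \<Longrightarrow> eval_poly p \<in> carrier A"
  unfolding eval_poly_def using mpoly_coeff_closed[of p K C] by (intro finsum_closed) auto

lemma eval_poly_lin:
  assumes a: "a \<in> carrier K" and p: "p \<in> carrier PC" and q: "q \<in> carrier PC"
  shows "eval_poly (\<lambda>m. a \<otimes>\<^bsub>K\<^esub> p m \<oplus>\<^bsub>K\<^esub> q m) = sc a \<otimes> eval_poly p \<oplus> eval_poly q"
proof -
  let ?S = "supp K p \<union> supp K q"
  have S: "finite ?S" using p q by (simp add: mpoly_carrier)
  have cl: "p m \<in> carrier K" "q m \<in> carrier K" for m
    using mpoly_coeff_closed[OF p] mpoly_coeff_closed[OF q] by auto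
  have pq: "(\<lambda>m. a \<otimes>\<^bsub>K\<^esub> p m \<oplus>\<^bsub>K\<^esub> q m) \<in> carrier PC"
    by (intro K.mpoly_add_closed K.mpoly_smult_closed a p q)
  have "supp K (\<lambda>m. a \<otimes>\<^bsub>K\<^esub> p m \<oplus>\<^bsub>K\<^esub> q m) \<subseteq> ?S" using a by (auto simp: supp_def)
  then have "eval_poly (\<lambda>m. a \<otimes>\<^bsub>K\<^esub> p m \<oplus>\<^bsub>K\<^esub> q m) = (\<Oplus>m\<in>?S. sc (a \<otimes>\<^bsub>K\<^esub> p m \<oplus>\<^bsub>K\<^esub> q m) \<otimes> eval_term m)"
    by (rule eval_poly_superset[OF pq S])
  also have "\<dots> = (\<Oplus>m\<in>?S. sc a \<otimes> (sc (p m) \<otimes> eval_term m) \<oplus> sc (q m) \<otimes> eval_term m)"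
    using cl a by (intro finsum_cong') (auto simp: l_distr m_assoc)
  also have "\<dots> = sc a \<otimes> (\<Oplus>m\<in>?S. sc (p m) \<otimes> eval_term m) \<oplus> (\<Oplus>m\<in>?S. sc (q m) \<otimes> eval_term m)"
    using cl a S by (subst finsum_addf) (auto simp: finsum_rdistr)
  also have "\<dots> = sc a \<otimes> eval_poly p \<oplus> eval_poly q"
    using eval_poly_superset[OF p S] eval_poly_superset[OF q S] by simp
  finally show ?thesis .
qed

lemma eval_poly_zero [simp]: "eval_poly (\<lambda>m. \<zero>\<^bsub>K\<^esub>) = \<zero>"
  by (simp add: eval_poly_def supp_def)

lemma eval_poly_monom:
  assumes a: "a \<in> carrier K" and s: "s \<in> terms C"
  shows "eval_poly (monom K a s) = sc a \<otimes> eval_term s"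
proof -
  have "eval_poly (monom K a s) = (\<Oplus>m\<in>{s}. sc (monom K a s m) \<otimes> eval_term m)"
    by (intro eval_poly_superset K.monom_closed a s) (auto simp: supp_def monom_def)
  then show ?thesis using a by (simp add: monom_def)
qed

lemma eval_poly_shift:
  assumes s: "s \<in> terms C" and q: "q \<in> carrier PC"
  shows "eval_poly (shift K s q) = eval_term s \<otimes> eval_poly q"
  using q
proof (induction rule: K.mpoly_induct)
  case (step q a t)
  have m: "monom K \<one>\<^bsub>K\<^esub> t \<in> carrier PC" using step by simp
  have "eval_poly (shift K s (\<lambda>m. a \<otimes>\<^bsub>K\<^esub> monom K \<one>\<^bsub>K\<^esub> t m \<oplus>\<^bsub>K\<^esub> q m)) =
      eval_poly (\<lambda>m. a \<otimes>\<^bsub>K\<^esub> monom K \<one>\<^bsub>K\<^esub> (s + t) m \<oplus>\<^bsub>K\<^esub> shift K s q m)"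
    using step by (simp add: K.shift_lin K.shift_monom)
  also have "\<dots> = sc a \<otimes> eval_poly (monom K \<one>\<^bsub>K\<^esub> (s + t)) \<oplus> eval_poly (shift K s q)"
    using step s by (intro eval_poly_lin K.shift_closed) auto
  also have "\<dots> = sc a \<otimes> (eval_term s \<otimes> eval_term t) \<oplus> eval_term s \<otimes> eval_poly q"
    using step s by (simp add: eval_poly_monom eval_term_add)
  also have "\<dots> = eval_term s \<otimes> (sc a \<otimes> eval_term t \<oplus> eval_poly q)"
    using step by (simp add: r_distr m_lcomm)
  also have "\<dots> = eval_term s \<otimes> eval_poly (\<lambda>m. a \<otimes>\<^bsub>K\<^esub> monom K \<one>\<^bsub>K\<^esub> t m \<oplus>\<^bsub>K\<^esub> q m)"
    using step m by (simp add: eval_poly_lin eval_poly_monom)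
  finally show ?case .
qed simp

lemma eval_poly_mult:
  assumes p: "p \<in> carrier PC" and q: "q \<in> carrier PC"
  shows "eval_poly (p \<otimes>\<^bsub>PC\<^esub> q) = eval_poly p \<otimes> eval_poly q"
  using p
proof (induction rule: K.mpoly_induct)
  case zero
  interpret P: cring PC by (rule K.mpoly_cring)
  have "(\<lambda>m. \<zero>\<^bsub>K\<^esub>) \<otimes>\<^bsub>PC\<^esub> q = (\<lambda>m. \<zero>\<^bsub>K\<^esub>)" using P.l_null[OF q] by simp
  then show ?case using q by simp
next
  case (step p a s)
  interpret P: cring PC by (rule K.mpoly_cring)
  have m: "monom K \<one>\<^bsub>K\<^esub> s \<in> carrier PC" "monom K a s \<in> carrier PC" using step by auto
  have "(\<lambda>m. a \<otimes>\<^bsub>K\<^esub> monom K \<one>\<^bsub>K\<^esub> s m \<oplus>\<^bsub>K\<^esub> p m) = monom K a s \<oplus>\<^bsub>PC\<^esub> p"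
    using step by (auto simp: monom_def)
  then have "(\<lambda>m. a \<otimes>\<^bsub>K\<^esub> monom K \<one>\<^bsub>K\<^esub> s m \<oplus>\<^bsub>K\<^esub> p m) \<otimes>\<^bsub>PC\<^esub> q =
      (\<lambda>m. a \<otimes>\<^bsub>K\<^esub> shift K s q m \<oplus>\<^bsub>K\<^esub> (p \<otimes>\<^bsub>PC\<^esub> q) m)"
    using P.l_distr[OF m(2) step.hyps(1) q] K.monom_mult[OF step.hyps(2) mpoly_coeff_closed[OF q], of C s] by simp
  then have "eval_poly ((\<lambda>m. a \<otimes>\<^bsub>K\<^esub> monom K \<one>\<^bsub>K\<^esub> s m \<oplus>\<^bsub>K\<^esub> p m) \<otimes>\<^bsub>PC\<^esub> q) =
      sc a \<otimes> (eval_term s \<otimes> eval_poly q) \<oplus> eval_poly p \<otimes> eval_poly q"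
    using step q eval_poly_lin[OF step.hyps(2) K.shift_closed[OF step.hyps(3) q] P.m_closed[OF step.hyps(1) q]]
    by (simp add: eval_poly_shift)
  also have "\<dots> = (sc a \<otimes> eval_term s \<oplus> eval_poly p) \<otimes> eval_poly q"
    using step q by (simp add: l_distr m_assoc)
  also have "\<dots> = eval_poly (\<lambda>m. a \<otimes>\<^bsub>K\<^esub> monom K \<one>\<^bsub>K\<^esub> s m \<oplus>\<^bsub>K\<^esub> p m) \<otimes> eval_poly q"
    using step m by (simp add: eval_poly_lin eval_poly_monom)
  finally show ?case .
qed

lemma eval_poly_add:
  "p \<in> carrier PC \<Longrightarrow> q \<in> carrier PC \<Longrightarrow> eval_poly (p \<oplus>\<^bsub>PC\<^esub> q) = eval_poly p \<oplus> eval_poly q"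
  using eval_poly_lin[of "\<one>\<^bsub>K\<^esub>" p q] by (simp add: mpoly_coeff_closed)

lemma eval_poly_hom: "eval_poly \<in> ring_hom PC A"
proof (rule ring_hom_memI)
  show "eval_poly \<one>\<^bsub>PC\<^esub> = \<one>"
    by (simp add: eval_poly_monom eval_term_empty)
qed (simp_all add: eval_poly_mult eval_poly_add del: mpoly_simps)

lemma eval_poly_smult:
  assumes "k \<in> carrier K" and p: "p \<in> carrier PC"
  shows "eval_poly (k \<odot>\<^bsub>PC\<^esub> p) = k \<odot> eval_poly p"
proof -
  have "(\<lambda>m. k \<otimes>\<^bsub>K\<^esub> p m \<oplus>\<^bsub>K\<^esub> \<zero>\<^bsub>K\<^esub>) = k \<odot>\<^bsub>PC\<^esub> p"
    using assms(1) mpoly_coeff_closed[OF p] by simp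
  then have "eval_poly (k \<odot>\<^bsub>PC\<^esub> p) = sc k \<otimes> eval_poly p"
    using eval_poly_lin[OF assms K.mpoly_zero_closed] assms by simp
  then show ?thesis using assms by (simp add: sc_mult del: mpoly_simps)
qed

text \<open>The universal property of the polynomial ring \<open>K[C]\<close>.\<close>

lemma hom_eq_eval_poly:
  assumes h: "h \<in> ring_hom PC A" and sm: "\<And>k p. k \<in> carrier K \<Longrightarrow> p \<in> carrier PC \<Longrightarrow> h (k \<odot>\<^bsub>PC\<^esub> p) = k \<odot> h p"
    and c: "\<And>v. v \<in> C \<Longrightarrow> h (monom K \<one>\<^bsub>K\<^esub> {#v#}) = c v" and p: "p \<in> carrier PC"
  shows "h p = eval_poly p"
proof -
  interpret h: ring_hom_cring PC A h
    by (intro ring_hom_cring.intro ring_hom_cring_axioms.intro K.mpoly_cring is_cring h)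
  have mon: "h (monom K \<one>\<^bsub>K\<^esub> s) = eval_term s" if "s \<in> terms C" for s
    using that
  proof (induction s)
    case empty
    show ?case using h.hom_one by (simp add: eval_term_empty)
  next
    case (add v s)
    then have v: "v \<in> C" "s \<in> terms C" by (auto simp: terms_def)
    have m: "monom K \<one>\<^bsub>K\<^esub> {#v#} \<in> carrier PC" "monom K \<one>\<^bsub>K\<^esub> s \<in> carrier PC"
      using v by (auto simp: terms_def)
    have "monom K \<one>\<^bsub>K\<^esub> {#v#} \<otimes>\<^bsub>PC\<^esub> monom K \<one>\<^bsub>K\<^esub> s = monom K \<one>\<^bsub>K\<^esub> (add_mset v s)"
    proof -
      have "monom K \<one>\<^bsub>K\<^esub> t m \<in> carrier K" for t :: "'c multiset" and m by (simp add: monom_def)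
      then show ?thesis
        using K.monom_mult[of "\<one>\<^bsub>K\<^esub>" "monom K \<one>\<^bsub>K\<^esub> s" C "{#v#}"] by (simp add: K.shift_monom)
    qed
    then have "h (monom K \<one>\<^bsub>K\<^esub> (add_mset v s)) = c v \<otimes> eval_term s"
      using h.hom_mult[OF m] c[OF v(1)] add.IH[OF v(2)] by simp
    then show ?case
      using eval_term_add[of "{#v#}" s] eval_term_single[OF v(1)] by simp
  qed
  from p show ?thesis
  proof (induction rule: K.mpoly_induct)
    case zero
    then show ?case using h.hom_zero by simp
  next
    case (step q a s)
    have m: "monom K \<one>\<^bsub>K\<^esub> s \<in> carrier PC" "a \<odot>\<^bsub>PC\<^esub> monom K \<one>\<^bsub>K\<^esub> s \<in> carrier PC"
      using step K.mpoly_smult_closed[OF step.hyps(2), of "monom K \<one>\<^bsub>K\<^esub> s"] by auto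
    have "h (\<lambda>m. a \<otimes>\<^bsub>K\<^esub> monom K \<one>\<^bsub>K\<^esub> s m \<oplus>\<^bsub>K\<^esub> q m) = h (a \<odot>\<^bsub>PC\<^esub> monom K \<one>\<^bsub>K\<^esub> s \<oplus>\<^bsub>PC\<^esub> q)" by simp
    also have "\<dots> = a \<odot> eval_term s \<oplus> h q"
      using h.hom_add[OF m(2) step.hyps(1)] sm[OF step.hyps(2) m(1)] mon[OF step.hyps(3)] by simp
    also have "\<dots> = eval_poly (\<lambda>m. a \<otimes>\<^bsub>K\<^esub> monom K \<one>\<^bsub>K\<^esub> s m \<oplus>\<^bsub>K\<^esub> q m)"
      using step m eval_poly_lin[OF step.hyps(2) m(1) step.hyps(1)] by (simp add: eval_poly_monom sc_mult)
    finally show ?case .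
  qed
qed

subsection \<open>Coefficientwise evaluation\<close>

text \<open>The map \<open>K[C][\<bold>x, x\<^sub>n] \<rightarrow> A[\<bold>x, x\<^sub>n]\<close> that evaluates coefficients at \<open>c\<close>. S-polynomials and reductions
  are formed by linear combinations and \<open>shift\<close>, which this map respects.\<close>

definition eval_coeffs :: "(('c + nat) multiset \<Rightarrow> 'k) \<Rightarrow> nat multiset \<Rightarrow> 'a" where
  "eval_coeffs p = (\<lambda>m. eval_poly (coeff_of_xterm p m))"

end

lemma cpart_join [simp]: "cpart (image_mset Inl \<delta> + image_mset Inr m) = \<delta>"
  by (simp add: cpart_def filter_mset_image_mset multiset.map_comp comp_def)

lemma xpart_join [simp]: "xpart (image_mset Inl \<delta> + image_mset Inr m) = m"
  by (simp add: xpart_def filter_mset_image_mset multiset.map_comp comp_def)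

lemma cpart_Inr [simp]: "cpart (image_mset Inr m) = {#}" and xpart_Inr [simp]: "xpart (image_mset Inr m) = m"
  using cpart_join[of "{#}" m] xpart_join[of "{#}" m] by simp_all

lemma cpart_Inl [simp]: "cpart (image_mset Inl \<delta>) = \<delta>" and xpart_Inl [simp]: "xpart (image_mset Inl \<delta>) = {#}"
  using cpart_join[of \<delta> "{#}"] xpart_join[of \<delta> "{#}"] by simp_all

text \<open>A term in \<open>C\<close> and \<open>\<bold>x, x\<^sub>n\<close> is the product of its two parts; \<open>parts_eqI\<close> and \<open>parts_terms\<close> reduce
  questions about such terms to the parts.\<close>

lemma join_parts: "image_mset Inl (cpart t) + image_mset Inr (xpart t) = t"
proof -
  have "image_mset Inl (cpart t) = filter_mset isl t"
    unfolding cpart_def multiset.map_comp comp_def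
    by (rule trans[OF image_mset_cong[of _ _ "\<lambda>x. x"]]) (auto)
  moreover have "image_mset Inr (xpart t) = filter_mset (\<lambda>v. \<not> isl v) t"
    unfolding xpart_def multiset.map_comp comp_def
    by (rule trans[OF image_mset_cong[of _ _ "\<lambda>x. x"]]) (auto)
  ultimately show ?thesis by (simp add: multiset_partition[symmetric])
qed

lemma cpart_add [simp]: "cpart (s + t) = cpart s + cpart t" and xpart_add [simp]: "xpart (s + t) = xpart s + xpart t"
  by (simp_all add: cpart_def xpart_def)

lemma parts_eqI: "cpart s = cpart t \<Longrightarrow> xpart s = xpart t \<Longrightarrow> s = t"
  by (metis join_parts)

lemma join_terms: "image_mset Inl \<delta> + image_mset Inr m \<in> terms (C <+> W) \<longleftrightarrow> \<delta> \<in> terms C \<and> m \<in> terms W"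
  by (auto simp: terms_def)

lemma parts_terms: "t \<in> terms (C <+> W) \<longleftrightarrow> cpart t \<in> terms C \<and> xpart t \<in> terms W"
  using join_terms[of "cpart t" "xpart t" C W] by (simp add: join_parts)

lemma coeff_of_xterm_shift:
  fixes p :: "('c + nat) multiset \<Rightarrow> 'k"
  shows "coeff_of_xterm (shift K u p) m =
    (if xpart u \<subseteq># m then shift K (cpart u) (coeff_of_xterm p (m - xpart u)) else (\<lambda>\<delta>. \<zero>\<^bsub>K\<^esub>))"
proof
  fix \<delta> :: "'c multiset"
  let ?t = "image_mset Inl \<delta> + image_mset Inr m :: ('c + nat) multiset"
  show "coeff_of_xterm (shift K u p) m \<delta> =
    (if xpart u \<subseteq># m then shift K (cpart u) (coeff_of_xterm p (m - xpart u)) else (\<lambda>\<delta>. \<zero>\<^bsub>K\<^esub>)) \<delta>"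
  proof (cases "xpart u \<subseteq># m \<and> cpart u \<subseteq># \<delta>")
    case True
    then obtain m' \<delta>' where *: "m = xpart u + m'" "\<delta> = cpart u + \<delta>'"
      by (auto simp: mset_subset_eq_exists_conv)
    then have t: "?t = u + (image_mset Inl \<delta>' + image_mset Inr m')"
      by (intro parts_eqI) simp_all
    have "coeff_of_xterm (shift K u p) m \<delta> = coeff_of_xterm p m' \<delta>'"
      by (simp only: coeff_of_xterm_def t shift_add_term)
    then show ?thesis using * by simp
  next
    case False
    have "\<not> u \<subseteq># ?t"
    proof
      assume "u \<subseteq># ?t"
      then obtain v where v: "?t = u + v" by (auto simp: mset_subset_eq_exists_conv)
      have "\<delta> = cpart (u + v)" "m = xpart (u + v)" unfolding v[symmetric] by simp_all
      then show False using False by simp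
    qed
    then show ?thesis using False by (auto simp: coeff_of_xterm_def shift_def)
  qed
qed

context evaluation
begin

lemma coeff_of_xterm_closed:
  assumes p: "p \<in> carrier (mpoly K (C <+> W))"
  shows "coeff_of_xterm p m \<in> carrier PC"
proof (rule mpoly_carrierI[of _ _ "cpart ` supp K p"])
  fix \<delta>
  show "coeff_of_xterm p m \<delta> \<in> carrier K"
    using mpoly_coeff_closed[OF p] by (simp add: coeff_of_xterm_def)
  assume "coeff_of_xterm p m \<delta> \<noteq> \<zero>\<^bsub>K\<^esub>"
  then have *: "p (image_mset Inl \<delta> + image_mset Inr m) \<noteq> \<zero>\<^bsub>K\<^esub>" by (simp add: coeff_of_xterm_def)
  show "\<delta> \<in> cpart ` supp K p \<and> \<delta> \<in> terms C"
    using * mpoly_term[OF p *] unfolding join_terms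
    by (auto simp: supp_def intro!: image_eqI[of _ _ "image_mset Inl \<delta> + image_mset Inr m"])
qed (use p in \<open>simp add: mpoly_carrier\<close>)

lemma eval_coeffs_coeff_closed:
  "p \<in> carrier (mpoly K (C <+> W)) \<Longrightarrow> eval_coeffs p m \<in> carrier A"
  by (simp add: eval_coeffs_def coeff_of_xterm_closed)

lemma eval_coeffs_nonzero:
  assumes "eval_coeffs p m \<noteq> \<zero>"
  shows "\<exists>t. p t \<noteq> \<zero>\<^bsub>K\<^esub> \<and> xpart t = m"
proof (rule ccontr)
  assume "\<nexists>t. p t \<noteq> \<zero>\<^bsub>K\<^esub> \<and> xpart t = m"
  then have "coeff_of_xterm p m = (\<lambda>\<delta>. \<zero>\<^bsub>K\<^esub>)"
    unfolding coeff_of_xterm_def by (metis xpart_join)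
  then show False using assms by (simp add: eval_coeffs_def)
qed

lemma eval_coeffs_closed:
  assumes p: "p \<in> carrier (mpoly K (C <+> W))"
  shows "eval_coeffs p \<in> carrier (mpoly A W)"
proof (rule mpoly_carrierI[of _ _ "xpart ` supp K p"])
  show "eval_coeffs p m \<in> carrier A" for m by (rule eval_coeffs_coeff_closed[OF p])
  fix m assume "eval_coeffs p m \<noteq> \<zero>"
  then obtain t where t: "p t \<noteq> \<zero>\<^bsub>K\<^esub>" "xpart t = m" using eval_coeffs_nonzero[of p m] by auto
  then show "m \<in> xpart ` supp K p \<and> m \<in> terms W"
    using mpoly_term[OF p t(1)] by (auto simp: supp_def parts_terms)
qed (use p in \<open>simp add: mpoly_carrier\<close>)

lemma eval_coeffs_lin:
  assumes "a \<in> carrier K" and "p \<in> carrier (mpoly K (C <+> W))" and "q \<in> carrier (mpoly K (C <+> W))"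
  shows "eval_coeffs (\<lambda>t. a \<otimes>\<^bsub>K\<^esub> p t \<oplus>\<^bsub>K\<^esub> q t) = (\<lambda>m. sc a \<otimes> eval_coeffs p m \<oplus> eval_coeffs q m)"
proof
  fix m
  have "coeff_of_xterm (\<lambda>t. a \<otimes>\<^bsub>K\<^esub> p t \<oplus>\<^bsub>K\<^esub> q t) m = (\<lambda>\<delta>. a \<otimes>\<^bsub>K\<^esub> coeff_of_xterm p m \<delta> \<oplus>\<^bsub>K\<^esub> coeff_of_xterm q m \<delta>)"
    by (simp add: coeff_of_xterm_def)
  then show "eval_coeffs (\<lambda>t. a \<otimes>\<^bsub>K\<^esub> p t \<oplus>\<^bsub>K\<^esub> q t) m = sc a \<otimes> eval_coeffs p m \<oplus> eval_coeffs q m"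
    using assms by (simp add: eval_coeffs_def eval_poly_lin coeff_of_xterm_closed)
qed

lemma eval_coeffs_shift:
  assumes u: "u \<in> terms (C <+> W)" and p: "p \<in> carrier (mpoly K (C <+> W))"
  shows "eval_coeffs (shift K u p) = (\<lambda>m. eval_term (cpart u) \<otimes> shift A (xpart u) (eval_coeffs p) m)"
proof
  fix m
  have "cpart u \<in> terms C" using u by (simp add: parts_terms)
  then show "eval_coeffs (shift K u p) m = eval_term (cpart u) \<otimes> shift A (xpart u) (eval_coeffs p) m"
    using p by (simp add: eval_coeffs_def coeff_of_xterm_shift eval_poly_shift coeff_of_xterm_closed
        shift_def[of A] del: mpoly_simps)
qed

end

section \<open>S-polynomials of the generic elements\<close>

locale lifting_reductions = lifting_problem K n H prec
  for K :: "'k ring" and n :: nat and H :: "(nat multiset \<Rightarrow> 'k) set"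
    and prec :: "nat multiset \<Rightarrow> nat multiset \<Rightarrow> bool" +
  fixes precC :: "cvar multiset \<Rightarrow> cvar multiset \<Rightarrow> bool"
    and red :: "nat multiset \<Rightarrow> nat multiset \<Rightarrow> (cvar + nat) multiset \<Rightarrow> 'k"
  assumes precC: "term_order (cvars K n prec H) precC"
    and red: "spoly_complete_reductions K n prec precC H red"
begin

abbreviation "C \<equiv> cvars K n prec H"
abbreviation "W \<equiv> C <+> {..n}"
abbreviation "eprec \<equiv> elimination_order (degrevorder n prec) precC"
abbreviation "G \<equiv> generic_element K n prec H"
abbreviation "hh \<equiv> h0 K n prec H red"

lemma degrev: "term_order {..n} (degrevorder n prec)"
  by (rule term_order_degrevorder[OF prec])

lemma term_order_eprec: "term_order W eprec"
  unfolding term_order_def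
proof (intro conjI ballI impI)
  fix s t u :: "(cvar + nat) multiset" assume s: "s \<in> terms W"
  then have s': "cpart s \<in> terms C" "xpart s \<in> terms {..n}" by (simp_all add: parts_terms)
  show "\<not> eprec s s"
    using term_order_irrefl[OF degrev s'(2)] term_order_irrefl[OF precC s'(1)] by (simp add: elimination_order_def)
  show "eprec {#} s" if "s \<noteq> {#}"
  proof -
    have e: "cpart {#} = ({#} :: cvar multiset)" "xpart {#} = {#}" by (simp_all add: cpart_def xpart_def)
    have "xpart s \<noteq> {#} \<or> cpart s \<noteq> {#}" using that parts_eqI[of s "{#}"] e by auto
    then show ?thesis
      using term_order_divides[OF degrev _ _ s'(2), of "{#}"] term_order_divides[OF precC _ _ s'(1), of "{#}"] e
      unfolding elimination_order_def by (cases "xpart s = {#}") auto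
  qed
  assume t: "t \<in> terms W"
  then have t': "cpart t \<in> terms C" "xpart t \<in> terms {..n}" by (simp_all add: parts_terms)
  show "eprec s t \<or> eprec t s" if "s \<noteq> t"
    using term_order_total[OF degrev s'(2) t'(2)] term_order_total[OF precC s'(1) t'(1)] that parts_eqI[of s t]
    by (auto simp: elimination_order_def)
  assume u: "u \<in> terms W"
  then have u': "cpart u \<in> terms C" "xpart u \<in> terms {..n}" by (simp_all add: parts_terms)
  show "eprec s u" if "eprec s t" "eprec t u"
    using that term_order_trans[OF degrev _ _ s'(2) t'(2) u'(2)] term_order_trans[OF precC _ _ s'(1) t'(1) u'(1)]
    by (auto simp: elimination_order_def)
  show "eprec (s + u) (t + u)" if "eprec s t"
    using that term_order_add[OF degrev _ s'(2) t'(2) u'(2)] term_order_add[OF precC _ s'(1) t'(1) u'(1)]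
    by (auto simp: elimination_order_def add.commute)
qed

text \<open>The terms of \<open>g\<^sub>\<alpha>\<close>, that is the products of \<open>C\<^sub>\<alpha>\<^sub>\<gamma>\<close> with \<open>x\<^sub>n x\<^sup>\<gamma>\<close>.\<close>

definition is_tail_term :: "nat multiset \<Rightarrow> (cvar + nat) multiset \<Rightarrow> bool" where
  "is_tail_term \<alpha> t \<longleftrightarrow> n \<in># xpart t \<and> (\<alpha>, xpart t - {#n#}) \<in> C \<and> cpart t = {#(\<alpha>, xpart t - {#n#})#}"

lemma normal_cvars: "\<alpha> \<in> M \<Longrightarrow> add_mset n \<gamma> \<in> normal_terms K n prec H (size \<alpha>) \<longleftrightarrow> (\<alpha>, \<gamma>) \<in> C"
  by (simp add: cvars_def minimal_generators_eq)

lemma generic_element_closed_coeff: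
  assumes \<alpha>: "\<alpha> \<in> M"
  shows generic_element_closed: "G \<alpha> \<in> carrier (mpoly K W)"
    and generic_element_coeff: "G \<alpha> t = (if cpart t = {#} then H.basis \<alpha> (xpart t) else \<zero>\<^bsub>K\<^esub>)
      \<oplus>\<^bsub>K\<^esub> (if is_tail_term \<alpha> t then \<one>\<^bsub>K\<^esub> else \<zero>\<^bsub>K\<^esub>)"
proof -
  interpret P: cring "mpoly K W" by (rule H.mpoly_cring)
  note bc = H.basis.F_closed[OF \<alpha>]
  have cl: "H.basis \<alpha> m \<in> carrier K" for m by (rule mpoly_coeff_closed[OF bc])
  let ?S1 = "supp K (H.basis \<alpha>)" and ?S2 = "{\<gamma>. add_mset n \<gamma> \<in> normal_terms K n prec H (size \<alpha>)}"
  let ?f1 = "\<lambda>m. monom K (H.basis \<alpha> m) (image_mset Inr m) :: (cvar + nat) multiset \<Rightarrow> 'k"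
  let ?t2 = "\<lambda>\<gamma>. add_mset (Inl (\<alpha>, \<gamma>)) (image_mset Inr (add_mset n \<gamma>)) :: (cvar + nat) multiset"
  let ?f2 = "\<lambda>\<gamma>. monom K \<one>\<^bsub>K\<^esub> (?t2 \<gamma>)"
  have t2: "?t2 \<gamma> = image_mset Inl {#(\<alpha>, \<gamma>)#} + image_mset Inr (add_mset n \<gamma>)" for \<gamma> by simp
  have S1: "finite ?S1" "?S1 \<subseteq> terms {..<n}" using bc by (auto simp: mpoly_carrier)
  have "?S2 \<subseteq> (\<lambda>m. m - {#n#}) ` normal_terms K n prec H (size \<alpha>)"
    by (auto intro!: image_eqI[of _ _ "add_mset n _"])
  then have S2: "finite ?S2" using finite_normal_terms by (auto intro: finite_subset)
  have c1: "?f1 m \<in> carrier (mpoly K W)" if "m \<in> ?S1" for m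
  proof (rule H.monom_closed[OF cl])
    have "m \<in> terms {..n}" using that S1(2) terms_atMost by blast
    then show "image_mset Inr m \<in> terms W" using join_terms[of "{#}" m C "{..n}"] by simp
  qed
  have c2: "?f2 \<gamma> \<in> carrier (mpoly K W)" if "\<gamma> \<in> ?S2" for \<gamma>
  proof (rule H.monom_closed)
    have "(\<alpha>, \<gamma>) \<in> C" using that normal_cvars[OF \<alpha>] by simp
    then show "?t2 \<gamma> \<in> terms W"
      unfolding t2 join_terms by (auto simp: terms_def cvars_iff)
  qed simp
  have G: "G \<alpha> = (\<Oplus>\<^bsub>mpoly K W\<^esub>m\<in>?S1. ?f1 m) \<oplus>\<^bsub>mpoly K W\<^esub> (\<Oplus>\<^bsub>mpoly K W\<^esub>\<gamma>\<in>?S2. ?f2 \<gamma>)"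
    by (simp add: generic_element_def Let_def all_vars_def groebner_element_eq[OF \<alpha>])
  show "G \<alpha> \<in> carrier (mpoly K W)"
    unfolding G using c1 c2 by (intro P.add.m_closed P.finsum_closed) auto
  have "(\<Oplus>\<^bsub>K\<^esub>m\<in>?S1. ?f1 m t) = (if xpart t \<in> ?S1 then ?f1 (xpart t) t else \<zero>\<^bsub>K\<^esub>)"
    using cl by (intro H.finsum_single[OF S1(1)]) (auto simp: monom_def)
  also have "\<dots> = (if cpart t = {#} then H.basis \<alpha> (xpart t) else \<zero>\<^bsub>K\<^esub>)"
  proof -
    have "t = image_mset Inr (xpart t) \<longleftrightarrow> cpart t = {#}"
    proof
      assume "t = image_mset Inr (xpart t)"
      then have "cpart t = cpart (image_mset Inr (xpart t) :: (cvar + nat) multiset)" by (rule arg_cong)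
      then show "cpart t = {#}" by simp
    qed (auto intro: parts_eqI)
    then show ?thesis by (auto simp: monom_def supp_def)
  qed
  finally have e1: "(\<Oplus>\<^bsub>mpoly K W\<^esub>m\<in>?S1. ?f1 m) t = (if cpart t = {#} then H.basis \<alpha> (xpart t) else \<zero>\<^bsub>K\<^esub>)"
    using H.mpoly_finsum[OF S1(1) c1, where m = t] by simp
  have t2_iff: "t = ?t2 \<gamma> \<longleftrightarrow> cpart t = {#(\<alpha>, \<gamma>)#} \<and> xpart t = add_mset n \<gamma>" for \<gamma>
    using parts_eqI[of t "?t2 \<gamma>"] cpart_join[of "{#(\<alpha>, \<gamma>)#}" "add_mset n \<gamma>"]
      xpart_join[of "{#(\<alpha>, \<gamma>)#}" "add_mset n \<gamma>"] unfolding t2 by metis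
  let ?i = "\<lambda>\<gamma>. if cpart t = {#(\<alpha>, \<gamma>)#} \<and> xpart t = add_mset n \<gamma> then \<one>\<^bsub>K\<^esub> else \<zero>\<^bsub>K\<^esub>"
  have "(\<Oplus>\<^bsub>K\<^esub>\<gamma>\<in>?S2. ?f2 \<gamma> t) = (\<Oplus>\<^bsub>K\<^esub>\<gamma>\<in>?S2. ?i \<gamma>)"
    unfolding monom_def t2_iff ..
  also have "\<dots> = (if xpart t - {#n#} \<in> ?S2 then ?i (xpart t - {#n#}) else \<zero>\<^bsub>K\<^esub>)"
    by (intro H.finsum_single[OF S2]) auto
  also have "\<dots> = (if is_tail_term \<alpha> t then \<one>\<^bsub>K\<^esub> else \<zero>\<^bsub>K\<^esub>)"
  proof (cases "n \<in># xpart t")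
    case True
    then show ?thesis using normal_cvars[OF \<alpha>, of "xpart t - {#n#}"] by (simp add: is_tail_term_def)
  next
    case False
    then have "xpart t \<noteq> add_mset n m" for m by auto
    then show ?thesis using False by (simp add: is_tail_term_def)
  qed
  finally have e2: "(\<Oplus>\<^bsub>mpoly K W\<^esub>\<gamma>\<in>?S2. ?f2 \<gamma>) t = (if is_tail_term \<alpha> t then \<one>\<^bsub>K\<^esub> else \<zero>\<^bsub>K\<^esub>)"
    using H.mpoly_finsum[OF S2 c2, where m = t] by simp
  show "G \<alpha> t = (if cpart t = {#} then H.basis \<alpha> (xpart t) else \<zero>\<^bsub>K\<^esub>)
      \<oplus>\<^bsub>K\<^esub> (if is_tail_term \<alpha> t then \<one>\<^bsub>K\<^esub> else \<zero>\<^bsub>K\<^esub>)"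
    unfolding G using e1 e2 by simp
qed

lemma generic_element_head_coeff: "\<alpha> \<in> M \<Longrightarrow> G \<alpha> (image_mset Inr \<alpha>) = \<one>\<^bsub>K\<^esub>"
  by (simp add: generic_element_coeff is_tail_term_def H.basis.F_head)

text \<open>Already the \<open>\<bold>x, x\<^sub>n\<close>-part of a tail term is smaller than \<open>\<alpha>\<close>, so the order on the terms in \<open>C\<close> never
  decides a comparison with the head term.\<close>

lemma generic_element_tail:
  assumes \<alpha>: "\<alpha> \<in> M" and t: "G \<alpha> t \<noteq> \<zero>\<^bsub>K\<^esub>" "t \<noteq> image_mset Inr \<alpha>"
  shows "degrevorder n prec (xpart t) \<alpha>"
proof (cases "is_tail_term \<alpha> t")
  case True
  then show ?thesis
    using cvars_degrev[of \<alpha> "xpart t - {#n#}"] by (auto simp: is_tail_term_def)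
next
  case False
  then have "cpart t = {#}" "H.basis \<alpha> (xpart t) \<noteq> \<zero>\<^bsub>K\<^esub>"
    using t(1) generic_element_coeff[OF \<alpha>, of t] by (auto split: if_splits)
  moreover have "xpart t \<noteq> \<alpha>" using t(2) \<open>cpart t = {#}\<close> parts_eqI[of t "image_mset Inr \<alpha>"] by auto
  ultimately show ?thesis using basis_tail_degrev[OF \<alpha>] by blast
qed

lemma head_term_generic_element:
  assumes \<alpha>: "\<alpha> \<in> M" shows "head_term K eprec (G \<alpha>) = image_mset Inr \<alpha>"
proof (rule head_term_eqI[OF term_order_eprec])
  show "supp K (G \<alpha>) \<subseteq> terms W" using generic_element_closed[OF \<alpha>] by (simp add: mpoly_carrier)
  show "image_mset Inr \<alpha> \<in> supp K (G \<alpha>)"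
    using generic_element_head_coeff[OF \<alpha>] H.one_not_zero by (simp add: supp_def)
  show "eprec t (image_mset Inr \<alpha>)" if "t \<in> supp K (G \<alpha>)" "t \<noteq> image_mset Inr \<alpha>" for t
    using generic_element_tail[OF \<alpha> _ that(2)] that(1) by (simp add: supp_def elimination_order_def)
qed

lemma head_coeff_generic_element: "\<alpha> \<in> M \<Longrightarrow> head_coeff K eprec (G \<alpha>) = \<one>\<^bsub>K\<^esub>"
  by (simp add: head_coeff_def head_term_generic_element generic_element_head_coeff)

lemma generic_element_nonzero: "\<alpha> \<in> M \<Longrightarrow> G \<alpha> \<noteq> (\<lambda>m. \<zero>\<^bsub>K\<^esub>)"
  using generic_element_head_coeff H.one_not_zero by metis

text \<open>Only the \<open>\<bold>x, x\<^sub>n\<close>-parts are compared, because after evaluation only these remain.\<close>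

definition below :: "nat multiset \<Rightarrow> ((cvar + nat) multiset \<Rightarrow> 'k) \<Rightarrow> bool" where
  "below l p \<longleftrightarrow> (\<forall>t. p t \<noteq> \<zero>\<^bsub>K\<^esub> \<longrightarrow> degrevorder n prec (xpart t) l)"

lemma reduction_stepE:
  assumes "reduction_step K W eprec (G ` M) h h'" and h: "h \<in> carrier (mpoly K W)"
  obtains \<alpha> u where "\<alpha> \<in> M" "u \<in> terms W" "h (u + image_mset Inr \<alpha>) \<noteq> \<zero>\<^bsub>K\<^esub>"
    "h' = (\<lambda>t. h t \<ominus>\<^bsub>K\<^esub> h (u + image_mset Inr \<alpha>) \<otimes>\<^bsub>K\<^esub> shift K u (G \<alpha>) t)"
proof -
  obtain \<alpha> u where \<alpha>: "\<alpha> \<in> M" and u: "h (u + image_mset Inr \<alpha>) \<noteq> \<zero>\<^bsub>K\<^esub>"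
    and h': "h' = h \<ominus>\<^bsub>mpoly K W\<^esub> (monom K (h (u + image_mset Inr \<alpha>) \<otimes>\<^bsub>K\<^esub> inv\<^bsub>K\<^esub> \<one>\<^bsub>K\<^esub>) u \<otimes>\<^bsub>mpoly K W\<^esub> G \<alpha>)"
    using assms(1) unfolding reduction_step_def
    by (auto simp: head_term_generic_element head_coeff_generic_element supp_def)
  let ?a = "h (u + image_mset Inr \<alpha>)"
  have a: "?a \<in> carrier K" by (rule mpoly_coeff_closed[OF h])
  have uW: "u \<in> terms W" using mpoly_term[OF h u] by simp
  note Gc = generic_element_closed[OF \<alpha>]
  have "monom K ?a u \<otimes>\<^bsub>mpoly K W\<^esub> G \<alpha> = (\<lambda>t. ?a \<otimes>\<^bsub>K\<^esub> shift K u (G \<alpha>) t)"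
    by (rule H.monom_mult[OF a mpoly_coeff_closed[OF Gc]])
  moreover have "(\<lambda>t. ?a \<otimes>\<^bsub>K\<^esub> shift K u (G \<alpha>) t) \<in> carrier (mpoly K W)"
    by (intro H.mpoly_smult_closed a H.shift_closed uW Gc)
  ultimately have "h' = (\<lambda>t. h t \<ominus>\<^bsub>K\<^esub> ?a \<otimes>\<^bsub>K\<^esub> shift K u (G \<alpha>) t)"
    using h' a H.mpoly_minus[OF h] by simp
  then show ?thesis using that \<alpha> uW u by blast
qed

lemma generic_multiple_xpart:
  assumes \<alpha>: "\<alpha> \<in> M" and u: "u \<in> terms W" and t: "shift K u (G \<alpha>) t \<noteq> \<zero>\<^bsub>K\<^esub>"
  shows "t = u + image_mset Inr \<alpha> \<or> degrevorder n prec (xpart t) (xpart u + \<alpha>)"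
proof -
  obtain v where v: "t = u + v" "G \<alpha> v \<noteq> \<zero>\<^bsub>K\<^esub>" using t by (rule shift_nonzeroE)
  have T: "xpart v \<in> terms {..n}" "xpart u \<in> terms {..n}" "\<alpha> \<in> terms {..n}"
    using mpoly_term[OF generic_element_closed[OF \<alpha>] v(2)] u heads_terms' \<alpha> by (auto simp: parts_terms)
  show ?thesis
  proof (cases "v = image_mset Inr \<alpha>")
    case False
    then have "degrevorder n prec (xpart v) \<alpha>" using generic_element_tail[OF \<alpha> v(2)] by simp
    then show ?thesis using term_order_add[OF degrev _ T(1,3,2)] v(1) by simp
  qed (use v in simp)
qed

text \<open>The bound holds for the term that is cancelled, hence for the multiple of \<open>G \<alpha>\<close> that is
  subtracted.\<close>

lemma reduction_step_below:
  assumes step: "reduction_step K W eprec (G ` M) h h'" and h: "h \<in> carrier (mpoly K W)"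
    and b: "below l h" and l: "l \<in> terms {..n}"
  shows "h' \<in> carrier (mpoly K W)" "below l h'"
proof -
  obtain \<alpha> u where *: "\<alpha> \<in> M" "u \<in> terms W" "h (u + image_mset Inr \<alpha>) \<noteq> \<zero>\<^bsub>K\<^esub>"
    and h': "h' = (\<lambda>t. h t \<ominus>\<^bsub>K\<^esub> h (u + image_mset Inr \<alpha>) \<otimes>\<^bsub>K\<^esub> shift K u (G \<alpha>) t)"
    using reduction_stepE[OF step h] .
  let ?a = "h (u + image_mset Inr \<alpha>)"
  have a: "?a \<in> carrier K" by (rule mpoly_coeff_closed[OF h])
  have s: "(\<lambda>t. ?a \<otimes>\<^bsub>K\<^esub> shift K u (G \<alpha>) t) \<in> carrier (mpoly K W)"
    by (intro H.mpoly_smult_closed a H.shift_closed *(2) generic_element_closed[OF *(1)])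
  show "h' \<in> carrier (mpoly K W)" unfolding h' by (rule H.mpoly_minus_closed[OF h s])
  have bu: "degrevorder n prec (xpart u + \<alpha>) l" using b *(3) by (force simp: below_def)
  show "below l h'"
    unfolding below_def
  proof (intro allI impI)
    fix t assume "h' t \<noteq> \<zero>\<^bsub>K\<^esub>"
    then have "h t \<noteq> \<zero>\<^bsub>K\<^esub> \<or> shift K u (G \<alpha>) t \<noteq> \<zero>\<^bsub>K\<^esub>"
      unfolding h' using a by (auto simp: H.minus_eq)
    then show "degrevorder n prec (xpart t) l"
    proof
      assume "h t \<noteq> \<zero>\<^bsub>K\<^esub>" then show ?thesis using b by (simp add: below_def)
    next
      assume t: "shift K u (G \<alpha>) t \<noteq> \<zero>\<^bsub>K\<^esub>"
      have T: "xpart t \<in> terms {..n}" "xpart u + \<alpha> \<in> terms {..n}"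
        using mpoly_term[OF H.shift_closed[OF *(2) generic_element_closed[OF *(1)]] t] *(1,2) heads_terms'
        by (auto simp: parts_terms)
      show ?thesis
        using generic_multiple_xpart[OF *(1,2) t] bu term_order_trans[OF degrev _ bu T(1,2) l] by auto
    qed
  qed
qed

text \<open>Head terms are free of \<open>C\<close>, so one that divides the \<open>\<bold>x, x\<^sub>n\<close>-part divides the whole term and permits a
  reduction.\<close>

lemma irreducible_standard:
  assumes irr: "\<nexists>r'. reduction_step K W eprec (G ` M) r r'" and t: "r t \<noteq> \<zero>\<^bsub>K\<^esub>"
  shows "standard M (xpart t)"
  unfolding standard_def
proof (intro ballI notI)
  fix \<alpha> assume \<alpha>: "\<alpha> \<in> M" "\<alpha> \<subseteq># xpart t"
  then obtain m where m: "xpart t = \<alpha> + m" by (auto simp: mset_subset_eq_exists_conv)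
  have "t = (image_mset Inl (cpart t) + image_mset Inr m) + image_mset Inr \<alpha>"
    by (rule parts_eqI) (simp_all add: m)
  then obtain u where u: "t = u + image_mset Inr \<alpha>" by blast
  have "\<exists>r'. reduction_step K W eprec (G ` M) r r'"
    unfolding reduction_step_def
    using \<alpha>(1) t u generic_element_nonzero[OF \<alpha>(1)]
    by (intro exI bexI[of _ "G \<alpha>"] exI[of _ u] conjI)
      (auto simp: head_term_generic_element supp_def)
  then show False using irr by blast
qed

lemma union_image_Inr: "image_mset Inr a \<union># image_mset Inr b = (image_mset Inr (a \<union># b) :: ('c + 'd) multiset)"
proof (rule multiset_eqI)
  fix x :: "'c + 'd"
  have "count (image_mset Inr m) (Inr i :: 'c + 'd) = count m i" for m i
    by (induction m) simp_all
  moreover have "count (image_mset Inr m) (Inl i :: 'c + 'd) = 0" for m :: "'d multiset" and i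
    by (auto simp: count_eq_zero_iff)
  ultimately show "count (image_mset Inr a \<union># image_mset Inr b) x = count (image_mset Inr (a \<union># b)) x"
    by (cases x) simp_all
qed

text \<open>The S-polynomial of \<open>G \<alpha>\<close> and \<open>G \<alpha>'\<close> (see \<open>spoly_eq\<close>), simplified by means of the known head terms
  and head coefficients.\<close>

definition syzygy_poly :: "nat multiset \<Rightarrow> nat multiset \<Rightarrow> (cvar + nat) multiset \<Rightarrow> 'k" where
  "syzygy_poly \<alpha> \<alpha>' = (\<lambda>t. shift K (image_mset Inr (\<alpha> \<union># \<alpha>' - \<alpha>)) (G \<alpha>) t
     \<ominus>\<^bsub>K\<^esub> shift K (image_mset Inr (\<alpha> \<union># \<alpha>' - \<alpha>')) (G \<alpha>') t)"

context
  fixes \<alpha> \<alpha>' assumes \<alpha>: "\<alpha> \<in> M" and \<alpha>': "\<alpha>' \<in> M"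
begin

lemma lcm_terms: "\<alpha> \<union># \<alpha>' \<in> terms {..n}"
  using \<alpha> \<alpha>' heads_terms' by (auto simp: terms_def)

lemma cofactor_terms:
  "image_mset Inr (\<alpha> \<union># \<alpha>' - \<alpha>) \<in> terms W" "image_mset Inr (\<alpha> \<union># \<alpha>' - \<alpha>') \<in> terms W"
  using terms_subset[OF diff_subset_eq_self lcm_terms] join_terms[of "{#}" _ C "{..n}"] by simp_all

lemma cofactor_sum: "\<alpha> \<union># \<alpha>' - \<alpha> + \<alpha> = \<alpha> \<union># \<alpha>'" "\<alpha> \<union># \<alpha>' - \<alpha>' + \<alpha>' = \<alpha> \<union># \<alpha>'"
  by (simp_all add: subset_mset.diff_add)

lemma spoly_eq: "spoly K W eprec (G \<alpha>) (G \<alpha>') = syzygy_poly \<alpha> \<alpha>'"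
proof -
  have d: "image_mset Inr (\<alpha> \<union># \<alpha>') - image_mset Inr \<beta> = (image_mset Inr (\<alpha> \<union># \<alpha>' - \<beta>) :: (cvar + nat) multiset)"
    if "\<beta> \<subseteq># \<alpha> \<union># \<alpha>'" for \<beta>
    using that by (simp add: image_mset_Diff)
  note Gc = generic_element_closed[OF \<alpha>] generic_element_closed[OF \<alpha>']
  have m: "monom K \<one>\<^bsub>K\<^esub> s \<otimes>\<^bsub>mpoly K W\<^esub> G \<beta> = shift K s (G \<beta>)" if "s \<in> terms W" "\<beta> \<in> M" for s \<beta>
    using H.monom_mult[OF _ mpoly_coeff_closed[OF generic_element_closed[OF that(2)]], of "\<one>\<^bsub>K\<^esub>" W s]
      mpoly_coeff_closed[OF H.shift_closed[OF that(1) generic_element_closed[OF that(2)]]] by simp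
  show ?thesis
    unfolding spoly_def Let_def head_term_generic_element[OF \<alpha>] head_term_generic_element[OF \<alpha>']
      head_coeff_generic_element[OF \<alpha>] head_coeff_generic_element[OF \<alpha>'] union_image_Inr syzygy_poly_def
    by (simp add: d m cofactor_terms \<alpha> \<alpha>'
        H.mpoly_minus[OF H.shift_closed[OF cofactor_terms(1) Gc(1)] H.shift_closed[OF cofactor_terms(2) Gc(2)]])
qed

lemma syzygy_poly_closed: "syzygy_poly \<alpha> \<alpha>' \<in> carrier (mpoly K W)"
  unfolding syzygy_poly_def
  by (intro H.mpoly_minus_closed H.shift_closed cofactor_terms generic_element_closed \<alpha> \<alpha>')

lemma syzygy_poly_below: "below (\<alpha> \<union># \<alpha>') (syzygy_poly \<alpha> \<alpha>')"
  unfolding below_def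
proof (intro allI impI)
  let ?u = "image_mset Inr (\<alpha> \<union># \<alpha>' - \<alpha>) :: (cvar + nat) multiset"
  let ?u' = "image_mset Inr (\<alpha> \<union># \<alpha>' - \<alpha>') :: (cvar + nat) multiset"
  let ?l = "image_mset Inr (\<alpha> \<union># \<alpha>') :: (cvar + nat) multiset"
  have l: "?u + image_mset Inr \<alpha> = ?l" "?u' + image_mset Inr \<alpha>' = ?l"
    unfolding image_mset_union[symmetric] cofactor_sum by simp_all
  fix t assume t: "syzygy_poly \<alpha> \<alpha>' t \<noteq> \<zero>\<^bsub>K\<^esub>"
  have "shift K ?u (G \<alpha>) ?l = \<one>\<^bsub>K\<^esub>" "shift K ?u' (G \<alpha>') ?l = \<one>\<^bsub>K\<^esub>"
    using shift_add_term(1)[of K ?u "G \<alpha>" "image_mset Inr \<alpha>"] shift_add_term(1)[of K ?u' "G \<alpha>'" "image_mset Inr \<alpha>'"]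
    unfolding l by (simp_all add: generic_element_head_coeff \<alpha> \<alpha>')
  then have "t \<noteq> ?l" using t by (auto simp: syzygy_poly_def H.minus_eq H.r_neg)
  moreover have "shift K ?u (G \<alpha>) t \<noteq> \<zero>\<^bsub>K\<^esub> \<or> shift K ?u' (G \<alpha>') t \<noteq> \<zero>\<^bsub>K\<^esub>"
    using t by (auto simp: syzygy_poly_def H.minus_eq)
  ultimately show "degrevorder n prec (xpart t) (\<alpha> \<union># \<alpha>')"
    using generic_multiple_xpart[OF \<alpha> cofactor_terms(1), of t] generic_multiple_xpart[OF \<alpha>' cofactor_terms(2), of t]
    unfolding l xpart_Inr cofactor_sum by blast
qed

lemma complete_reduction:
  shows "(reduction_step K W eprec (G ` M))\<^sup>*\<^sup>* (syzygy_poly \<alpha> \<alpha>') (red \<alpha> \<alpha>')"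
    and "\<nexists>r'. reduction_step K W eprec (G ` M) (red \<alpha> \<alpha>') r'"
proof -
  have "is_complete_reduction K W eprec (G ` M) (spoly K W eprec (G \<alpha>) (G \<alpha>')) (red \<alpha> \<alpha>')"
    using red \<alpha> \<alpha>' by (simp add: spoly_complete_reductions_def Let_def all_vars_def minimal_generators_eq)
  then show "(reduction_step K W eprec (G ` M))\<^sup>*\<^sup>* (syzygy_poly \<alpha> \<alpha>') (red \<alpha> \<alpha>')"
    and "\<nexists>r'. reduction_step K W eprec (G ` M) (red \<alpha> \<alpha>') r'"
    unfolding spoly_eq is_complete_reduction_def by (rule conjunct1, rule conjunct2)
qed

end

end

section \<open>Evaluated S-polynomials\<close>

locale evaluated_lifting = lifting_reductions K n H prec precC red + lifting_algebra K n H prec A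
  for K :: "'k ring" and n :: nat and H :: "(nat multiset \<Rightarrow> 'k) set"
    and prec :: "nat multiset \<Rightarrow> nat multiset \<Rightarrow> bool"
    and precC :: "cvar multiset \<Rightarrow> cvar multiset \<Rightarrow> bool"
    and red :: "nat multiset \<Rightarrow> nat multiset \<Rightarrow> (cvar + nat) multiset \<Rightarrow> 'k"
    and A :: "('k, 'a) module" (structure) +
  fixes c :: "cvar \<Rightarrow> 'a"
  assumes c_closed: "v \<in> C \<Longrightarrow> c v \<in> carrier A"
begin

sublocale E: evaluation A K C c
  using algebra finite_cvars c_closed A.is_cring
  by (intro evaluation.intro evaluation_axioms.intro) auto

sublocale L: monic_family A "{..n}" "degrevorder n prec" M "lift c"
  using c_closed by (rule lift_family)

lemma coefficient_family: "coefficient_family c"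
  using c_closed by simp

lemma sc_eq_scalar: "E.sc = scalar"
  by (simp add: E.sc_def[abs_def] scalar_def[abs_def])

lemma eval_generic_element:
  assumes \<alpha>: "\<alpha> \<in> M" shows "E.eval_coeffs (G \<alpha>) = lift c \<alpha>"
proof
  fix m
  have cl: "H.basis \<alpha> m \<in> carrier K" by (rule mpoly_coeff_closed[OF H.basis.F_closed[OF \<alpha>]])
  have last: "H.basis \<alpha> m = \<zero>\<^bsub>K\<^esub>" if "n \<in># m"
    using mpoly_term[OF H.basis.F_closed[OF \<alpha>], of m] that by (cases "H.basis \<alpha> m = \<zero>\<^bsub>K\<^esub>") (auto simp: terms_def)
  have co: "coeff_of_xterm (G \<alpha>) m \<delta> = (if \<delta> = {#} then H.basis \<alpha> m else \<zero>\<^bsub>K\<^esub>)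
      \<oplus>\<^bsub>K\<^esub> (if n \<in># m \<and> (\<alpha>, m - {#n#}) \<in> C \<and> \<delta> = {#(\<alpha>, m - {#n#})#} then \<one>\<^bsub>K\<^esub> else \<zero>\<^bsub>K\<^esub>)" for \<delta>
    unfolding coeff_of_xterm_def generic_element_coeff[OF \<alpha>] is_tail_term_def cpart_join xpart_join ..
  show "E.eval_coeffs (G \<alpha>) m = lift c \<alpha> m"
  proof (cases "n \<in># m \<and> (\<alpha>, m - {#n#}) \<in> C")
    case True
    then have "coeff_of_xterm (G \<alpha>) m = monom K \<one>\<^bsub>K\<^esub> {#(\<alpha>, m - {#n#})#}"
      unfolding fun_eq_iff co monom_def using last by auto
    moreover have "{#(\<alpha>, m - {#n#})#} \<in> terms C" using True by (simp add: terms_def)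
    ultimately show ?thesis
      using True E.eval_term_single[of "(\<alpha>, m - {#n#})"] c_closed
      by (simp add: E.eval_coeffs_def E.eval_poly_monom lift_def)
  next
    case False
    then have "coeff_of_xterm (G \<alpha>) m = monom K (H.basis \<alpha> m) {#}"
      unfolding fun_eq_iff co monom_def using cl by auto
    then have "E.eval_coeffs (G \<alpha>) m = scalar (H.basis \<alpha> m)"
      using cl by (simp add: E.eval_coeffs_def E.eval_poly_monom E.eval_term_empty sc_eq_scalar)
    then show ?thesis using False last by (auto simp: lift_def f_def)
  qed
qed

text \<open>A reduction step subtracts a scalar multiple of a term multiple of some \<open>G \<alpha>\<close>. Evaluated at \<open>c\<close> this is
  a multiple of \<open>lift c \<alpha>\<close>, with head term below \<open>l\<close>; the part of the multiplier that involves
  \<open>C\<close> becomes a scalar.\<close>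

lemma reductions_eval:
  assumes "(reduction_step K W eprec (G ` M))\<^sup>*\<^sup>* h r"
    and h: "h \<in> carrier (mpoly K W)" and b: "below l h" and l: "l \<in> terms {..n}"
  shows "r \<in> carrier (mpoly K W) \<and> below l r \<and>
    (\<lambda>m. E.eval_coeffs h m \<ominus> E.eval_coeffs r m) \<in> lspan A (L.multiples_within (\<lambda>t. degrevorder n prec t l))"
  using assms(1)
proof induction
  case base
  have "E.eval_coeffs h m \<ominus> E.eval_coeffs h m = \<zero>" for m
    using E.eval_coeffs_coeff_closed[OF h, of m] by (simp add: A.minus_eq A.r_neg)
  then show ?case using h b by (simp add: lspan.zero)
next
  case (step p q)
  then have p: "p \<in> carrier (mpoly K W)" "below l p"
    and hp: "(\<lambda>m. E.eval_coeffs h m \<ominus> E.eval_coeffs p m) \<in> lspan A (L.multiples_within (\<lambda>t. degrevorder n prec t l))"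
    by auto
  note q = reduction_step_below[OF step.hyps(2) p l]
  obtain \<alpha> u where \<alpha>: "\<alpha> \<in> M" and u: "u \<in> terms W" and pu: "p (u + image_mset Inr \<alpha>) \<noteq> \<zero>\<^bsub>K\<^esub>"
    and q_eq: "q = (\<lambda>t. p t \<ominus>\<^bsub>K\<^esub> p (u + image_mset Inr \<alpha>) \<otimes>\<^bsub>K\<^esub> shift K u (G \<alpha>) t)"
    using reduction_stepE[OF step.hyps(2) p(1)] .
  let ?a = "p (u + image_mset Inr \<alpha>)" and ?s = "shift K u (G \<alpha>)" and ?e = "E.eval_term (cpart u)"
    and ?b = "shift A (xpart u) (lift c \<alpha>)"
  have a: "?a \<in> carrier K" by (rule mpoly_coeff_closed[OF p(1)])
  note Gc = generic_element_closed[OF \<alpha>]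
  have sc: "?s \<in> carrier (mpoly K W)" by (rule H.shift_closed[OF u Gc])
  have "q = (\<lambda>t. (\<ominus>\<^bsub>K\<^esub> ?a) \<otimes>\<^bsub>K\<^esub> ?s t \<oplus>\<^bsub>K\<^esub> p t)"
    unfolding q_eq using a mpoly_coeff_closed[OF sc] mpoly_coeff_closed[OF p(1)]
    by (simp add: H.minus_eq H.l_minus H.a_comm)
  then have "E.eval_coeffs q = (\<lambda>m. E.sc (\<ominus>\<^bsub>K\<^esub> ?a) \<otimes> (?e \<otimes> ?b m) \<oplus> E.eval_coeffs p m)"
    using E.eval_coeffs_lin[OF _ sc p(1), of "\<ominus>\<^bsub>K\<^esub> ?a"] a E.eval_coeffs_shift[OF u Gc]
    by (simp add: eval_generic_element[OF \<alpha>])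
  moreover have T: "xpart u \<in> terms {..n}" using u by (simp add: parts_terms)
  have "?b \<in> carrier (mpoly A {..n})" using T L.F_closed[OF \<alpha>] by (rule A.shift_closed)
  then have bm: "?b m \<in> carrier A" for m by (rule mpoly_coeff_closed)
  have pm: "E.eval_coeffs p m \<in> carrier A" for m by (rule E.eval_coeffs_coeff_closed[OF p(1)])
  have hm: "E.eval_coeffs h m \<in> carrier A" for m by (rule E.eval_coeffs_coeff_closed[OF h])
  have "E.sc (\<ominus>\<^bsub>K\<^esub> ?a) \<otimes> (?e \<otimes> ?b m) = \<ominus> (E.sc ?a \<otimes> ?e \<otimes> ?b m)" for m
    using a bm[of m] by (simp add: A.l_minus A.m_assoc)
  ultimately have "E.eval_coeffs q = (\<lambda>m. \<ominus> (E.sc ?a \<otimes> ?e \<otimes> ?b m) \<oplus> E.eval_coeffs p m)" by simp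
  moreover have "E.eval_coeffs h m \<ominus> (\<ominus> (E.sc ?a \<otimes> ?e \<otimes> ?b m) \<oplus> E.eval_coeffs p m) =
      (E.sc ?a \<otimes> ?e) \<otimes> ?b m \<oplus> (E.eval_coeffs h m \<ominus> E.eval_coeffs p m)" for m
  proof -
    have "E.sc ?a \<otimes> ?e \<otimes> ?b m \<in> carrier A" using a bm by simp
    then show ?thesis using pm[of m] hm[of m] by algebra
  qed
  moreover have "?b \<in> L.multiples_within (\<lambda>t. degrevorder n prec t l)"
  proof -
    have "degrevorder n prec (xpart u + \<alpha>) l" using p(2) pu by (force simp: below_def)
    then show ?thesis using T \<alpha> by (auto simp: L.multiples_within_def)
  qed
  ultimately show ?case
    using lspan.step[OF hp, of "E.sc ?a \<otimes> ?e" ?b] a q by simp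
qed

definition syzygy :: "nat multiset \<Rightarrow> nat multiset \<Rightarrow> nat multiset \<Rightarrow> 'a" where
  "syzygy \<alpha> \<alpha>' = (\<lambda>m. shift A (\<alpha> \<union># \<alpha>' - \<alpha>) (lift c \<alpha>) m \<ominus> shift A (\<alpha> \<union># \<alpha>' - \<alpha>') (lift c \<alpha>') m)"

context
  fixes \<alpha> \<alpha>' assumes \<alpha>: "\<alpha> \<in> M" and \<alpha>': "\<alpha>' \<in> M"
begin

lemma cofactors: "\<alpha> \<union># \<alpha>' - \<alpha> \<in> terms {..n}" "\<alpha> \<union># \<alpha>' - \<alpha>' \<in> terms {..n}"
  using terms_subset[OF diff_subset_eq_self lcm_terms[OF \<alpha> \<alpha>']] by auto

lemma syzygy_parts_closed:
  "shift A (\<alpha> \<union># \<alpha>' - \<alpha>) (lift c \<alpha>) \<in> carrier (mpoly A {..n})"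
  "shift A (\<alpha> \<union># \<alpha>' - \<alpha>') (lift c \<alpha>') \<in> carrier (mpoly A {..n})"
  using A.shift_closed[OF cofactors(1) L.F_closed[OF \<alpha>]] A.shift_closed[OF cofactors(2) L.F_closed[OF \<alpha>']] .

lemma eval_syzygy_poly: "E.eval_coeffs (syzygy_poly \<alpha> \<alpha>') = syzygy \<alpha> \<alpha>'"
proof -
  let ?u = "image_mset Inr (\<alpha> \<union># \<alpha>' - \<alpha>) :: (cvar + nat) multiset"
  let ?u' = "image_mset Inr (\<alpha> \<union># \<alpha>' - \<alpha>') :: (cvar + nat) multiset"
  note Gc = generic_element_closed[OF \<alpha>] generic_element_closed[OF \<alpha>']
  note uT = cofactor_terms[OF \<alpha> \<alpha>']
  have sc: "shift K ?u (G \<alpha>) \<in> carrier (mpoly K W)" "shift K ?u' (G \<alpha>') \<in> carrier (mpoly K W)"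
    using H.shift_closed[OF uT(1) Gc(1)] H.shift_closed[OF uT(2) Gc(2)] .
  have "syzygy_poly \<alpha> \<alpha>' = (\<lambda>t. (\<ominus>\<^bsub>K\<^esub> \<one>\<^bsub>K\<^esub>) \<otimes>\<^bsub>K\<^esub> shift K ?u' (G \<alpha>') t \<oplus>\<^bsub>K\<^esub> shift K ?u (G \<alpha>) t)"
    unfolding syzygy_poly_def using mpoly_coeff_closed[OF sc(1)] mpoly_coeff_closed[OF sc(2)]
    by (simp add: H.minus_eq H.l_minus H.a_comm)
  then have "E.eval_coeffs (syzygy_poly \<alpha> \<alpha>') = (\<lambda>m. E.sc (\<ominus>\<^bsub>K\<^esub> \<one>\<^bsub>K\<^esub>) \<otimes> E.eval_coeffs (shift K ?u' (G \<alpha>')) m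
      \<oplus> E.eval_coeffs (shift K ?u (G \<alpha>)) m)"
    using E.eval_coeffs_lin[OF _ sc(2) sc(1), of "\<ominus>\<^bsub>K\<^esub> \<one>\<^bsub>K\<^esub>"] by simp
  moreover have "E.eval_coeffs (shift K ?u (G \<alpha>)) = shift A (\<alpha> \<union># \<alpha>' - \<alpha>) (lift c \<alpha>)"
    unfolding E.eval_coeffs_shift[OF uT(1) Gc(1)] eval_generic_element[OF \<alpha>]
    using mpoly_coeff_closed[OF syzygy_parts_closed(1)] by (simp add: E.eval_term_empty)
  moreover have "E.eval_coeffs (shift K ?u' (G \<alpha>')) = shift A (\<alpha> \<union># \<alpha>' - \<alpha>') (lift c \<alpha>')"
    unfolding E.eval_coeffs_shift[OF uT(2) Gc(2)] eval_generic_element[OF \<alpha>']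
    using mpoly_coeff_closed[OF syzygy_parts_closed(2)] by (simp add: E.eval_term_empty)
  ultimately show ?thesis
    unfolding syzygy_def
    using mpoly_coeff_closed[OF syzygy_parts_closed(1)] mpoly_coeff_closed[OF syzygy_parts_closed(2)]
    by (simp add: A.minus_eq A.l_minus A.a_comm)
qed

lemma remainder_facts:
  shows remainder_closed: "red \<alpha> \<alpha>' \<in> carrier (mpoly K W)"
    and remainder_standard: "standard_poly A M (E.eval_coeffs (red \<alpha> \<alpha>'))"
    and remainder_congruent: "(\<lambda>m. syzygy \<alpha> \<alpha>' m \<ominus> E.eval_coeffs (red \<alpha> \<alpha>') m)
      \<in> lspan A (L.multiples_within (\<lambda>t. degrevorder n prec t (\<alpha> \<union># \<alpha>')))"
proof -
  note * = reductions_eval[OF complete_reduction(1)[OF \<alpha> \<alpha>'] syzygy_poly_closed[OF \<alpha> \<alpha>']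
      syzygy_poly_below[OF \<alpha> \<alpha>'] lcm_terms[OF \<alpha> \<alpha>']]
  show "red \<alpha> \<alpha>' \<in> carrier (mpoly K W)" using * by simp
  show "(\<lambda>m. syzygy \<alpha> \<alpha>' m \<ominus> E.eval_coeffs (red \<alpha> \<alpha>') m)
      \<in> lspan A (L.multiples_within (\<lambda>t. degrevorder n prec t (\<alpha> \<union># \<alpha>')))"
    using * by (simp add: eval_syzygy_poly)
  show "standard_poly A M (E.eval_coeffs (red \<alpha> \<alpha>'))"
    unfolding standard_poly_def
  proof (intro allI impI)
    fix m assume "E.eval_coeffs (red \<alpha> \<alpha>') m \<noteq> \<zero>"
    then obtain t where "red \<alpha> \<alpha>' t \<noteq> \<zero>\<^bsub>K\<^esub>" "xpart t = m" using E.eval_coeffs_nonzero by blast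
    then show "standard M m" using irreducible_standard[OF complete_reduction(2)[OF \<alpha> \<alpha>']] by blast
  qed
qed

end

lemma lift_ideal_is_ideal: "ideal (lift_ideal c) (mpoly A {..n})"
  using L.F_closed by (intro ring.genideal_ideal cring.axioms(1) A.mpoly_cring) auto

lemma lift_in_lift_ideal: "\<alpha> \<in> M \<Longrightarrow> lift c \<alpha> \<in> lift_ideal c"
  using L.F_closed ring.genideal_self[OF cring.axioms(1)[OF A.mpoly_cring], of "lift c ` M"] by auto

abbreviation "remainders_vanish \<equiv> (\<forall>\<alpha>\<in>M. \<forall>\<alpha>'\<in>M. E.eval_coeffs (red \<alpha> \<alpha>') = (\<lambda>m. \<zero>))"

text \<open>The evaluated S-polynomial and its difference from the evaluated remainder both lie in the
  ideal, so the evaluated remainder is a standard element of it.\<close>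

lemma remainders_vanish_if:
  assumes std: "\<And>p. p \<in> lift_ideal c \<Longrightarrow> standard_poly A M p \<Longrightarrow> p = (\<lambda>m. \<zero>)"
  shows remainders_vanish
proof (intro ballI)
  fix \<alpha> \<alpha>' assume M: "\<alpha> \<in> M" "\<alpha>' \<in> M"
  note I = lift_ideal_is_ideal
  let ?r = "E.eval_coeffs (red \<alpha> \<alpha>')"
  have S: "syzygy \<alpha> \<alpha>' \<in> lift_ideal c"
    unfolding syzygy_def
    by (intro A.ideal_mpoly_minus[OF I] A.ideal_mpoly_shift[OF I] lift_in_lift_ideal cofactors M)
  have "L.multiples_within (\<lambda>t. degrevorder n prec t (\<alpha> \<union># \<alpha>')) \<subseteq> lift_ideal c"
    using A.ideal_mpoly_shift[OF I lift_in_lift_ideal] by (auto simp: L.multiples_within_def)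
  then have d: "(\<lambda>m. syzygy \<alpha> \<alpha>' m \<ominus> ?r m) \<in> lift_ideal c"
    using A.ideal_lspan_subset[OF I] remainder_congruent[OF M] by blast
  have "?r \<in> carrier (mpoly A {..n})"
    by (rule E.eval_coeffs_closed[OF remainder_closed[OF M]])
  from A.ideal_mpoly_remainder[OF I S this d]
  show "?r = (\<lambda>m. \<zero>)" using remainder_standard[OF M] by (rule std)
qed

text \<open>When the remainders vanish, the S-polynomials have representations below the least common
  multiples of the head terms. Every other coincidence of head terms is a term multiple of one of
  these, so Buchberger's criterion applies.\<close>

lemma standard_in_lift_ideal:
  assumes van: remainders_vanish and p: "p \<in> lift_ideal c" and std: "standard_poly A M p"
  shows "p = (\<lambda>m. \<zero>)"
proof (rule L.buchberger[OF _ p std])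
  fix s \<alpha> s' \<alpha>'
  assume *: "\<alpha> \<in> M" "\<alpha>' \<in> M" "s \<in> terms {..n}" "s' \<in> terms {..n}" "s + \<alpha> = s' + \<alpha>'"
  let ?l = "\<alpha> \<union># \<alpha>'"
  have "?l \<subseteq># s + \<alpha>" 
    using mset_subset_eq_add_right[of \<alpha> s] mset_subset_eq_add_right[of \<alpha>' s'] *(5) by simp
  then obtain v where "s + \<alpha> = ?l + v" unfolding mset_subset_eq_exists_conv ..
  then have v: "s + \<alpha> = v + ?l" by (simp add: add.commute)
  have "s + \<alpha> = (v + (?l - \<alpha>)) + \<alpha>" "s' + \<alpha>' = (v + (?l - \<alpha>')) + \<alpha>'"
    unfolding *(5)[symmetric] v union_assoc cofactor_sum[OF *(1,2)] by simp_all
  then have "s = v + (?l - \<alpha>)" "s' = v + (?l - \<alpha>')" by (simp_all only: add_right_cancel)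
  then have s: "shift A v (shift A (?l - \<alpha>) (lift c \<alpha>)) = shift A s (lift c \<alpha>)"
      "shift A v (shift A (?l - \<alpha>') (lift c \<alpha>')) = shift A s' (lift c \<alpha>')"
    by (simp_all add: A.shift_add)
  have vT: "v \<in> terms {..n}" 
  proof -
    have "s + \<alpha> \<in> terms {..n}" using *(1,3) heads_terms' by auto
    then show ?thesis unfolding v by simp
  qed
  have "syzygy \<alpha> \<alpha>' \<in> lspan A (L.multiples_within (\<lambda>t. degrevorder n prec t ?l))"
  proof -
    have S: "syzygy \<alpha> \<alpha>' \<in> carrier (mpoly A {..n})"
      unfolding syzygy_def by (intro A.mpoly_minus_closed syzygy_parts_closed *)
    have "E.eval_coeffs (red \<alpha> \<alpha>') = (\<lambda>m. \<zero>)" using van *(1,2) by blast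
    then show ?thesis
      using remainder_congruent[OF *(1,2)] mpoly_coeff_closed[OF S] by (simp add: A.minus_eq)
  qed
  then have "shift A v (syzygy \<alpha> \<alpha>') \<in> lspan A (L.multiples_within (\<lambda>t. degrevorder n prec t (s + \<alpha>)))"
  proof induction
    case zero
    then show ?case by (simp add: lspan.zero)
  next
    case (step p a b)
    obtain u \<beta> where b: "b = shift A u (lift c \<beta>)" "u \<in> terms {..n}" "\<beta> \<in> M" "degrevorder n prec (u + \<beta>) ?l"
      using step.hyps(3) by (auto simp: L.multiples_within_def)
    have "degrevorder n prec (v + (u + \<beta>)) (v + ?l)"
      using b heads_terms' vT lcm_terms[OF *(1,2)] by (intro term_order_add[OF degrev]) auto
    then have "shift A v b \<in> L.multiples_within (\<lambda>t. degrevorder n prec t (s + \<alpha>))"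
      using b vT unfolding L.multiples_within_def v mem_Collect_eq
      by (intro exI[of _ "v + u"] exI[of _ \<beta>]) (simp add: A.shift_add union_assoc)
    then show ?case
      unfolding A.shift_lin[OF step.hyps(2)] by (rule lspan.step[OF step.IH step.hyps(2)])
  qed
  then show "(\<lambda>m. shift A s (lift c \<alpha>) m \<ominus> shift A s' (lift c \<alpha>') m)
       \<in> lspan A (L.multiples_within (\<lambda>t. degrevorder n prec t (s + \<alpha>)))"
    unfolding syzygy_def A.shift_minus s .
qed

abbreviation "h0_gens \<equiv> {coeff_of_xterm (red \<alpha> \<alpha>') m | \<alpha> \<alpha>' m.
        \<alpha> \<in> minimal_generators K n prec H \<and> \<alpha>' \<in> minimal_generators K n prec H \<and> m \<in> terms {..n}}"

lemma h0_gens_closed: "h0_gens \<subseteq> carrier E.PC"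
  using E.coeff_of_xterm_closed[OF remainder_closed] by (auto simp: minimal_generators_eq)

text \<open>The generators of \<open>\<hh>\<^sub>0\<close> are the coefficients of the remainders, and the zeros of the evaluation form an
  ideal.\<close>

lemma eval_h0_iff: "(\<forall>p\<in>hh. E.eval_poly p = \<zero>) \<longleftrightarrow> remainders_vanish"
proof
  assume k: "\<forall>p\<in>hh. E.eval_poly p = \<zero>"
  show remainders_vanish
  proof (intro ballI ext)
    fix \<alpha> \<alpha>' m assume M: "\<alpha> \<in> M" "\<alpha>' \<in> M"
    show "E.eval_coeffs (red \<alpha> \<alpha>') m = \<zero>"
    proof (cases "m \<in> terms {..n}")
      case True
      then have "coeff_of_xterm (red \<alpha> \<alpha>') m \<in> h0_gens"
        using M unfolding minimal_generators_eq mem_Collect_eq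
        by (intro exI[of _ \<alpha>] exI[of _ \<alpha>'] exI[of _ m] conjI refl)
      then have "coeff_of_xterm (red \<alpha> \<alpha>') m \<in> hh"
        unfolding h0_def by (rule subsetD[OF ring.genideal_self[OF cring.axioms(1)[OF H.mpoly_cring] h0_gens_closed]])
      then show ?thesis using k unfolding E.eval_coeffs_def by (rule bspec[rotated])
    next
      case False
      have "xpart t \<noteq> m" if "red \<alpha> \<alpha>' t \<noteq> \<zero>\<^bsub>K\<^esub>" for t
        using False mpoly_term[OF remainder_closed[OF M] that] by (auto simp: parts_terms)
      then show ?thesis using E.eval_coeffs_nonzero[of "red \<alpha> \<alpha>'" m] by metis
    qed
  qed
next
  assume van: remainders_vanish
  interpret ev: ring_hom_ring E.PC A E.eval_poly
    by (rule ring_hom_ringI2[OF cring.axioms(1)[OF H.mpoly_cring] A.ring_axioms E.eval_poly_hom])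
  let ?ker = "{p \<in> carrier E.PC. E.eval_poly p \<in> {\<zero>}}"
  have ker: "ideal ?ker E.PC" by (rule ev.ideal_vimage[OF A.zeroideal])
  have "h0_gens \<subseteq> ?ker"
  proof
    fix p assume p: "p \<in> h0_gens"
    then obtain \<alpha> \<alpha>' m where m: "p = coeff_of_xterm (red \<alpha> \<alpha>') m" "\<alpha> \<in> M" "\<alpha>' \<in> M"
      by (auto simp: minimal_generators_eq)
    have "E.eval_poly p = E.eval_coeffs (red \<alpha> \<alpha>') m" by (simp add: E.eval_coeffs_def m(1))
    moreover have "E.eval_coeffs (red \<alpha> \<alpha>') = (\<lambda>m. \<zero>)" by (rule van[rule_format, OF m(2,3)])
    ultimately have "E.eval_poly p = \<zero>" by simp
    then show "p \<in> ?ker" using subsetD[OF h0_gens_closed p] by simp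
  qed
  then have "hh \<subseteq> ?ker"
    unfolding h0_def by (rule ring.genideal_minimal[OF cring.axioms(1)[OF H.mpoly_cring] ker])
  then show "\<forall>p\<in>hh. E.eval_poly p = \<zero>" by auto
qed

lemma lifting_iff_eval_h0: "lift_ideal c \<in> liftings n H A \<longleftrightarrow> (\<forall>p\<in>hh. E.eval_poly p = \<zero>)"
  unfolding eval_h0_iff
proof
  assume I: "lift_ideal c \<in> liftings n H A"
  show remainders_vanish by (rule remainders_vanish_if) (rule standard_in_lifting[OF I])
next
  assume van: remainders_vanish
  show "lift_ideal c \<in> liftings n H A"
    by (rule lift_ideal_lifting[OF coefficient_family]) (rule standard_in_lift_ideal[OF van])
qed

end

section \<open>Quotient algebras\<close>

lemma quot_algebra_simps [simp]:
  "carrier (quot_algebra P I) = carrier (P Quot I)" "mult (quot_algebra P I) = mult (P Quot I)"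
  "one (quot_algebra P I) = one (P Quot I)" "zero (quot_algebra P I) = zero (P Quot I)"
  "add (quot_algebra P I) = add (P Quot I)"
  by (simp_all add: quot_algebra_def)

lemma quot_carrier: "carrier (P Quot I) = (\<lambda>p. I +>\<^bsub>P\<^esub> p) ` carrier P"
  by (auto simp: FactRing_simps)

lemma quot_algebra_cring:
  assumes "cring P" and "ideal I P"
  shows "cring (quot_algebra P I)"
proof -
  interpret Q: cring "P Quot I" by (rule ideal.quotient_is_cring[OF assms(2,1)])
  have "(\<lambda>x. x) \<in> ring_iso (P Quot I) (quot_algebra P I)"
    by (rule ring_iso_memI) (simp_all add: bij_betw_def)
  from Q.ring_iso_imp_img_cring[OF this] show ?thesis by (simp add: quot_algebra_def)
qed

context
  fixes K :: "'k ring" and P :: "('k, 'p) module" and I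
  assumes alg: "algebra K P" and I: "ideal I P"
begin

interpretation P: algebra K P by (rule alg)
interpretation I: ideal I P by (rule I)

lemma quot_algebra_hom: "(\<lambda>p. I +>\<^bsub>P\<^esub> p) \<in> ring_hom P (quot_algebra P I)"
  using I.rcos_ring_hom by (simp add: ring_hom_def)

lemma quot_algebra_smult:
  assumes "k \<in> carrier K" "p \<in> carrier P"
  shows "k \<odot>\<^bsub>quot_algebra P I\<^esub> (I +>\<^bsub>P\<^esub> p) = I +>\<^bsub>P\<^esub> (k \<odot>\<^bsub>P\<^esub> p)"
proof -
  have "k \<odot>\<^bsub>P\<^esub> \<one>\<^bsub>P\<^esub> \<in> carrier P" using assms by simp
  from ring_hom_mult[OF quot_algebra_hom this assms(2)]
  show ?thesis using assms by (simp add: quot_algebra_def P.smult_assoc2)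
qed

lemma quot_algebra_algebra: "algebra K (quot_algebra P I)"
proof (rule algebraI)
  let ?Q = "quot_algebra P I" and ?q = "\<lambda>p. I +>\<^bsub>P\<^esub> p"
  interpret q: ring_hom_cring P ?Q ?q
    by (intro ring_hom_cring.intro ring_hom_cring_axioms.intro algebra.axioms(2)[OF alg] quot_algebra_cring I
        quot_algebra_hom)
  show "cring K" by (rule P.R.is_cring)
  show "cring ?Q" by (rule quot_algebra_cring[OF algebra.axioms(2)[OF alg] I])
  note sm = quot_algebra_smult
  have ex: "\<exists>p\<in>carrier P. x = ?q p" if "x \<in> carrier ?Q" for x
    using that by (auto simp: quot_carrier)
  fix x assume "x \<in> carrier ?Q"
  then obtain p where p: "p \<in> carrier P" "x = ?q p" using ex by blast
  show "\<one>\<^bsub>K\<^esub> \<odot>\<^bsub>?Q\<^esub> x = x" using p by (simp add: sm)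
  fix a assume a: "a \<in> carrier K"
  show "a \<odot>\<^bsub>?Q\<^esub> x \<in> carrier ?Q" unfolding p(2) sm[OF a p(1)] using a p q.hom_closed by simp
  {
    fix b assume b: "b \<in> carrier K"
    show "(a \<oplus>\<^bsub>K\<^esub> b) \<odot>\<^bsub>?Q\<^esub> x = a \<odot>\<^bsub>?Q\<^esub> x \<oplus>\<^bsub>?Q\<^esub> b \<odot>\<^bsub>?Q\<^esub> x"
      unfolding p(2) using a b p by (simp add: sm P.smult_l_distr q.hom_add[symmetric] del: quot_algebra_simps q.hom_add)
    show "(a \<otimes>\<^bsub>K\<^esub> b) \<odot>\<^bsub>?Q\<^esub> x = a \<odot>\<^bsub>?Q\<^esub> (b \<odot>\<^bsub>?Q\<^esub> x)"
      unfolding p(2) using a b p by (simp add: sm P.smult_assoc1)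
  }
  fix y assume "y \<in> carrier ?Q"
  then obtain r where r: "r \<in> carrier P" "y = ?q r" using ex by blast
  show "a \<odot>\<^bsub>?Q\<^esub> (x \<oplus>\<^bsub>?Q\<^esub> y) = a \<odot>\<^bsub>?Q\<^esub> x \<oplus>\<^bsub>?Q\<^esub> a \<odot>\<^bsub>?Q\<^esub> y"
    unfolding p(2) r(2) using a p r by (simp add: sm P.smult_r_distr q.hom_add[symmetric] del: quot_algebra_simps q.hom_add)
  show "(a \<odot>\<^bsub>?Q\<^esub> x) \<otimes>\<^bsub>?Q\<^esub> y = a \<odot>\<^bsub>?Q\<^esub> (x \<otimes>\<^bsub>?Q\<^esub> y)"
    unfolding p(2) r(2) using a p r by (simp add: sm P.smult_assoc2 q.hom_mult[symmetric] del: quot_algebra_simps q.hom_mult)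
qed

text \<open>The preimage of an ideal is finitely generated, and the images of its generators generate the
  ideal.\<close>

lemma quot_algebra_noetherian:
  assumes "noetherian_ring P"
  shows "noetherian_ring (quot_algebra P I)"
proof -
  let ?Q = "quot_algebra P I" and ?q = "\<lambda>p. I +>\<^bsub>P\<^esub> p"
  interpret Q: cring ?Q by (rule quot_algebra_cring[OF algebra.axioms(2)[OF alg] I])
  interpret q: ring_hom_ring P ?Q ?q
    by (rule ring_hom_ringI2[OF cring.axioms(1)[OF algebra.axioms(2)[OF alg]] Q.ring_axioms quot_algebra_hom])
  show ?thesis
  proof (rule Q.noetherian_ringI)
    fix J assume J: "ideal J ?Q"
    have JQ: "J \<subseteq> carrier ?Q" using J by (auto dest: ideal.Icarr)
    obtain B where B: "B \<subseteq> carrier P" "finite B" "{p \<in> carrier P. ?q p \<in> J} = Idl\<^bsub>P\<^esub> B"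
      using noetherian_ring.finetely_gen[OF assms q.ideal_vimage[OF J]] by blast
    have qB: "?q ` B \<subseteq> carrier ?Q" using B(1) q.hom_closed by auto
    note P_ring = cring.axioms(1)[OF algebra.axioms(2)[OF alg]]
    have "B \<subseteq> Idl\<^bsub>P\<^esub> B" by (rule ring.genideal_self[OF P_ring B(1)])
    then have "?q ` B \<subseteq> J" using B(3) by auto
    then have 1: "Idl\<^bsub>?Q\<^esub> (?q ` B) \<subseteq> J" by (rule Q.genideal_minimal[OF J])
    have "B \<subseteq> {p \<in> carrier P. ?q p \<in> Idl\<^bsub>?Q\<^esub> (?q ` B)}" using B(1) Q.genideal_self[OF qB] by auto
    then have "Idl\<^bsub>P\<^esub> B \<subseteq> {p \<in> carrier P. ?q p \<in> Idl\<^bsub>?Q\<^esub> (?q ` B)}"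
      by (rule ring.genideal_minimal[OF P_ring q.ideal_vimage[OF Q.genideal_ideal[OF qB]]])
    then have 2: "J \<subseteq> Idl\<^bsub>?Q\<^esub> (?q ` B)"
      using JQ unfolding B(3)[symmetric] by (auto simp: quot_carrier)
    show "\<exists>A\<subseteq>carrier ?Q. finite A \<and> J = Idl\<^bsub>?Q\<^esub> A"
      using 1 2 qB B(2) by (intro exI[of _ "?q ` B"]) auto
  qed
qed

lemma quot_algebra_induced_hom:
  fixes A :: "('k, 'a) module"
  assumes A: "algebra K A" and h: "h \<in> ring_hom P A"
    and sm: "\<And>k p. k \<in> carrier K \<Longrightarrow> p \<in> carrier P \<Longrightarrow> h (k \<odot>\<^bsub>P\<^esub> p) = k \<odot>\<^bsub>A\<^esub> h p"
    and kill: "\<And>p. p \<in> I \<Longrightarrow> h p = \<zero>\<^bsub>A\<^esub>"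
  shows "\<exists>\<phi>\<in>alg_hom K (quot_algebra P I) A. \<forall>p\<in>carrier P. \<phi> (I +>\<^bsub>P\<^esub> p) = h p"
proof -
  let ?Q = "quot_algebra P I" and ?q = "\<lambda>p. I +>\<^bsub>P\<^esub> p"
  interpret h: ring_hom_cring P A h
    by (intro ring_hom_cring.intro ring_hom_cring_axioms.intro algebra.axioms(2)[OF alg] algebra.axioms(2)[OF A] h)
  interpret q: ring_hom_cring P ?Q ?q
    by (intro ring_hom_cring.intro ring_hom_cring_axioms.intro algebra.axioms(2)[OF alg] quot_algebra_cring I quot_algebra_hom)
  define \<phi> where "\<phi> = restrict (\<lambda>X. h (SOME p. p \<in> X)) (carrier ?Q)"
  have \<phi>: "\<phi> (?q p) = h p" if p: "p \<in> carrier P" for p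
  proof -
    have "p \<in> ?q p" by (rule I.a_rcos_self[OF p])
    then have "(SOME r. r \<in> ?q p) \<in> ?q p" by (rule someI)
    then obtain i where i: "i \<in> I" "(SOME r. r \<in> ?q p) = i \<oplus>\<^bsub>P\<^esub> p" by (auto simp: a_r_coset_def')
    then have "h (SOME r. r \<in> ?q p) = h p" using kill[OF i(1)] p I.Icarr[OF i(1)] by simp
    then show ?thesis using q.hom_closed[OF p] by (simp add: \<phi>_def)
  qed
  have ex: "\<exists>p\<in>carrier P. x = ?q p" if "x \<in> carrier ?Q" for x
    using that by (auto simp: quot_carrier)
  have "\<phi> \<in> ring_hom ?Q A"
  proof (rule ring_hom_memI)
    fix x assume "x \<in> carrier ?Q"
    then obtain p where p: "p \<in> carrier P" "x = ?q p" using ex by blast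
    then show "\<phi> x \<in> carrier A" using \<phi> by simp
    fix y assume "y \<in> carrier ?Q"
    then obtain r where r: "r \<in> carrier P" "y = ?q r" using ex by blast
    show "\<phi> (x \<otimes>\<^bsub>?Q\<^esub> y) = \<phi> x \<otimes>\<^bsub>A\<^esub> \<phi> y" "\<phi> (x \<oplus>\<^bsub>?Q\<^esub> y) = \<phi> x \<oplus>\<^bsub>A\<^esub> \<phi> y"
      unfolding p(2) r(2) q.hom_mult[OF p(1) r(1), symmetric] q.hom_add[OF p(1) r(1), symmetric]
      using p(1) r(1) by (simp_all add: \<phi> del: q.hom_mult q.hom_add quot_algebra_simps)
  next
    have "\<phi> (?q \<one>\<^bsub>P\<^esub>) = \<one>\<^bsub>A\<^esub>"
      using \<phi>[OF monoid.one_closed[OF ring.is_monoid[OF cring.axioms(1)[OF algebra.axioms(2)[OF alg]]]]]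
      by (simp del: q.hom_one quot_algebra_simps)
    then show "\<phi> \<one>\<^bsub>?Q\<^esub> = \<one>\<^bsub>A\<^esub>" unfolding q.hom_one .
  qed
  moreover have "\<phi> (k \<odot>\<^bsub>?Q\<^esub> x) = k \<odot>\<^bsub>A\<^esub> \<phi> x" if k: "k \<in> carrier K" and x: "x \<in> carrier ?Q" for k x
  proof -
    obtain p where p: "p \<in> carrier P" "x = ?q p" using ex x by blast
    then show ?thesis using k quot_algebra_smult[OF k p(1)] \<phi> sm[OF k p(1)] P.smult_closed[OF k p(1)] by simp
  qed
  ultimately have "\<phi> \<in> alg_hom K ?Q A" by (auto simp: alg_hom_def \<phi>_def)
  then show ?thesis using \<phi> by blast
qed

end

section \<open>The trivial lifting\<close>

context lifting_algebra
begin

text \<open>The coefficient of \<open>x\<^sub>n\<^sup>j\<close>, as a polynomial in \<open>\<bold>x\<close>.\<close>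

definition slice :: "nat \<Rightarrow> (nat multiset \<Rightarrow> 'a) \<Rightarrow> nat multiset \<Rightarrow> 'a" where
  "slice j p = (\<lambda>m. if n \<in># m then \<zero> else p (m + replicate_mset j n))"

lemma standard_add_replicate: "standard M (m + replicate_mset j n) \<longleftrightarrow> standard M m"
  by (induction j) simp_all

lemma slice_shift_f:
  assumes "s \<in> terms {..n}" and \<alpha>: "\<alpha> \<in> M"
  shows "slice j (shift A s (f \<alpha>)) \<in> HA"
proof -
  obtain s' where s': "s' \<in> terms {..<n}" "s = s' + replicate_mset (count s n) n"
  proof
    show "filter_mset (\<lambda>i. i \<noteq> n) s \<in> terms {..<n}" using filter_terms_below[OF assms(1)] .
    show "s = filter_mset (\<lambda>i. i \<noteq> n) s + replicate_mset (count s n) n" by (rule multiset_eqI) simp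
  qed
  have "slice j (shift A s (f \<alpha>)) = (if count s n = j then shift A s' (f \<alpha>) else (\<lambda>m. \<zero>))"
  proof
    fix m
    show "slice j (shift A s (f \<alpha>)) m = (if count s n = j then shift A s' (f \<alpha>) else (\<lambda>m. \<zero>)) m"
    proof (cases "shift A s (f \<alpha>) (m + replicate_mset j n) \<noteq> \<zero> \<and> n \<notin># m")
      case True
      then obtain u where u: "m + replicate_mset j n = s + u" "f \<alpha> u \<noteq> \<zero>" by (auto elim: shift_nonzeroE)
      have "n \<notin># u" using f_last[OF \<alpha>, of u] u(2) by blast
      then have j: "count s n = j"
        using arg_cong[OF u(1), of "\<lambda>m. count m n"] True by (simp add: not_in_iff)
      have "m + replicate_mset j n = (s' + replicate_mset j n) + u" using u(1) s'(2) unfolding j by argo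
      also have "\<dots> = (s' + u) + replicate_mset j n" by (simp only: ac_simps)
      finally have "m = s' + u" by (simp only: add_right_cancel)
      then have "shift A s' (f \<alpha>) m = f \<alpha> u" by simp
      moreover have "shift A s (f \<alpha>) (m + replicate_mset j n) = f \<alpha> u" unfolding u(1) by simp
      ultimately show ?thesis using True j by (simp add: slice_def)
    next
      case False
      show ?thesis
      proof (rule ccontr)
        assume ne: "\<not> ?thesis"
        then have j: "count s n = j" and m: "shift A s' (f \<alpha>) m \<noteq> \<zero>"
          using False by (auto simp: slice_def split: if_splits)
        from m obtain u where u: "m = s' + u" "f \<alpha> u \<noteq> \<zero>" by (rule shift_nonzeroE)
        have "n \<notin># u" using f_last[OF \<alpha>, of u] u(2) by blast
        moreover have "n \<notin># s'" using s'(1) by (auto simp: terms_def)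
        ultimately have "n \<notin># m" using u(1) by simp
        moreover have "m + replicate_mset j n = (s' + replicate_mset j n) + u" unfolding u(1) by (simp only: ac_simps)
        then have "m + replicate_mset j n = s + u" using s'(2) unfolding j by argo
        ultimately show False using False u(2) by simp
      qed
    qed
  qed
  then show ?thesis
    using A.ideal_mpoly_zero[OF HA_ideal] A.ideal_mpoly_shift[OF HA_ideal f_in_HA[OF \<alpha>] s'(1)] by simp
qed

text \<open>For \<open>c = 0\<close> the ideal is generated by the \<open>f \<alpha>\<close>, which do not involve \<open>x\<^sub>n\<close>. So the
  coefficients of the powers of \<open>x\<^sub>n\<close> in \<open>p\<close> are standard elements of \<open>H A[\<bold>x]\<close>, hence zero.\<close>

lemma standard_in_trivial_lift:
  assumes p: "p \<in> lift_ideal (\<lambda>_. \<zero>)" and std: "standard_poly A M p"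
  shows "p = (\<lambda>m. \<zero>)"
proof -
  have lf: "lift (\<lambda>_. \<zero>) \<alpha> = f \<alpha>" if "\<alpha> \<in> M" for \<alpha>
    using f_last[OF that] by (auto simp: lift_def)
  have C: "lift (\<lambda>_. \<zero>) ` M \<subseteq> carrier (mpoly A {..n})" using lift_closed[of "\<lambda>_. \<zero>"] by auto
  have "slice j p \<in> HA" for j
    using p unfolding A.Idl_eq_lspan[OF C]
  proof induction
    case zero
    then show ?case using A.ideal_mpoly_zero[OF HA_ideal] by (simp add: slice_def)
  next
    case (step p a b)
    then obtain s \<alpha> where "b = shift A s (f \<alpha>)" "s \<in> terms {..n}" "\<alpha> \<in> M" using lf by auto
    then have "slice j b \<in> HA" by (simp add: slice_shift_f)
    then have "(\<lambda>m. a \<otimes> slice j b m \<oplus> slice j p m) \<in> HA"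
      using step by (intro A.ideal_mpoly_add[OF HA_ideal] A.ideal_mpoly_smult[OF HA_ideal])
    moreover have "slice j (\<lambda>m. a \<otimes> b m \<oplus> p m) = (\<lambda>m. a \<otimes> slice j b m \<oplus> slice j p m)"
      using step.hyps(2) by (auto simp: slice_def)
    ultimately show ?case by simp
  qed
  moreover have "standard_poly A M (slice j p)" for j
    using std by (auto simp: standard_poly_def slice_def standard_add_replicate)
  ultimately have z: "slice j p = (\<lambda>m. \<zero>)" for j by (rule standard_in_HA)
  show ?thesis
  proof
    fix m
    let ?m = "filter_mset (\<lambda>i. i \<noteq> n) m"
    have "?m + replicate_mset (count m n) n = m" by (rule multiset_eqI) simp
    then show "p m = \<zero>" using fun_cong[OF z[of "count m n"], of ?m] by (simp add: slice_def)
  qed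
qed

lemma lift_cong: "(\<And>v. v \<in> cvars K n prec H \<Longrightarrow> c v = d v) \<Longrightarrow> lift c \<alpha> = lift d \<alpha>"
  by (auto simp: lift_def)

end

section \<open>Representability\<close>

lemma alg_homD:
  assumes "\<phi> \<in> alg_hom K A B"
  shows "\<phi> \<in> ring_hom A B" "\<phi> \<in> extensional (carrier A)"
    "\<And>k x. k \<in> carrier K \<Longrightarrow> x \<in> carrier A \<Longrightarrow> \<phi> (k \<odot>\<^bsub>A\<^esub> x) = k \<odot>\<^bsub>B\<^esub> \<phi> x"
  using assms by (auto simp: alg_hom_def)

context lifting_reductions
begin

abbreviation "PC \<equiv> mpoly K C"
abbreviation "RR \<equiv> quot_algebra PC hh"

text \<open>The point with coordinates in \<open>A\<close> that determines a homomorphism on \<open>K[C]/\<hh>\<^sub>0\<close>: the images of the variables.\<close>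

definition coords :: "((cvar multiset \<Rightarrow> 'k) set \<Rightarrow> 'a) \<Rightarrow> cvar \<Rightarrow> 'a" where
  "coords \<phi> v = \<phi> (hh +>\<^bsub>PC\<^esub> monom K \<one>\<^bsub>K\<^esub> {#v#})"

lemma evaluated_liftingI:
  assumes "algebra K A" and "\<And>v. v \<in> C \<Longrightarrow> c v \<in> carrier A"
  shows "evaluated_lifting K n H prec precC red A c"
proof -
  interpret lifting_algebra K n H prec A
    using assms(1) by (intro lifting_algebra.intro lifting_algebra_axioms.intro lifting_problem_axioms)
  show ?thesis
    using assms(2)
    by (intro evaluated_lifting.intro evaluated_lifting_axioms.intro lifting_reductions_axioms lifting_algebra_axioms)
qed

lemma PC_algebra: "algebra K PC"
  by (rule mpoly_algebra[OF H.is_cring])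

lemma PC_ring: "ring PC"
  by (rule cring.axioms(1)[OF H.mpoly_cring])

lemma trivial_evaluation: "evaluated_lifting K n H prec precC red PC (\<lambda>_. \<zero>\<^bsub>PC\<^esub>)"
  by (intro evaluated_liftingI PC_algebra ring.ring_simprules(2) PC_ring)

lemma hh_ideal: "ideal hh PC"
  unfolding h0_def by (rule ring.genideal_ideal[OF PC_ring evaluated_lifting.h0_gens_closed[OF trivial_evaluation]])

text \<open>The evaluation at \<open>C = 0\<close>, with values in \<open>K[C]\<close> itself, kills \<open>\<hh>\<^sub>0\<close> but not 1.\<close>

lemma one_notin_hh: "\<one>\<^bsub>PC\<^esub> \<notin> hh"
proof
  assume one: "\<one>\<^bsub>PC\<^esub> \<in> hh"
  interpret Z: evaluated_lifting K n H prec precC red PC "\<lambda>_. \<zero>\<^bsub>PC\<^esub>" by (rule trivial_evaluation)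
  have van: Z.remainders_vanish
    by (rule Z.remainders_vanish_if) (rule Z.standard_in_trivial_lift)
  have "Z.E.eval_poly \<one>\<^bsub>PC\<^esub> = \<zero>\<^bsub>PC\<^esub>" using Z.eval_h0_iff van one by blast
  moreover have "Z.E.eval_poly \<one>\<^bsub>PC\<^esub> = \<one>\<^bsub>PC\<^esub>" by (rule ring_hom_one[OF Z.E.eval_poly_hom])
  ultimately have "monom K \<one>\<^bsub>K\<^esub> {#} = (\<lambda>m :: cvar multiset. \<zero>\<^bsub>K\<^esub>)" by simp
  from fun_cong[OF this, of "{#}"] show False by (simp add: monom_def)
qed

lemma RR_noetherian: "noetherian_algebra K RR"
  unfolding noetherian_algebra_def
proof (intro conjI)
  show "algebra K RR" by (rule quot_algebra_algebra[OF PC_algebra hh_ideal])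
  show "noetherian_ring RR"
    by (rule quot_algebra_noetherian[OF PC_algebra hh_ideal H.mpoly_noetherian[OF finite_cvars precC]])
  show "\<one>\<^bsub>RR\<^esub> \<noteq> \<zero>\<^bsub>RR\<^esub>"
  proof
    assume "\<one>\<^bsub>RR\<^esub> = \<zero>\<^bsub>RR\<^esub>"
    then have "hh +>\<^bsub>PC\<^esub> \<one>\<^bsub>PC\<^esub> = hh" by (simp add: FactRing_def)
    moreover have "\<one>\<^bsub>PC\<^esub> \<in> hh +>\<^bsub>PC\<^esub> \<one>\<^bsub>PC\<^esub>"
      by (rule abelian_subgroup.a_rcos_self[OF abelian_subgroupI3[OF ideal.axioms(1)[OF hh_ideal] ring.is_abelian_group[OF PC_ring]] ring.ring_simprules(6)[OF PC_ring]])
    ultimately show False using one_notin_hh by simp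
  qed
qed

lemma monom_var_closed: "v \<in> C \<Longrightarrow> monom K \<one>\<^bsub>K\<^esub> {#v#} \<in> carrier PC"
  by (simp add: terms_def)

lemma RR_carrier: "carrier RR = (\<lambda>p. hh +>\<^bsub>PC\<^esub> p) ` carrier PC"
  by (simp add: quot_carrier)

lemma coords_closed:
  assumes "\<phi> \<in> alg_hom K RR A" "v \<in> C" shows "coords \<phi> v \<in> carrier A"
  unfolding coords_def
  by (intro ring_hom_closed[OF alg_homD(1)[OF assms(1)]] ring_hom_closed[OF quot_algebra_hom[OF PC_algebra hh_ideal]]
      monom_var_closed assms(2))

lemma coset_hom:
  assumes A: "algebra K A" and \<phi>: "\<phi> \<in> alg_hom K RR A"
  shows "(\<lambda>p. \<phi> (hh +>\<^bsub>PC\<^esub> p)) \<in> ring_hom PC A"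
  using ring_hom_trans[OF quot_algebra_hom[OF PC_algebra hh_ideal] alg_homD(1)[OF \<phi>]] by (simp add: comp_def)

lemma alg_hom_eval:
  assumes A: "algebra K A" and \<phi>: "\<phi> \<in> alg_hom K RR A"
    and c: "\<And>v. v \<in> C \<Longrightarrow> coords \<phi> v = c v" and p: "p \<in> carrier PC"
  shows "\<phi> (hh +>\<^bsub>PC\<^esub> p) = evaluation.eval_poly A K C c p"
proof -
  have "c v \<in> carrier A" if "v \<in> C" for v using coords_closed[OF \<phi> that] c[OF that] by simp
  then interpret evaluated_lifting K n H prec precC red A c
    by (rule evaluated_liftingI[OF A])
  show ?thesis
  proof (rule E.hom_eq_eval_poly[OF coset_hom[OF A \<phi>] _ _ p])
    fix k p assume kp: "k \<in> carrier K" "p \<in> carrier E.PC"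
    have "hh +>\<^bsub>PC\<^esub> p \<in> carrier RR" using kp(2) unfolding RR_carrier by (rule imageI)
    then show "\<phi> (hh +>\<^bsub>PC\<^esub> (k \<odot>\<^bsub>E.PC\<^esub> p)) = k \<odot>\<^bsub>A\<^esub> \<phi> (hh +>\<^bsub>PC\<^esub> p)"
      unfolding quot_algebra_smult[OF PC_algebra hh_ideal kp, symmetric] by (rule alg_homD(3)[OF \<phi> kp(1)])
  next
    show "\<phi> (hh +>\<^bsub>PC\<^esub> monom K \<one>\<^bsub>K\<^esub> {#v#}) = c v" if "v \<in> C" for v
      using c[OF that] by (simp add: coords_def)
  qed
qed

definition lifting_of :: "('k, 'a) module \<Rightarrow> ((cvar multiset \<Rightarrow> 'k) set \<Rightarrow> 'a) \<Rightarrow> (nat multiset \<Rightarrow> 'a) set" where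
  "lifting_of A \<phi> = Idl\<^bsub>mpoly A {..n}\<^esub> (lifting_algebra.lift K n H prec A (coords \<phi>) ` M)"

text \<open>A homomorphism is evaluation at its coordinates \<open>c\<close>, and \<open>c\<close> can be recovered from the lifting as its only
  family with \<open>lift c \<alpha> \<in> I\<close>; conversely every lifting arises from a \<open>c\<close> at which \<open>\<hh>\<^sub>0\<close> vanishes.\<close>

lemma lifting_of_bij:
  assumes A: "algebra K A"
  shows "bij_betw (lifting_of A) (alg_hom K RR A) (liftings n H A)"
proof -
  interpret lifting_algebra K n H prec A
    using A by (intro lifting_algebra.intro lifting_algebra_axioms.intro lifting_problem_axioms)
  have mem: "lifting_of A \<phi> \<in> liftings n H A" if \<phi>: "\<phi> \<in> alg_hom K RR A" for \<phi>
  proof -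
    interpret evaluated_lifting K n H prec precC red A "coords \<phi>"
      by (rule evaluated_liftingI[OF A coords_closed[OF \<phi>]])
    have "E.eval_poly p = \<zero>\<^bsub>A\<^esub>" if p: "p \<in> hh" for p
    proof -
      have pc: "p \<in> carrier PC" by (rule ideal.Icarr[OF hh_ideal p])
      have "\<phi> (hh +>\<^bsub>PC\<^esub> p) = E.eval_poly p" by (rule alg_hom_eval[OF A \<phi> refl pc])
      moreover have "hh +>\<^bsub>PC\<^esub> p = hh +>\<^bsub>PC\<^esub> \<zero>\<^bsub>PC\<^esub>"
        using ring.quotient_eq_iff_same_a_r_cos[OF PC_ring hh_ideal pc ring.ring_simprules(2)[OF PC_ring]] p
          ring.ring_simprules(15)[OF PC_ring] pc
        by (metis additive_subgroup.a_inv_closed additive_subgroup.zero_closed additive_subgroup.a_closed hh_ideal ideal.axioms(1) a_minus_def)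
      moreover have "\<phi> (hh +>\<^bsub>PC\<^esub> \<zero>\<^bsub>PC\<^esub>) = \<zero>\<^bsub>A\<^esub>"
        by (rule ring_hom_zero[OF coset_hom[OF A \<phi>] PC_ring A.ring_axioms])
      ultimately show ?thesis by simp
    qed
    then show ?thesis unfolding lifting_of_def lifting_iff_eval_h0 by blast
  qed
  have lifts: "\<forall>\<alpha>\<in>M. lift (coords \<phi>) \<alpha> \<in> lifting_of A \<phi>" if \<phi>: "\<phi> \<in> alg_hom K RR A" for \<phi>
  proof -
    interpret evaluated_lifting K n H prec precC red A "coords \<phi>"
      by (rule evaluated_liftingI[OF A coords_closed[OF \<phi>]])
    show ?thesis unfolding lifting_of_def using lift_in_lift_ideal by blast
  qed
  show ?thesis
    unfolding bij_betw_def
  proof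
    show "inj_on (lifting_of A) (alg_hom K RR A)"
    proof (rule inj_onI)
      fix \<phi> \<psi> assume \<phi>: "\<phi> \<in> alg_hom K RR A" and \<psi>: "\<psi> \<in> alg_hom K RR A" and eq: "lifting_of A \<phi> = lifting_of A \<psi>"
      have "coords \<psi> v = coords \<phi> v" if v: "v \<in> C" for v
      proof (rule lift_unique[OF lifting_ideal[OF mem[OF \<phi>]] standard_in_lifting[OF mem[OF \<phi>]] _ _ _ _ v])
        show "\<forall>\<alpha>\<in>M. lift (coords \<psi>) \<alpha> \<in> lifting_of A \<phi>" unfolding eq by (rule lifts[OF \<psi>])
        show "\<forall>\<alpha>\<in>M. lift (coords \<phi>) \<alpha> \<in> lifting_of A \<phi>" by (rule lifts[OF \<phi>])
        show "coefficient_family (coords \<psi>)" using coords_closed[OF \<psi>] by simp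
        show "coefficient_family (coords \<phi>)" using coords_closed[OF \<phi>] by simp
      qed
      then have "\<phi> (hh +>\<^bsub>PC\<^esub> p) = \<psi> (hh +>\<^bsub>PC\<^esub> p)" if "p \<in> carrier PC" for p
        using alg_hom_eval[OF A \<phi> refl that] alg_hom_eval[OF A \<psi> _ that, of "coords \<phi>"] by simp
      then show "\<phi> = \<psi>"
        by (intro extensionalityI[OF alg_homD(2)[OF \<phi>] alg_homD(2)[OF \<psi>]]) (auto simp: quot_carrier)
    qed
    show "lifting_of A ` alg_hom K RR A = liftings n H A"
    proof
      show "lifting_of A ` alg_hom K RR A \<subseteq> liftings n H A" using mem by blast
      show "liftings n H A \<subseteq> lifting_of A ` alg_hom K RR A"
      proof
        fix I assume I: "I \<in> liftings n H A"
        obtain c where c: "coefficient_family c" "\<forall>\<alpha>\<in>M. lift c \<alpha> \<in> I"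
          using lifting_contains_lift[OF I] by (elim exE conjE)
        have Ic: "I = lift_ideal c" by (rule lifting_eq_lift_ideal[OF I c])
        interpret evaluated_lifting K n H prec precC red A c
          using c(1) by (intro evaluated_liftingI[OF A]) simp
        have kill: "E.eval_poly p = \<zero>\<^bsub>A\<^esub>" if "p \<in> hh" for p
          using I that lifting_iff_eval_h0 unfolding Ic by simp
        have "\<exists>\<phi>\<in>alg_hom K RR A. \<forall>p\<in>carrier PC. \<phi> (hh +>\<^bsub>PC\<^esub> p) = E.eval_poly p"
          by (rule quot_algebra_induced_hom[OF PC_algebra hh_ideal A E.eval_poly_hom])
            (fact E.eval_poly_smult, fact kill)
        then obtain \<phi> where \<phi>: "\<phi> \<in> alg_hom K RR A" "\<forall>p\<in>carrier PC. \<phi> (hh +>\<^bsub>PC\<^esub> p) = E.eval_poly p"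
          by (elim bexE)
        have "coords \<phi> v = c v" if v: "v \<in> C" for v
          using \<phi>(2) monom_var_closed[OF v] v c(1)
          by (simp add: coords_def E.eval_poly_monom E.eval_term_single terms_def)
        then have "lift (coords \<phi>) \<alpha> = lift c \<alpha>" for \<alpha> by (rule lift_cong)
        then have "lifting_of A \<phi> = I" unfolding lifting_of_def Ic by simp
        then show "I \<in> lifting_of A ` alg_hom K RR A" using \<phi>(1) by blast
      qed
    qed
  qed
qed

text \<open>A homomorphism \<open>\<psi>\<close> of algebras fixes the scalars, hence maps \<open>lift c \<alpha>\<close> to \<open>lift (\<psi> \<circ> c) \<alpha>\<close>.\<close>

lemma lifting_of_natural:
  assumes A: "algebra K A" and B: "algebra K B"
    and \<phi>: "\<phi> \<in> alg_hom K RR A" and \<psi>: "\<psi> \<in> alg_hom K A B"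
  shows "lifting_of B (compose (carrier RR) \<psi> \<phi>) = liftings_map n A B \<psi> (lifting_of A \<phi>)"
proof -
  interpret A: evaluated_lifting K n H prec precC red A "coords \<phi>"
    by (rule evaluated_liftingI[OF A coords_closed[OF \<phi>]])
  interpret B: lifting_algebra K n H prec B
    using B by (intro lifting_algebra.intro lifting_algebra_axioms.intro lifting_problem_axioms)
  interpret \<psi>: ring_hom_cring A B \<psi>
    by (intro ring_hom_cring.intro ring_hom_cring_axioms.intro A.A.is_cring B.A.is_cring alg_homD(1)[OF \<psi>])
  let ?\<Psi> = "\<lambda>g m. \<psi> (g m)"
  let ?c = "coords (compose (carrier RR) \<psi> \<phi>)"
  have c: "?c v = \<psi> (coords \<phi> v)" if "v \<in> C" for v
    using monom_var_closed[OF that] by (simp add: coords_def compose_def quot_carrier del: mpoly_simps)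
  have sc: "\<psi> (A.scalar k) = B.scalar k" if "k \<in> carrier K" for k
    using alg_homD(3)[OF \<psi> that, of "\<one>\<^bsub>A\<^esub>"] by (simp add: A.scalar_def B.scalar_def)
  have lift: "B.lift ?c \<alpha> = ?\<Psi> (A.lift (coords \<phi>) \<alpha>)" if \<alpha>: "\<alpha> \<in> M" for \<alpha>
    using c sc[OF mpoly_coeff_closed[OF H.basis.F_closed[OF \<alpha>]]]
    by (auto simp: A.lift_def B.lift_def A.f_def B.f_def)
  let ?I = "lifting_of A \<phi>"
  have I: "?I = lspan A (multiples A {..n} (A.lift (coords \<phi>) ` M))"
    unfolding lifting_of_def using A.L.F_closed by (intro A.A.Idl_eq_lspan) auto
  have IC: "?I \<subseteq> carrier (mpoly A {..n})"
    unfolding lifting_of_def using A.A.ideal_mpoly_closed[OF A.lift_ideal_is_ideal] by auto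
  have C1: "?\<Psi> ` ?I \<subseteq> carrier (mpoly B {..n})"
    using IC ring_hom_mpoly_closed[OF A.A.is_cring B.A.is_cring alg_homD(1)[OF \<psi>]] by auto
  have C2: "B.lift ?c ` M \<subseteq> carrier (mpoly B {..n})"
    using lift A.L.F_closed ring_hom_mpoly_closed[OF A.A.is_cring B.A.is_cring alg_homD(1)[OF \<psi>]] by auto
  note B_ring = cring.axioms(1)[OF B.A.mpoly_cring]
  have J: "ideal (Idl\<^bsub>mpoly B {..n}\<^esub> (B.lift ?c ` M)) (mpoly B {..n})"
    by (rule ring.genideal_ideal[OF B_ring C2])
  have "?\<Psi> g \<in> Idl\<^bsub>mpoly B {..n}\<^esub> (B.lift ?c ` M)" if "g \<in> ?I" for g
  proof -
    have "multiples A {..n} (A.lift (coords \<phi>) ` M) \<subseteq> carrier (mpoly A {..n})"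
      using A.L.F_closed by (intro A.A.multiples_closed) auto
    from ring_hom_lspan[OF A.A.is_cring B.A.is_cring alg_homD(1)[OF \<psi>] this]
    have "?\<Psi> g \<in> lspan B (?\<Psi> ` multiples A {..n} (A.lift (coords \<phi>) ` M))"
      using that unfolding I by blast
    moreover have "?\<Psi> ` multiples A {..n} (A.lift (coords \<phi>) ` M) \<subseteq> Idl\<^bsub>mpoly B {..n}\<^esub> (B.lift ?c ` M)"
    proof
      fix p assume "p \<in> ?\<Psi> ` multiples A {..n} (A.lift (coords \<phi>) ` M)"
      then obtain s \<alpha> where p: "p = ?\<Psi> (shift A s (A.lift (coords \<phi>) \<alpha>))" "s \<in> terms {..n}" "\<alpha> \<in> M" by auto
      have "p = shift B s (B.lift ?c \<alpha>)"
        unfolding p(1) lift[OF p(3)] by (rule ring_hom_shift[OF A.A.is_cring B.A.is_cring alg_homD(1)[OF \<psi>]])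
      moreover have "B.lift ?c \<alpha> \<in> Idl\<^bsub>mpoly B {..n}\<^esub> (B.lift ?c ` M)"
        using ring.genideal_self[OF B_ring C2] p(3) by auto
      ultimately show "p \<in> Idl\<^bsub>mpoly B {..n}\<^esub> (B.lift ?c ` M)"
        using B.A.ideal_mpoly_shift[OF J _ p(2)] by simp
    qed
    ultimately show ?thesis using B.A.ideal_lspan_subset[OF J] by blast
  qed
  then have 1: "Idl\<^bsub>mpoly B {..n}\<^esub> (?\<Psi> ` ?I) \<subseteq> Idl\<^bsub>mpoly B {..n}\<^esub> (B.lift ?c ` M)"
    by (intro ring.genideal_minimal[OF B_ring J]) auto
  have "B.lift ?c ` M \<subseteq> ?\<Psi> ` ?I"
  proof
    fix p assume "p \<in> B.lift ?c ` M"
    then obtain \<alpha> where \<alpha>: "p = B.lift ?c \<alpha>" "\<alpha> \<in> M" by (rule imageE)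
    have "A.lift (coords \<phi>) \<alpha> \<in> ?I" unfolding lifting_of_def by (rule A.lift_in_lift_ideal[OF \<alpha>(2)])
    then show "p \<in> ?\<Psi> ` ?I" unfolding \<alpha>(1) lift[OF \<alpha>(2)] by (rule imageI)
  qed
  then have "B.lift ?c ` M \<subseteq> Idl\<^bsub>mpoly B {..n}\<^esub> (?\<Psi> ` ?I)"
    using ring.genideal_self[OF B_ring C1] by (rule subset_trans)
  then have 2: "Idl\<^bsub>mpoly B {..n}\<^esub> (B.lift ?c ` M) \<subseteq> Idl\<^bsub>mpoly B {..n}\<^esub> (?\<Psi> ` ?I)"
    by (intro ring.genideal_minimal[OF B_ring] ring.genideal_ideal[OF B_ring C1])
  show ?thesis
    unfolding liftings_map_def using 1 2 by (simp add: lifting_of_def[of B] subset_antisym)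
qed

end

theorem theorem4p3:
  fixes K :: "'k ring" and n :: nat
    and H :: "(nat multiset \<Rightarrow> 'k) set"
    and prec :: "nat multiset \<Rightarrow> nat multiset \<Rightarrow> bool"
    and precC :: "cvar multiset \<Rightarrow> cvar multiset \<Rightarrow> bool"
    and red :: "nat multiset \<Rightarrow> nat multiset \<Rightarrow> (cvar + nat) multiset \<Rightarrow> 'k"
  assumes "field K"
    and "homogeneous_ideal K {..<n} H"
    and "term_order {..<n} prec"
    and "term_order (cvars K n prec H) precC"
    and "spoly_complete_reductions K n prec precC H red"
  shows "represents K (quot_algebra (mpoly K (cvars K n prec H)) (h0 K n prec H red))
           (liftings n H :: ('k, 'u) module \<Rightarrow> (nat multiset \<Rightarrow> 'u) set set) (liftings_map n)"
proof -
  interpret lifting_reductions K n H prec precC red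
    using assms by (intro lifting_reductions.intro lifting_reductions_axioms.intro lifting_problem.intro)
  show ?thesis
    unfolding represents_def
  proof (intro conjI exI[of _ lifting_of] allI impI ballI)
    show "noetherian_algebra K RR" by (rule RR_noetherian)
  next
    fix A :: "('k, 'u) module" assume "noetherian_algebra K A"
    then show "bij_betw (lifting_of A) (alg_hom K RR A) (liftings n H A)"
      by (intro lifting_of_bij) (simp add: noetherian_algebra_def)
  next
    fix A B :: "('k, 'u) module" and \<phi> \<psi>
    assume "noetherian_algebra K A" "noetherian_algebra K B" "\<phi> \<in> alg_hom K RR A" "\<psi> \<in> alg_hom K A B"
    then show "lifting_of B (compose (carrier RR) \<psi> \<phi>) = liftings_map n A B \<psi> (lifting_of A \<phi>)"
      by (intro lifting_of_natural) (simp_all add: noetherian_algebra_def)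
  qed
qed

end
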